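(* Let $0<T<\infty$ and let $u$ be a solution of the boundary problem in $(0,T)$ (in the sense defined in the context). Then there exists a unique Radon measure $\mu$ on $\mathbf{R}^N$ with $\operatorname{supp}\mu\subset D$ such that $$\lim_{t\to+0}\int_D u(y,t)\phi(y)\,dy=\int_D\phi(y)\,d\mu(y)\qquad\text{for all }\phi\in C_0(\mathbf{R}^N).$$ Furthermore, for any $\delta>0$ there exists $\gamma_1>0$ such that: (1) if $1<p<p_*$, then $\displaystyle\sup_{x\in D}\exp\Big(-(1+\delta)\frac{x_N^2}{4T}\Big)\mu(B(x,T^{1/2}))\le\gamma_1 T^{\frac N2-\frac{1}{2(p-1)}}$; (2) if $p=p_*$, then $\displaystyle\sup_{x\in D}\exp\Big(-(1+\delta)\frac{x_N^2}{4\sigma^2}\Big)\mu(B(x,\sigma))\le\gamma_1\Big[\log\Big(e+\frac{T^{1/2}}{\sigma}\Big)\Big]^{-N}$ for all $0<\sigma<T^{1/2}$; (3) if $p>p_*$, then $\displaystyle\sup_{x\in D}\exp\Big(-(1+\delta)\frac{x_N^2}{4\sigma^2}\Big)\mu(B(x,\sigma))\le\gamma_1\sigma^{N-\frac{1}{p-1}}$ for all $0<\sigma<T^{1/2}$.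
   Context: Let $N\ge1$, $p>1$ and $p_*:=1+\frac1N$. Write $x=(x',x_N)\in\mathbf{R}^{N-1}\times\mathbf{R}$, $\mathbf{R}^N_+=\{x_N>0\}$, $D:=\overline{\mathbf{R}^N_+}$, and identify $\partial\mathbf{R}^N_+$ with $\mathbf{R}^{N-1}$. $B(x,r)$ is the open ball of radius $r$ centered at $x$. Let $\Gamma_N(x,t)=(4\pi t)^{-N/2}e^{-|x|^2/(4t)}$ and $G(x,y,t):=\Gamma_N(x-y,t)+\Gamma_N(x-y_*,t)$ for $x,y\in D$, $t>0$, where $y_*=(y',-y_N)$ (Neumann heat kernel of the half space). The problem is $\partial_tu=\Delta u$ in $\mathbf{R}^N_+\times(0,\infty)$, $\partial_\nu u=u^p$ on $\partial\mathbf{R}^N_+\times(0,\infty)$. A nonnegative continuous function $u$ on $D\times(0,T)$ is a solution of this problem in $(0,T)$ if for every $0<\tau<T$ and $(x,t)\in D\times(\tau,T)$, $$u(x,t)=\int_DG(x,y,t-\tau)u(y,\tau)\,dy+\int_\tau^t\int_{\mathbf{R}^{N-1}}G(x,(y',0),t-s)u(y',0,s)^p\,dy'\,ds.$$ *)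

theory Defs
  imports "HOL-Analysis.Analysis"
begin

text \<open>Points of R^N are vectors real^'n with N = CARD('n); a distinguished index e
  plays the role of the last coordinate x_N.\<close>

definition halfD :: "'n::finite \<Rightarrow> (real^'n) set" where
  "halfD e = {x. 0 \<le> x $ e}"

definition reflect :: "'n::finite \<Rightarrow> real^'n \<Rightarrow> real^'n" where
  "reflect e y = (\<chi> i. if i = e then - (y $ e) else y $ i)"

definition heatGamma :: "real^'n::finite \<Rightarrow> real \<Rightarrow> real" where
  "heatGamma x t = (4 * pi * t) powr (- real CARD('n) / 2) * exp (- (norm x)\<^sup>2 / (4 * t))"

definition neumannG :: "'n::finite \<Rightarrow> real^'n \<Rightarrow> real^'n \<Rightarrow> real \<Rightarrow> real" where
  "neumannG e x y t = heatGamma (x - y) t + heatGamma (x - reflect e y) t"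

text \<open>(N-1)-dimensional Lebesgue measure on the boundary hyperplane {x. x$e = 0},
  i.e. Lebesgue measure on R^(N-1) transported to the boundary (y' \<mapsto> (y',0)).\<close>
definition bdry_measure :: "'n::finite \<Rightarrow> (real^'n) measure" where
  "bdry_measure e = distr (Pi\<^sub>M (UNIV - {e}) (\<lambda>_. lborel)) borel
      (\<lambda>f. \<chi> i. if i = e then 0 else f i)"

text \<open>Solution of u_t = \<Delta>u in R^N_+, \<partial>_\<nu> u = u^p on the boundary, on (0,T).\<close>
definition is_solution :: "'n::finite \<Rightarrow> real \<Rightarrow> real \<Rightarrow> (real^'n \<Rightarrow> real \<Rightarrow> real) \<Rightarrow> bool" where
  "is_solution e p T u \<longleftrightarrow>
     continuous_on (halfD e \<times> {0<..<T}) (\<lambda>(x, t). u x t) \<and>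
     (\<forall>x\<in>halfD e. \<forall>t\<in>{0<..<T}. 0 \<le> u x t) \<and>
     (\<forall>\<tau> t x. 0 < \<tau> \<longrightarrow> \<tau> < t \<longrightarrow> t < T \<longrightarrow> x \<in> halfD e \<longrightarrow>
        ennreal (u x t) =
          (\<integral>\<^sup>+ y. ennreal (indicator (halfD e) y * neumannG e x y (t - \<tau>) * u y \<tau>) \<partial>lborel)
          + (\<integral>\<^sup>+ s. indicator {\<tau><..<t} s *
               (\<integral>\<^sup>+ y. ennreal (neumannG e x y (t - s) * u y s powr p) \<partial>bdry_measure e) \<partial>lborel))"

definition radon_measure :: "(real^'n::finite) measure \<Rightarrow> bool" where
  "radon_measure \<mu> \<longleftrightarrow> sets \<mu> = sets borel \<and> (\<forall>K. compact K \<longrightarrow> emeasure \<mu> K < \<infinity>)"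

definition C0 :: "(real^'n::finite \<Rightarrow> real) set" where
  "C0 = {\<phi>. continuous_on UNIV \<phi> \<and> (\<exists>K. compact K \<and> (\<forall>x. x \<notin> K \<longrightarrow> \<phi> x = 0))}"

definition initial_trace :: "'n::finite \<Rightarrow> (real^'n \<Rightarrow> real \<Rightarrow> real) \<Rightarrow> (real^'n) measure \<Rightarrow> bool" where
  "initial_trace e u \<mu> \<longleftrightarrow> radon_measure \<mu> \<and> emeasure \<mu> (UNIV - halfD e) = 0 \<and>
     (\<forall>\<phi>\<in>C0. ((\<lambda>t. \<integral> y. indicator (halfD e) y * u y t * \<phi> y \<partial>lborel)
                 \<longlongrightarrow> (\<integral> y. \<phi> y \<partial>\<mu>)) (at_right 0))"

end

theory Submission
  imports Defs "HOL-Probability.Distributions"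
begin

text \<open>Existence of the trace: since \<open>u(t) \<ge> S(t - \<tau>) u(\<tau>)\<close> for the Neumann semigroup \<open>S\<close>, and
  \<open>S(h) \<phi> \<ge> \<phi> - \<epsilon> 1\<^sub>K\<close> for small \<open>h\<close> whenever \<open>\<phi> \<ge> 0\<close> is supported in the compact set \<open>K\<close>, the
  integral of \<open>u(t) \<phi>\<close> is increasing in \<open>t\<close> up to arbitrarily small errors and therefore converges
  as \<open>t\<close> tends to 0. The limit is a positive functional, which the Riesz theorem represents by a measure.

  Growth bounds: the linear part of the Duhamel formula turns mass of \<open>\<mu>\<close> in a ball of radius \<open>\<sigma>\<close>
  into a lower bound for \<open>u\<close> on a boundary cylinder of size \<open>\<sigma>\<close>, and the boundary term makes a
  lower bound on such a cylinder double again and again, so that finiteness of \<open>u\<close> limits the mass.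
  For \<open>p = 1 + 1/N\<close> the lower bounds \<open>u \<ge> a\<^sub>k t\<^sup>-\<^sup>N\<^sup>/\<^sup>2\<close> for \<open>t \<ge> 4\<^sup>k \<sigma>\<^sup>2\<close> on cubes of side \<open>\<surd>t\<close> obey
  \<open>a\<^sub>k\<^sub>+\<^sub>1 = a\<^sub>k + c a\<^sub>k\<^sup>p\<close>; they stay bounded up to \<open>4\<^sup>k \<sigma>\<^sup>2 \<approx> T\<close>, which yields the logarithm.\<close>

section \<open>Continuous functions of compact support\<close>

text \<open>The solution is only bounded from below, and on the boundary hyperplane, where the
  nonlinearity lives. A kernel of size h^(-N/2) integrated over a boundary cube of side sqrt h
  leaves h^(-1/2), so a lower bound A kept for a time l produces about A^p sqrt l; equating this
  with 2 A gives the doubling time A^(2-2p). The weight exp(-(1+\<delta>) x_N^2 / (4 \<sigma>^2))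
  pays for two obstacles, each costing a factor q = sqrt(1+\<delta>) in the exponent. The heights of
  points in a ball around x differ from x_N and are compared with it by Young's inequality; and u
  exists only before T while \<sigma>^2 = T is allowed, so the kernel has to be used at times
  between \<sigma>^2/q and \<sigma>^2. Doubling alone settles every p except the critical one, (1)
  being the general estimate at \<sigma> = sqrt T. At p = 1 + 1/N it gives the power 0 of \<sigma>,
  that is, mere boundedness, and the joint effect of all scales between \<sigma>^2 and T has to be
  counted.\<close>

lemma C0_add: "f \<in> C0 \<Longrightarrow> g \<in> C0 \<Longrightarrow> (\<lambda>x. f x + g x) \<in> C0"
proof -
  assume "f \<in> C0" "g \<in> C0"
  then obtain K K' where "compact K" "compact K'" "continuous_on UNIV f" "continuous_on UNIV g"
    "\<And>x. x \<notin> K \<Longrightarrow> f x = 0" "\<And>x. x \<notin> K' \<Longrightarrow> g x = 0"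
    by (auto simp: C0_def)
  then show ?thesis
    unfolding C0_def mem_Collect_eq
    by (intro conjI exI[of _ "K \<union> K'"] continuous_intros) auto
qed

lemma C0_mult_continuous:
  "f \<in> C0 \<Longrightarrow> continuous_on UNIV g \<Longrightarrow> (\<lambda>x. f x * g x) \<in> C0"
  unfolding C0_def by (auto intro: continuous_on_mult)

lemma C0_comp_continuous:
  assumes "f \<in> C0" "continuous_on UNIV h" "h 0 = (0::real)"
  shows "(\<lambda>x. h (f x)) \<in> C0"
  using assms continuous_on_compose2[OF assms(2), of UNIV f] unfolding C0_def by auto

lemma C0_scale: "f \<in> C0 \<Longrightarrow> (\<lambda>x. c * f x) \<in> C0"
  by (rule C0_comp_continuous) (auto intro: continuous_on_mult_left continuous_on_id)

lemma C0_zero: "(\<lambda>x. 0) \<in> C0"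
  unfolding C0_def by auto

lemma C0_diff: "f \<in> C0 \<Longrightarrow> g \<in> C0 \<Longrightarrow> (\<lambda>x. f x - g x) \<in> C0"
  using C0_add[OF _ C0_scale[of g "-1"]] by simp

lemma C0_sum: "(\<And>i. i \<in> I \<Longrightarrow> f i \<in> C0) \<Longrightarrow> (\<lambda>x. \<Sum>i\<in>I. f i x) \<in> C0"
  by (induction I rule: infinite_finite_induct) (auto intro: C0_zero C0_add)

lemma C0_borel_measurable: "f \<in> C0 \<Longrightarrow> f \<in> borel_measurable borel"
  by (auto simp: C0_def intro: borel_measurable_continuous_onI)

lemma C0_bounded:
  fixes f :: "real^'n::finite \<Rightarrow> real"
  assumes "f \<in> C0"
  obtains B where "0 \<le> B" "\<And>x. \<bar>f x\<bar> \<le> B"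
proof -
  obtain K where K: "compact K" "continuous_on UNIV f" "\<And>x. x \<notin> K \<Longrightarrow> f x = 0"
    using assms by (auto simp: C0_def)
  then have "bounded (f ` K)"
    by (intro compact_imp_bounded compact_continuous_image) (auto intro: continuous_on_subset)
  then obtain B where B: "\<And>x. x \<in> K \<Longrightarrow> \<bar>f x\<bar> \<le> B"
    by (auto simp: bounded_iff)
  have "\<bar>f x\<bar> \<le> max 0 B" for x
    using K(3)[of x] B[of x] by (cases "x \<in> K") auto
  then show ?thesis using that[of "max 0 B"] by simp
qed

lemma C0_cutoff:
  fixes K :: "(real^'n::finite) set"
  assumes "bounded K"
  obtains \<psi> where "\<psi> \<in> C0" "\<And>x. 0 \<le> \<psi> x" "\<And>x. \<psi> x \<le> 1" "\<And>x. x \<in> K \<Longrightarrow> \<psi> x = 1"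
proof -
  obtain R where R: "\<And>x. x \<in> K \<Longrightarrow> norm x \<le> R"
    using assms by (auto simp: bounded_iff)
  have "(\<lambda>x::real^'n. max 0 (min 1 (R + 1 - norm x))) \<in> C0"
    unfolding C0_def mem_Collect_eq
    by (intro conjI exI[of _ "cball 0 (R + 1)"] continuous_intros) auto
  then show ?thesis
  proof (rule that)
    show "max 0 (min 1 (R + 1 - norm x)) = 1" if "x \<in> K" for x
      using R[OF that] by simp
  qed auto
qed

text \<open>The distance to the complement, scaled by \<open>k\<close> and truncated at 1, increases
  to the indicator of an open \<open>U\<close>. The whole space is a separate case because
  \<open>infdist\<close> to the empty set is 0.\<close>

definition approx_ind :: "(real^'n::finite) set \<Rightarrow> nat \<Rightarrow> real^'n \<Rightarrow> real" where
  "approx_ind U k x = (if U = UNIV then 1 else min 1 (real k * infdist x (- U)))"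

lemma approx_ind_bounds: "0 \<le> approx_ind U k x" "approx_ind U k x \<le> 1"
  by (auto simp: approx_ind_def infdist_nonneg)

lemma approx_ind_continuous: "continuous_on UNIV (approx_ind U k)"
  unfolding approx_ind_def[abs_def] by (cases "U = UNIV") (simp_all add: continuous_on_min continuous_intros)

lemma approx_ind_mono: "j \<le> k \<Longrightarrow> approx_ind U j x \<le> approx_ind U k x"
  using mult_right_mono[of "real j" "real k" "infdist x (- U)"] infdist_nonneg[of x "- U"]
  unfolding approx_ind_def by (auto simp: min_def)

lemma approx_ind_outside: "x \<notin> U \<Longrightarrow> approx_ind U k x = 0"
  unfolding approx_ind_def by auto

lemma approx_ind_eventually_one:
  assumes "open U" "x \<in> U"
  shows "\<exists>k0. \<forall>k\<ge>k0. approx_ind U k x = 1"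
proof (cases "U = UNIV")
  case False
  then have "infdist x (- U) > 0"
    using assms by (intro infdist_pos_not_in_closed) auto
  then obtain k0 :: nat where k0: "1 \<le> real k0 * infdist x (- U)"
    using ex_less_of_nat_mult[of "infdist x (- U)" 1] by (auto intro: less_imp_le)
  have "approx_ind U k x = 1" if "k \<ge> k0" for k
    using k0 mult_right_mono[of "real k0" "real k" "infdist x (- U)"] that infdist_nonneg[of x "- U"] False
    unfolding approx_ind_def by (auto simp: min_def)
  then show ?thesis by blast
qed (simp add: approx_ind_def)

lemma approx_ind_C0:
  assumes "bounded U"
  shows "approx_ind U k \<in> C0"
proof -
  have "x \<notin> closure U \<Longrightarrow> approx_ind U k x = 0" for x
    using approx_ind_outside[of x U k] closure_subset[of U] by blast
  then show ?thesis
    using assms approx_ind_continuous[of U k] unfolding C0_def mem_Collect_eq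
    by (intro conjI exI[of _ "closure U"]) (simp_all add: compact_closure)
qed

lemma approx_ind_SUP:
  assumes "open U"
  shows "(SUP k. ennreal (approx_ind U k x)) = indicator U x"
proof (cases "x \<in> U")
  case True
  then obtain k0 where "approx_ind U k0 x = 1"
    using approx_ind_eventually_one[OF assms] by blast
  then have "1 \<le> (SUP k. ennreal (approx_ind U k x))"
    by (intro SUP_upper2[of k0]) auto
  moreover have "(SUP k. ennreal (approx_ind U k x)) \<le> 1"
    by (auto intro!: SUP_least simp: approx_ind_bounds)
  ultimately show ?thesis using True by simp
qed (simp add: approx_ind_outside)

text \<open>Monotone convergence; it turns information about integrals of test functions into
  information about measures of open sets.\<close>

lemma nn_integral_approx_ind_SUP:
  assumes "open U" and [simp]: "sets M = sets borel"
  shows "(SUP k. \<integral>\<^sup>+x. ennreal (approx_ind U k x) \<partial>M) = emeasure M U"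
proof -
  have [measurable]: "approx_ind U k \<in> borel_measurable M" for k
    using borel_measurable_continuous_onI[OF approx_ind_continuous[of U k]]
    by (simp add: measurable_cong_sets[OF assms(2) refl])
  have "(SUP k. \<integral>\<^sup>+x. ennreal (approx_ind U k x) \<partial>M) = (\<integral>\<^sup>+x. (SUP k. ennreal (approx_ind U k x)) \<partial>M)"
    by (intro nn_integral_monotone_convergence_SUP[symmetric])
       (auto simp: incseq_def le_fun_def intro!: ennreal_leI approx_ind_mono)
  also have "\<dots> = emeasure M U"
    using assms by (simp add: approx_ind_SUP)
  finally show ?thesis .
qed

lemma radon_C0_integrable:
  assumes "radon_measure M" "f \<in> C0"
  shows "integrable M f"
proof -
  have [simp]: "sets M = sets borel" using assms by (simp add: radon_measure_def)
  obtain K where K: "compact K" "\<And>x. x \<notin> K \<Longrightarrow> f x = 0"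
    using assms by (auto simp: C0_def)
  obtain B where B: "0 \<le> B" "\<And>x. \<bar>f x\<bar> \<le> B"
    using C0_bounded assms(2) by blast
  have [measurable]: "f \<in> borel_measurable M" "K \<in> sets M"
    using C0_borel_measurable[OF assms(2)] K(1)
    by (simp_all add: measurable_def sets_eq_imp_space_eq[of M borel] borel_compact)
  have fin: "emeasure M K < \<infinity>" using assms(1) K(1) by (simp add: radon_measure_def)
  show ?thesis
  proof (rule Bochner_Integration.integrable_bound)
    show "integrable M (\<lambda>x. B * indicator K x)"
      using fin by (intro integrable_mult_right integrable_real_indicator) (auto simp: borel_compact K(1))
    show "AE x in M. norm (f x) \<le> norm (B * indicator K x)"
      using B K(2) by (auto simp: indicator_def)
  qed simp
qed

lemma radon_bounded_finite:
  assumes "radon_measure M" "bounded A"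
  shows "emeasure M A < \<infinity>"
proof -
  have "emeasure M A \<le> emeasure M (closure A)"
    using assms closure_subset by (intro emeasure_mono) (auto simp: radon_measure_def)
  also have "\<dots> < \<infinity>"
    using assms by (auto simp: radon_measure_def)
  finally show ?thesis .
qed

text \<open>Open boxes are stable under intersection, generate the Borel sets and are bounded. On
  each of them the measure is a supremum of integrals of functions in \<open>C0\<close>, where both
  measures agree.\<close>

lemma radon_measure_eqI:
  fixes M M' :: "(real^'n::finite) measure"
  assumes M: "radon_measure M" and M': "radon_measure M'"
    and eq: "\<And>f. f \<in> C0 \<Longrightarrow> (\<integral>x. f x \<partial>M) = (\<integral>x. f x \<partial>M')"
  shows "M = M'"
proof (rule measure_eqI_generator_eq)
  let ?E = "range (\<lambda>(a, b). box a b::(real^'n) set)"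
  have sets: "sets M = sets borel" "sets M' = sets borel"
    using M M' by (auto simp: radon_measure_def)
  show "Int_stable ?E"
    by (auto simp: Int_stable_def box_Int_box)
  show "?E \<subseteq> Pow UNIV" "sets M = sigma_sets UNIV ?E" "sets M' = sigma_sets UNIV ?E"
    by (simp_all add: borel_eq_box sets)
  let ?A = "\<lambda>n::nat. box (- (real n *\<^sub>R One)) (real n *\<^sub>R One) :: (real^'n) set"
  show "range ?A \<subseteq> ?E" "(\<Union>i. ?A i) = UNIV"
    unfolding UN_box_eq_UNIV by auto
  show "emeasure M (?A i) \<noteq> \<infinity>" for i
    using radon_bounded_finite[OF M bounded_box] by (metis less_irrefl)
  show "emeasure M X = emeasure M' X" if "X \<in> ?E" for X
  proof -
    from that have X: "open X" "bounded X" by (auto simp: open_box bounded_box)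
    have "(\<integral>\<^sup>+x. ennreal (approx_ind X k x) \<partial>M) = (\<integral>\<^sup>+x. ennreal (approx_ind X k x) \<partial>M')" for k
      using radon_C0_integrable[OF M approx_ind_C0[OF X(2)]]
        radon_C0_integrable[OF M' approx_ind_C0[OF X(2)]]
      by (simp add: nn_integral_eq_integral approx_ind_bounds eq approx_ind_C0 X(2))
    then show ?thesis
      using nn_integral_approx_ind_SUP[OF X(1) sets(1)] nn_integral_approx_ind_SUP[OF X(1) sets(2)]
      by simp
  qed
qed

section \<open>Riesz representation\<close>

locale positive_C0_functional =
  fixes L :: "(real^'n::finite \<Rightarrow> real) \<Rightarrow> real"
  assumes add: "f \<in> C0 \<Longrightarrow> g \<in> C0 \<Longrightarrow> L (\<lambda>x. f x + g x) = L f + L g"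
    and scale: "f \<in> C0 \<Longrightarrow> L (\<lambda>x. c * f x) = c * L f"
    and nonneg: "f \<in> C0 \<Longrightarrow> (\<And>x. 0 \<le> f x) \<Longrightarrow> 0 \<le> L f"
begin

lemma diff: "f \<in> C0 \<Longrightarrow> g \<in> C0 \<Longrightarrow> L (\<lambda>x. f x - g x) = L f - L g"
  using add[of f "\<lambda>x. (- 1) * g x"] scale[of g "-1"] C0_scale[of g "-1"] by simp

lemma mono: "f \<in> C0 \<Longrightarrow> g \<in> C0 \<Longrightarrow> (\<And>x. f x \<le> g x) \<Longrightarrow> L f \<le> L g"
  using diff[of g f] nonneg[of "\<lambda>x. g x - f x"] C0_diff[of g f] by simp

lemma zero: "L (\<lambda>x. 0) = 0"
  using scale[OF C0_zero, of 0] by simp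

lemma sum: "finite I \<Longrightarrow> (\<And>i. i \<in> I \<Longrightarrow> f i \<in> C0) \<Longrightarrow> L (\<lambda>x. \<Sum>i\<in>I. f i x) = (\<Sum>i\<in>I. L (f i))"
  by (induction I rule: finite_induct) (auto simp: zero add C0_sum)

text \<open>A Dini argument: on the compact support of \<open>f\<close>, finitely many terms of the series already
  dominate \<open>f\<close> up to any given error.\<close>
lemma le_suminf:
  assumes f: "f \<in> C0" and g: "\<And>n. g n \<in> C0" "\<And>n x. 0 \<le> g n x"
    and le: "\<And>x. ennreal (f x) \<le> (\<Sum>n. ennreal (g n x))"
  shows "ennreal (L f) \<le> (\<Sum>n. ennreal (L (g n)))"
proof -
  obtain K where K: "compact K" "\<And>x. x \<notin> K \<Longrightarrow> f x = 0" and cf: "continuous_on UNIV f"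
    using f by (auto simp: C0_def)
  obtain \<psi> where \<psi>: "\<psi> \<in> C0" "\<And>x. 0 \<le> \<psi> x" "\<And>x. \<psi> x \<le> 1" "\<And>x. x \<in> K \<Longrightarrow> \<psi> x = 1"
    using C0_cutoff[OF compact_imp_bounded[OF K(1)]] by blast
  have cg: "continuous_on UNIV (g n)" for n using g(1)[of n] by (simp add: C0_def)
  have main: "ennreal (L f) \<le> (\<Sum>n. ennreal (L (g n))) + ennreal (\<epsilon> * L \<psi>)" if "\<epsilon> > 0" for \<epsilon>
  proof -
    \<comment> \<open>Where the first \<open>k\<close> terms come within \<open>\<epsilon>\<close>
      of \<open>f\<close>. These sets are open and increase with \<open>k\<close>, so one of them
      contains the compact set \<open>K\<close>.\<close>
    define U where "U k = {x. f x - (\<Sum>n<k. g n x) < \<epsilon>}" for k :: nat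
    have "open (U k)" for k
      unfolding U_def by (intro open_Collect_less continuous_intros cf cg)
    moreover have "K \<subseteq> (\<Union>k. U k)"
    proof
      fix x assume "x \<in> K"
      show "x \<in> (\<Union>k. U k)"
      proof (cases "f x < \<epsilon>")
        case True
        then have "x \<in> U 0" by (simp add: U_def)
        then show ?thesis by blast
      next
        case False
        then have "ennreal (f x - \<epsilon>) < ennreal (f x)"
          using \<open>\<epsilon> > 0\<close> by (intro ennreal_lessI) auto
        also have "\<dots> \<le> (\<Sum>n. ennreal (g n x))" by (rule le)
        also have "\<dots> = (SUP k. \<Sum>n<k. ennreal (g n x))"
          by (rule suminf_eq_SUP)
        finally obtain k where "ennreal (f x - \<epsilon>) < (\<Sum>n<k. ennreal (g n x))"
          by (auto simp: less_SUP_iff)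
        also have "\<dots> = ennreal (\<Sum>n<k. g n x)"
          using g(2) by simp
        finally have "f x - \<epsilon> < (\<Sum>n<k. g n x)"
          using False by (subst (asm) ennreal_less_iff) auto
        then have "x \<in> U k" by (simp add: U_def)
        then show ?thesis by blast
      qed
    qed
    ultimately obtain D where D: "finite D" "K \<subseteq> (\<Union>k\<in>D. U k)"
      using compactE_image[OF K(1), of UNIV U] by (metis (no_types, lifting))
    define m where "m = Max (insert 0 D)"
    have U_mono: "U k \<subseteq> U m" if "k \<in> D" for k
    proof -
      have "k \<le> m" using that D(1) by (auto simp: m_def)
      then have "(\<Sum>n<k. g n x) \<le> (\<Sum>n<m. g n x)" for x
        using g(2) by (intro sum_mono2) auto
      then show ?thesis unfolding U_def by (smt (verit) Collect_mono)
    qed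
    \<comment> \<open>The cutoff turns the error into a function of compact support, to which
      \<open>L\<close> applies; a positive constant is not in \<open>C0\<close>.\<close>
    have "f x \<le> (\<Sum>n<m. g n x) + \<epsilon> * \<psi> x" for x
    proof (cases "x \<in> K")
      case True
      then have "x \<in> U m" using D(2) U_mono by blast
      then show ?thesis using True \<psi>(4) by (simp add: U_def)
    next
      case False
      then show ?thesis using K(2) g(2) \<psi>(2) \<open>\<epsilon> > 0\<close> by (auto intro!: add_nonneg_nonneg sum_nonneg)
    qed
    then have "L f \<le> L (\<lambda>x. (\<Sum>n<m. g n x) + \<epsilon> * \<psi> x)"
      by (intro mono f C0_add C0_sum g C0_scale \<psi>)
    also have "\<dots> = (\<Sum>n<m. L (g n)) + \<epsilon> * L \<psi>"
      by (simp add: add C0_sum g C0_scale \<psi> scale sum)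
    finally have "ennreal (L f) \<le> ennreal ((\<Sum>n<m. L (g n)) + \<epsilon> * L \<psi>)"
      by (rule ennreal_leI)
    also have "\<dots> = (\<Sum>n<m. ennreal (L (g n))) + ennreal (\<epsilon> * L \<psi>)"
      using g \<psi> \<open>\<epsilon> > 0\<close>
      by (subst ennreal_plus) (auto intro!: sum_nonneg nonneg mult_nonneg_nonneg sum_ennreal[symmetric])
    also have "\<dots> \<le> (\<Sum>n. ennreal (L (g n))) + ennreal (\<epsilon> * L \<psi>)"
      by (intro add_right_mono sum_le_suminf) auto
    finally show ?thesis .
  qed
  have L\<psi>: "0 \<le> L \<psi>" using \<psi> by (auto intro: nonneg)
  show ?thesis
  proof (rule ennreal_le_epsilon)
    fix r :: real assume "0 < r"
    \<comment> \<open>The denominator \<open>L \<psi> + 1\<close> stays positive when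
      \<open>L \<psi>\<close> is 0.\<close>
    have "ennreal (L f) \<le> (\<Sum>n. ennreal (L (g n))) + ennreal (r / (L \<psi> + 1) * L \<psi>)"
      using \<open>0 < r\<close> L\<psi> by (intro main) auto
    also have "\<dots> \<le> (\<Sum>n. ennreal (L (g n))) + ennreal r"
      using \<open>0 < r\<close> L\<psi> by (intro add_left_mono ennreal_leI) (simp add: field_simps)
    finally show "ennreal (L f) \<le> (\<Sum>n. ennreal (L (g n))) + ennreal r" .
  qed
qed

section \<open>The outer measure of a positive functional\<close>

definition covers :: "(real^'n) set \<Rightarrow> (nat \<Rightarrow> real^'n \<Rightarrow> real) \<Rightarrow> bool" where
  "covers A g \<longleftrightarrow> (\<forall>n. g n \<in> C0 \<and> (\<forall>x. 0 \<le> g n x)) \<and> (\<forall>x\<in>A. 1 \<le> (\<Sum>n. ennreal (g n x)))"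

text \<open>Covering by series of test functions instead of open sets lets \<open>L\<close> enter
  directly, without a preliminary measure of open sets, and makes countable subadditivity a matter
  of merging series.\<close>

definition outer :: "(real^'n) set \<Rightarrow> ennreal" where
  "outer A = (INF g\<in>Collect (covers A). \<Sum>n. ennreal (L (g n)))"

lemma outer_le: "covers A g \<Longrightarrow> outer A \<le> (\<Sum>n. ennreal (L (g n)))"
  unfolding outer_def by (rule INF_lower) simp

lemma outer_mono: "A \<subseteq> B \<Longrightarrow> outer A \<le> outer B"
  unfolding outer_def by (rule INF_superset_mono) (auto simp: covers_def subset_iff)

lemma outer_le_L:
  assumes "f \<in> C0" "\<And>x. 0 \<le> f x" "\<And>x. x \<in> A \<Longrightarrow> 1 \<le> f x"
  shows "outer A \<le> ennreal (L f)"
proof -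
  have s: "(\<Sum>n. ennreal ((if n = (0::nat) then f else (\<lambda>x. 0)) x)) = ennreal (f x)" for x
    by (subst suminf_finite[of "{0}"]) auto
  have "covers A (\<lambda>n. if n = 0 then f else (\<lambda>x. 0))"
    unfolding covers_def s using assms C0_zero by (auto simp: ennreal_ge_1)
  then have "outer A \<le> (\<Sum>n. ennreal (L (if n = (0::nat) then f else (\<lambda>x. 0))))"
    by (rule outer_le)
  also have "\<dots> = ennreal (L f)"
    by (subst suminf_finite[of "{0}"]) (auto simp: zero)
  finally show ?thesis .
qed

text \<open>Every cover of \<open>A\<close> has sum at least 1 on \<open>A\<close> and thus
  dominates \<open>f\<close>, so the Dini argument bounds \<open>L f\<close> by the value of that
  cover.\<close>

lemma L_le_outer:
  assumes "f \<in> C0" "\<And>x. f x \<le> indicator A x"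
  shows "ennreal (L f) \<le> outer A"
  unfolding outer_def
proof (rule INF_greatest)
  fix g assume "g \<in> Collect (covers A)"
  then have g: "\<And>n. g n \<in> C0" "\<And>n x. 0 \<le> g n x" "\<And>x. x \<in> A \<Longrightarrow> 1 \<le> (\<Sum>n. ennreal (g n x))"
    by (auto simp: covers_def)
  show "ennreal (L f) \<le> (\<Sum>n. ennreal (L (g n)))"
  proof (rule le_suminf[OF assms(1) g(1,2)])
    fix x
    show "ennreal (f x) \<le> (\<Sum>n. ennreal (g n x))"
    proof (cases "x \<in> A")
      case True
      then have "ennreal (f x) \<le> 1" using assms(2)[of x] by (simp add: ennreal_le_1)
      then show ?thesis using g(3)[OF True] by (rule order_trans)
    next
      case False
      then show ?thesis using assms(2)[of x] by (simp add: ennreal_neg)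
    qed
  qed
qed

lemma outer_empty: "outer {} = 0"
  using outer_le_L[OF C0_zero, of "{}"] by (simp add: zero)

text \<open>Covers of the \<open>A i\<close> that are optimal up to \<open>r * (1/2)^Suc i\<close>
  are merged into one sequence through the pairing \<open>prod_decode\<close>; the errors add up to
  \<open>r\<close>.\<close>

lemma outer_UN: "outer (\<Union>i. A i) \<le> (\<Sum>i::nat. outer (A i))"
proof (rule ennreal_le_epsilon)
  fix r :: real assume "0 < r" and fin: "(\<Sum>i. outer (A i)) < top"
  have "\<exists>g. covers (A i) g \<and> (\<Sum>n. ennreal (L (g n))) \<le> outer (A i) + ennreal (r * (1/2)^Suc i)" for i
  proof -
    have "outer (A i) < top"
      using fin sum_le_suminf[of "\<lambda>i. outer (A i)" "{i}"] by (simp add: order_le_less_trans)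
    then have "outer (A i) < outer (A i) + ennreal (r * (1/2)^Suc i)"
      using \<open>0 < r\<close> by (cases "outer (A i)") (auto simp: ennreal_plus[symmetric] ennreal_less_iff simp del: ennreal_plus)
    then show ?thesis
      unfolding outer_def[of "A i"] by (subst (asm) Inf_less_iff) (auto intro: less_imp_le)
  qed
  then obtain g where g: "\<And>i. covers (A i) (g i)"
    "\<And>i. (\<Sum>n. ennreal (L (g i n))) \<le> outer (A i) + ennreal (r * (1/2)^Suc i)"
    by metis
  define h where "h k = (case prod_decode k of (i, n) \<Rightarrow> g i n)" for k
  have sums: "(\<Sum>k. F (h k)) = (\<Sum>i. \<Sum>n. F (g i n))" for F :: "_ \<Rightarrow> ennreal"
    using suminf_ennreal_2dimen[of "\<lambda>i. \<Sum>n. F (g i n)" "\<lambda>(i, n). F (g i n)"]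
    by (simp add: h_def split_def o_def)
  have "covers (\<Union>i. A i) h"
    unfolding covers_def
  proof (intro conjI allI ballI)
    show "h n \<in> C0" "0 \<le> h n x" for n x
      using g(1) by (auto simp: h_def covers_def split: prod.split)
    fix x assume "x \<in> (\<Union>i. A i)"
    then obtain i where "x \<in> A i" by blast
    then have "1 \<le> (\<Sum>n. ennreal (g i n x))"
      using g(1)[of i] by (auto simp: covers_def)
    also have "\<dots> \<le> (\<Sum>i. \<Sum>n. ennreal (g i n x))"
      using sum_le_suminf[of "\<lambda>i. \<Sum>n. ennreal (g i n x)" "{i}"] by simp
    also have "\<dots> = (\<Sum>k. ennreal (h k x))"
      using sums[of "\<lambda>f. ennreal (f x)"] by simp
    finally show "1 \<le> (\<Sum>k. ennreal (h k x))" .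
  qed
  then have "outer (\<Union>i. A i) \<le> (\<Sum>k. ennreal (L (h k)))" by (rule outer_le)
  also have "\<dots> = (\<Sum>i. \<Sum>n. ennreal (L (g i n)))"
    by (rule sums)
  also have "\<dots> \<le> (\<Sum>i. outer (A i) + ennreal (r * (1/2)^Suc i))"
    by (intro suminf_le g) auto
  also have "\<dots> = (\<Sum>i. outer (A i)) + (\<Sum>i. ennreal (r * (1/2)^Suc i))"
    by (rule suminf_add[symmetric]) auto
  also have "(\<Sum>i. ennreal (r * (1/2)^Suc i)) = ennreal r"
    using sums_mult[OF power_half_series, of r] \<open>0 < r\<close> by (intro suminf_ennreal_eq) auto
  finally show "outer (\<Union>i. A i) \<le> (\<Sum>i. outer (A i)) + ennreal r" .
qed

lemma outer_measure_space_outer: "outer_measure_space (Pow UNIV) outer"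
  unfolding outer_measure_space_def positive_def increasing_def countably_subadditive_def
  by (auto simp: outer_empty intro: outer_mono outer_UN)

lemma outer_Un: "outer (A \<union> B) \<le> outer A + outer B"
proof -
  define S where "S i = (if i = 0 then A else if i = 1 then B else {})" for i :: nat
  have "outer (A \<union> B) \<le> outer (\<Union>i. S i)"
    by (intro outer_mono) (auto simp: S_def split: if_splits)
  also have "\<dots> \<le> (\<Sum>i. outer (S i))" by (rule outer_UN)
  also have "\<dots> = (\<Sum>i\<in>{0, 1}. outer (S i))"
    by (rule suminf_finite) (auto simp: S_def outer_empty)
  also have "\<dots> = outer A + outer B" by (simp add: S_def)
  finally show ?thesis .
qed

text \<open>The cover \<open>g\<close> of \<open>A\<close> is split as \<open>g f\<^sub>k + g (1 - f\<^sub>k)\<close> with \<open>f\<^sub>k\<close> increasing to the indicator of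
  \<open>U\<close>; the second part covers \<open>A - U\<close>, and the increments \<open>g (f\<^sub>k\<^sub>+\<^sub>1 - f\<^sub>k)\<close> cover \<open>A \<inter> U\<close>.\<close>
lemma outer_split_open:
  assumes "open U"
  shows "outer (A \<inter> U) + outer (A - U) \<le> outer A"
proof (cases "U = UNIV")
  case False
  define f where "f = approx_ind U"
  \<comment> \<open>Starting at 0 lets the increments telescope to \<open>f K\<close>. For
    \<open>U = UNIV\<close> every \<open>approx_ind\<close> is 1, so that case is treated
    apart.\<close>
  have f0: "f 0 x = 0" for x using False by (simp add: f_def approx_ind_def)
  have fb: "0 \<le> f k x" "f k x \<le> 1" for k x by (simp_all add: f_def approx_ind_bounds)
  have fm: "f j x \<le> f k x" if "j \<le> k" for j k x using that by (simp add: f_def approx_ind_mono)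
  have fc: "continuous_on UNIV (f k)" for k by (simp add: f_def approx_ind_continuous)
  show ?thesis
    unfolding outer_def[of A]
  proof (rule INF_greatest)
    fix g assume "g \<in> Collect (covers A)"
    then have g: "\<And>n. g n \<in> C0" "\<And>n x. 0 \<le> g n x" "\<And>x. x \<in> A \<Longrightarrow> 1 \<le> (\<Sum>n. ennreal (g n x))"
      by (auto simp: covers_def)
    have gf: "(\<lambda>x. g n x * f k x) \<in> C0" for n k by (intro C0_mult_continuous g fc)
    have gf': "(\<lambda>x. g n x * (1 - f k x)) \<in> C0" for n k
      by (intro C0_mult_continuous g continuous_on_diff continuous_on_const fc)
    have part1: "(\<Sum>n. ennreal (L (\<lambda>x. g n x * f k x))) + outer (A - U) \<le> (\<Sum>n. ennreal (L (g n)))" for k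
    proof -
      have "covers (A - U) (\<lambda>n x. g n x * (1 - f k x))"
        unfolding covers_def using g(2,3) gf' fb by (auto simp: f_def approx_ind_outside)
      then have "outer (A - U) \<le> (\<Sum>n. ennreal (L (\<lambda>x. g n x * (1 - f k x))))"
        by (rule outer_le)
      then have "(\<Sum>n. ennreal (L (\<lambda>x. g n x * f k x))) + outer (A - U) \<le>
          (\<Sum>n. ennreal (L (\<lambda>x. g n x * f k x)) + ennreal (L (\<lambda>x. g n x * (1 - f k x))))"
        by (subst suminf_add[symmetric]) (auto intro: add_left_mono)
      also have "\<dots> = (\<Sum>n. ennreal (L (g n)))"
      proof (intro arg_cong[where f = suminf] ext)
        fix n
        have "L (g n) = L (\<lambda>x. g n x * f k x + g n x * (1 - f k x))"
          by (intro arg_cong[where f = L] ext) (simp add: algebra_simps)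
        also have "\<dots> = L (\<lambda>x. g n x * f k x) + L (\<lambda>x. g n x * (1 - f k x))"
          by (rule add[OF gf gf'])
        finally show "ennreal (L (\<lambda>x. g n x * f k x)) + ennreal (L (\<lambda>x. g n x * (1 - f k x))) = ennreal (L (g n))"
          using g fb by (subst ennreal_plus[symmetric]) (auto intro!: nonneg gf gf')
      qed
      finally show ?thesis .
    qed
    define d where "d n k x = g n x * (f (Suc k) x - f k x)" for n k x
    have dC: "d n k \<in> C0" "0 \<le> d n k x" for n k x
      unfolding d_def using g fm[of k "Suc k"]
      by (auto intro!: C0_mult_continuous continuous_on_diff fc)
    have dsum: "(\<Sum>k<K. d n k x) = g n x * f K x" for n K x
      by (induction K) (auto simp: d_def f0 algebra_simps)
    have Ldsum: "(\<Sum>k. ennreal (L (d n k))) = (SUP K. ennreal (L (\<lambda>x. g n x * f K x)))" for n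
    proof -
      have "(\<Sum>k<K. ennreal (L (d n k))) = ennreal (L (\<lambda>x. g n x * f K x))" for K
        using dC by (simp add: sum_ennreal nonneg sum[symmetric] dsum)
      then show ?thesis by (simp add: suminf_eq_SUP)
    qed
    define h where "h k = (case prod_decode k of (i, n) \<Rightarrow> d i n)" for k
    have sums: "(\<Sum>k. F (h k)) = (\<Sum>i. \<Sum>n. F (d i n))" for F :: "_ \<Rightarrow> ennreal"
      using suminf_ennreal_2dimen[of "\<lambda>i. \<Sum>n. F (d i n)" "\<lambda>(i, n). F (d i n)"]
      by (simp add: h_def split_def o_def)
    have "covers (A \<inter> U) h"
      unfolding covers_def
    proof (intro conjI allI ballI)
      show "h n \<in> C0" "0 \<le> h n x" for n x
        using dC by (auto simp: h_def split: prod.split)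
      fix x assume x: "x \<in> A \<inter> U"
      then obtain k0 where k0: "f k0 x = 1"
        using approx_ind_eventually_one[OF assms, of x] by (auto simp: f_def)
      have "1 \<le> (\<Sum>n. ennreal (g n x))" using g(3) x by blast
      also have "\<dots> \<le> (\<Sum>n. \<Sum>k. ennreal (d n k x))"
      proof (intro suminf_le)
        fix n
        have "ennreal (g n x) = (\<Sum>k<k0. ennreal (d n k x))"
          using dC(2) by (simp add: sum_ennreal dsum k0)
        also have "\<dots> \<le> (\<Sum>k. ennreal (d n k x))" by (intro sum_le_suminf) auto
        finally show "ennreal (g n x) \<le> (\<Sum>k. ennreal (d n k x))" .
      qed auto
      also have "\<dots> = (\<Sum>k. ennreal (h k x))" using sums[of "\<lambda>f. ennreal (f x)"] by simp
      finally show "1 \<le> (\<Sum>k. ennreal (h k x))" .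
    qed
    then have "outer (A \<inter> U) \<le> (\<Sum>k. ennreal (L (h k)))" by (rule outer_le)
    also have "\<dots> = (\<Sum>n. SUP K. ennreal (L (\<lambda>x. g n x * f K x)))"
      using sums[of "\<lambda>f. ennreal (L f)"] by (simp add: Ldsum)
    \<comment> \<open>Monotonicity in \<open>K\<close> lets the supremum leave the sum;
      \<open>part1\<close> then applies for each fixed \<open>K\<close>.\<close>
    also have "\<dots> = (SUP K. \<Sum>n. ennreal (L (\<lambda>x. g n x * f K x)))"
      using fm g(2) by (intro ennreal_suminf_SUP_eq) (auto simp: incseq_def intro!: ennreal_leI mono gf mult_left_mono)
    finally have "outer (A \<inter> U) + outer (A - U) \<le> (SUP K. \<Sum>n. ennreal (L (\<lambda>x. g n x * f K x))) + outer (A - U)"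
      by (rule add_right_mono)
    also have "\<dots> = (SUP K. (\<Sum>n. ennreal (L (\<lambda>x. g n x * f K x))) + outer (A - U))"
      by (rule ennreal_SUP_add_left[symmetric]) auto
    also have "\<dots> \<le> (\<Sum>n. ennreal (L (g n)))"
      using part1 by (rule SUP_least)
    finally show "outer (A \<inter> U) + outer (A - U) \<le> (\<Sum>n. ennreal (L (g n)))" .
  qed
qed (simp add: outer_empty)

definition riesz_measure :: "(real^'n) measure" where
  "riesz_measure = measure_of UNIV (sets borel) outer"

lemma sets_riesz_measure: "sets riesz_measure = sets borel"
  using sets.sigma_sets_eq[of "borel :: (real^'n) measure"] by (simp add: riesz_measure_def sets_measure_of)

text \<open>Caratheodory's theorem: \<open>outer\<close> is countably additive on the sigma-algebra
  of sets that split every set additively. Open sets do so by \<open>outer_split_open\<close>, hence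
  so do all Borel sets.\<close>

lemma emeasure_riesz_measure:
  assumes "A \<in> sets borel"
  shows "emeasure riesz_measure A = outer A"
proof -
  interpret P: sigma_algebra UNIV "Pow UNIV :: (real^'n) set set" by (rule sigma_algebra_Pow)
  define \<Lambda> where "\<Lambda> = lambda_system UNIV (Pow UNIV) outer"
  have ms: "measure_space UNIV \<Lambda> outer"
    unfolding \<Lambda>_def by (rule P.caratheodory_lemma[OF outer_measure_space_outer])
  have "U \<in> \<Lambda>" if "open U" for U
    unfolding \<Lambda>_def P.lambda_system_eq
  proof (intro CollectI conjI ballI)
    show "outer (x \<inter> U) + outer (x - U) = outer x" for x
      using outer_split_open[OF that, of x] outer_Un[of "x \<inter> U" "x - U"]
      by (intro antisym) (auto simp: Int_Diff_Un)
  qed simp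
  then have sub: "sets borel \<subseteq> \<Lambda>"
    using ms sigma_algebra.sigma_sets_subset[of UNIV \<Lambda> "{S. open S}"]
    by (auto simp: borel_def measure_space_def)
  have "measure_space UNIV (sets borel) outer"
    using ms sub sets.sigma_algebra_axioms[of "borel :: (real^'n) measure"]
    unfolding measure_space_def positive_def countably_additive_def
    by (auto simp: subset_iff)
  then show ?thesis
    using assms unfolding riesz_measure_def
    by (subst emeasure_measure_of_sigma) (auto simp: measure_space_def)
qed

lemma radon_riesz_measure: "radon_measure riesz_measure"
  unfolding radon_measure_def
proof (intro conjI allI impI)
  fix K :: "(real^'n) set" assume K: "compact K"
  obtain \<psi> where \<psi>: "\<psi> \<in> C0" "\<And>x. 0 \<le> \<psi> x" "\<And>x. \<psi> x \<le> 1" "\<And>x. x \<in> K \<Longrightarrow> \<psi> x = 1"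
    using C0_cutoff[OF compact_imp_bounded[OF K]] by blast
  have "emeasure riesz_measure K \<le> ennreal (L \<psi>)"
    using K \<psi> by (subst emeasure_riesz_measure) (auto intro!: outer_le_L simp: borel_compact)
  then show "emeasure riesz_measure K < \<infinity>"
    by (simp add: order_le_less_trans)
qed (rule sets_riesz_measure)

end

section \<open>Comparison of positive functionals through superlevel sets\<close>

lemma positive_C0_functional_integral:
  assumes "radon_measure M"
  shows "positive_C0_functional (\<lambda>f. \<integral>x. f x \<partial>M)"
  by standard (auto simp: radon_C0_integrable[OF assms])

text \<open>Layer-cake argument: \<open>f\<close> is cut into layers of height
  \<open>\<epsilon>\<close>, and the rescaled layer \<open>g j\<close> lies between the indicators
  of consecutive superlevel sets. Bounding \<open>I\<close> by the larger set and \<open>J\<close>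
  by the smaller one differs by a shift of the index, which costs at most \<open>\<epsilon>\<close>
  times the value of \<open>m\<close> where \<open>f\<close> is positive. Two functionals appear so
  that \<open>L\<close> and the integral can exchange roles.\<close>

lemma positive_C0_functional_le:
  assumes I: "positive_C0_functional I" and J: "positive_C0_functional J"
    and upper: "\<And>f A. f \<in> C0 \<Longrightarrow> open A \<Longrightarrow> bounded A \<Longrightarrow> (\<And>x. f x \<le> indicator A x) \<Longrightarrow> I f \<le> m A"
    and lower: "\<And>f A. f \<in> C0 \<Longrightarrow> open A \<Longrightarrow> bounded A \<Longrightarrow> (\<And>x. 0 \<le> f x) \<Longrightarrow> (\<And>x. x \<in> A \<Longrightarrow> 1 \<le> f x) \<Longrightarrow> m A \<le> J f"
    and m: "\<And>A. 0 \<le> m A"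
    and f: "f \<in> C0" "\<And>x. 0 \<le> f x"
  shows "I f \<le> J f"
proof (rule field_le_epsilon)
  interpret I: positive_C0_functional I by fact
  interpret J: positive_C0_functional J by fact
  obtain B where B: "0 \<le> B" "\<And>x. \<bar>f x\<bar> \<le> B" using C0_bounded f(1) by blast
  obtain K where K: "compact K" "continuous_on UNIV f" "\<And>x. x \<notin> K \<Longrightarrow> f x = 0"
    using f(1) by (auto simp: C0_def)
  fix e :: real assume "0 < e"
  define m0 where "m0 = m {x. f x > 0}"
  define \<epsilon> where "\<epsilon> = e / (m0 + 1)"
  have m0: "0 \<le> m0" by (simp add: m0_def m)
  have \<epsilon>: "0 < \<epsilon>" "\<epsilon> * m0 \<le> e"
    using \<open>0 < e\<close> m0 by (auto simp: \<epsilon>_def field_simps)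
  obtain n :: nat where n: "B \<le> real n * \<epsilon>"
    using ex_less_of_nat_mult[OF \<epsilon>(1), of B] by (auto intro: less_imp_le)
  define A where "A j = {x. f x > real j * \<epsilon>}" for j :: nat
  \<comment> \<open>The part of \<open>f\<close> between the heights \<open>j * \<epsilon>\<close>
    and \<open>Suc j * \<epsilon>\<close>, rescaled to height 1.\<close>
  define g where "g j x = min (max (f x / \<epsilon> - real j) 0) 1" for j :: nat and x
  have Ao: "open (A j)" for j
    unfolding A_def using K(2) by (intro open_Collect_less continuous_on_const)
  have Ab: "bounded (A j)" for j
  proof (rule bounded_subset[OF compact_imp_bounded[OF K(1)]])
    show "A j \<subseteq> K"
    proof
      fix x assume "x \<in> A j"
      then have "0 < f x" using \<epsilon>(1) by (simp add: A_def) (smt (verit) mult_nonneg_nonneg of_nat_0_le_iff)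
      then show "x \<in> K" using K(3) by force
    qed
  qed
  have g: "g j \<in> C0" for j
    unfolding g_def by (rule C0_comp_continuous[OF f(1), of "\<lambda>y. min (max (y / \<epsilon> - real j) 0) 1"])
      (use \<epsilon> in \<open>auto intro!: continuous_on_min continuous_on_max continuous_on_diff continuous_on_divide continuous_on_const continuous_on_id\<close>)
  have gA: "g j x \<le> indicator (A j) x" for j x
    using \<epsilon>(1) by (auto simp: g_def A_def indicator_def field_simps)
  have Ag: "1 \<le> g j x" if "x \<in> A (Suc j)" for j x
    using \<epsilon>(1) that by (auto simp: g_def A_def field_simps)
  have g_nn: "0 \<le> g j x" for j x by (simp add: g_def)
  have "(\<Sum>j<k. g j x) = min (f x / \<epsilon>) (real k)" for k x
  proof (induction k)
    case 0
    then show ?case using f(2)[of x] \<epsilon>(1) by simp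
  next
    case (Suc k)
    then show ?case by (auto simp: g_def min_def max_def)
  qed
  moreover have "f x / \<epsilon> \<le> real n" for x
    using B(2)[of x] n \<epsilon>(1) by (simp add: field_simps)
  ultimately have f_eq: "f = (\<lambda>x. \<epsilon> * (\<Sum>j<n. g j x))"
    using \<epsilon>(1) by (auto simp: fun_eq_iff min_def)
  have "I f = \<epsilon> * (\<Sum>j<n. I (g j))"
    by (subst f_eq) (simp add: I.scale I.sum C0_sum g)
  also have "\<dots> \<le> \<epsilon> * (\<Sum>j<n. m (A j))"
    using \<epsilon>(1) by (intro mult_left_mono sum_mono upper g Ao Ab gA) auto
  \<comment> \<open>The shift from \<open>A j\<close> to \<open>A (Suc j)\<close> telescopes,
    leaving only the first and the last superlevel set.\<close>
  also have "(\<Sum>j<n. m (A j)) = (\<Sum>j<n. m (A (Suc j))) + (m (A 0) - m (A n))"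
    using sum_lessThan_telescope[of "\<lambda>j. m (A j)" n] by (simp add: sum_subtractf)
  also have "\<epsilon> * \<dots> \<le> \<epsilon> * ((\<Sum>j<n. J (g j)) + m0)"
    using \<epsilon>(1) m[of "A n"] unfolding m0_def
    by (intro mult_left_mono add_mono sum_mono lower g Ao Ab g_nn Ag) (auto simp: A_def)
  also have "\<dots> = \<epsilon> * (\<Sum>j<n. J (g j)) + \<epsilon> * m0" by (simp add: algebra_simps)
  also have "\<epsilon> * (\<Sum>j<n. J (g j)) = J f"
    using arg_cong[OF f_eq, of J] by (simp add: J.scale J.sum C0_sum g)
  finally show "I f \<le> J f + e" using \<epsilon>(2) by simp
qed

text \<open>\<open>L\<close> and integration against \<open>riesz_measure\<close> are squeezed by
  the same values on bounded open sets, so the comparison works in both directions for nonnegative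
  functions; positive and negative parts give the rest.\<close>

theorem (in positive_C0_functional) riesz_representation:
  assumes f: "f \<in> C0"
  shows "L f = (\<integral>x. f x \<partial>riesz_measure)"
proof -
  let ?M = riesz_measure
  interpret I: positive_C0_functional "\<lambda>f. \<integral>x. f x \<partial>?M"
    by (rule positive_C0_functional_integral[OF radon_riesz_measure])
  have em: "outer A = ennreal (measure ?M A)" if "open A" "bounded A" for A
    using that radon_bounded_finite[OF radon_riesz_measure, of A]
    by (simp add: emeasure_riesz_measure[symmetric] emeasure_eq_ennreal_measure)
  have L1: "L f \<le> measure ?M A" if "f \<in> C0" "open A" "bounded A" "\<And>x. f x \<le> indicator A x" for f A
    using L_le_outer[OF that(1,4)] em[OF that(2,3)] by (simp add: ennreal_le_iff)
  have L2: "measure ?M A \<le> L f"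
    if "f \<in> C0" "open A" "bounded A" "\<And>x. 0 \<le> f x" "\<And>x. x \<in> A \<Longrightarrow> 1 \<le> f x" for f A
    using outer_le_L[of f A] em[OF that(2,3)] nonneg[of f] that(1,4,5) by (simp add: ennreal_le_iff)
  have ind: "integrable ?M (indicat_real A)" "(\<integral>x. indicat_real A x \<partial>?M) = measure ?M A"
    if "open A" "bounded A" for A
    using that radon_bounded_finite[OF radon_riesz_measure, of A] sets_riesz_measure
    by (auto intro!: integrable_real_indicator simp: sets_eq_imp_space_eq[OF sets_riesz_measure])
  have I1: "(\<integral>x. f x \<partial>?M) \<le> measure ?M A"
    if "f \<in> C0" "open A" "bounded A" "\<And>x. f x \<le> indicator A x" for f A
    using integral_mono[OF radon_C0_integrable[OF radon_riesz_measure that(1)] ind(1)[OF that(2,3)] that(4)]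
    by (simp add: ind(2)[OF that(2,3)] sets_eq_imp_space_eq[OF sets_riesz_measure])
  have I2: "measure ?M A \<le> (\<integral>x. f x \<partial>?M)"
    if "f \<in> C0" "open A" "bounded A" "\<And>x. 0 \<le> f x" "\<And>x. x \<in> A \<Longrightarrow> 1 \<le> f x" for f A
    using integral_mono[OF ind(1)[OF that(2,3)] radon_C0_integrable[OF radon_riesz_measure that(1)]] that(4,5)
    by (auto simp: ind(2)[OF that(2,3)] sets_eq_imp_space_eq[OF sets_riesz_measure] indicator_def)
  note L = positive_C0_functional_axioms and I = I.positive_C0_functional_axioms
  have eq: "L g = (\<integral>x. g x \<partial>?M)" if "g \<in> C0" "\<And>x. 0 \<le> g x" for g
    using positive_C0_functional_le[OF L I L1 I2 measure_nonneg that]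
      positive_C0_functional_le[OF I L I1 L2 measure_nonneg that] by (rule antisym)
  have p: "(\<lambda>x. max (f x) 0) \<in> C0" "(\<lambda>x. max (- f x) 0) \<in> C0"
    by (rule C0_comp_continuous[OF f, of "\<lambda>y. max y 0"] C0_comp_continuous[OF f, of "\<lambda>y. max (- y) 0"],
        auto intro!: continuous_on_max continuous_on_minus continuous_on_id continuous_on_const)+
  have "f = (\<lambda>x. max (f x) 0 - max (- f x) 0)" by (auto simp: fun_eq_iff)
  then have "L f = L (\<lambda>x. max (f x) 0 - max (- f x) 0)" by simp
  also have "\<dots> = L (\<lambda>x. max (f x) 0) - L (\<lambda>x. max (- f x) 0)" by (rule diff[OF p])
  also have "\<dots> = (\<integral>x. max (f x) 0 \<partial>?M) - (\<integral>x. max (- f x) 0 \<partial>?M)" by (simp add: eq p)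
  also have "\<dots> = (\<integral>x. max (f x) 0 - max (- f x) 0 \<partial>?M)" by (rule I.diff[OF p, symmetric])
  also have "\<dots> = (\<integral>x. f x \<partial>?M)" by (intro Bochner_Integration.integral_cong) auto
  finally show ?thesis .
qed

section \<open>Lower bounds on boundary cylinders\<close>

text \<open>The embedding pulls the box back to a product of intervals. For N = 1 the product is
  empty and equal to 1: the boundary measure is then the unit mass at the origin.\<close>

lemma emeasure_bdry_measure_box:
  fixes e :: "'n::finite" and a b :: "'n \<Rightarrow> real"
  assumes "\<And>i. i \<noteq> e \<Longrightarrow> a i \<le> b i"
  shows "{y. y $ e = 0 \<and> (\<forall>i. i \<noteq> e \<longrightarrow> a i \<le> y $ i \<and> y $ i \<le> b i)} \<in> sets (bdry_measure e)" (is "?S \<in> _")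
    and "emeasure (bdry_measure e) {y. y $ e = 0 \<and> (\<forall>i. i \<noteq> e \<longrightarrow> a i \<le> y $ i \<and> y $ i \<le> b i)} =
      ennreal (\<Prod>i\<in>UNIV - {e}. b i - a i)"
proof -
  let ?P = "Pi\<^sub>M (UNIV - {e}) (\<lambda>_. lborel :: real measure)"
  let ?\<iota> = "\<lambda>f. (\<chi> i. if i = e then 0 else f i) :: real^'n"
  interpret product_sigma_finite "\<lambda>_. lborel :: real measure"
    by standard
  have "closed ?S"
    by (intro closed_Collect_conj closed_Collect_all closed_Collect_imp closed_Collect_eq closed_Collect_le
        open_Collect_const continuous_on_const continuous_on_component continuous_on_id)
  then have S: "?S \<in> sets borel" by (rule borel_closed)
  then show "?S \<in> sets (bdry_measure e)" by (simp add: bdry_measure_def)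
  have comp: "(\<lambda>f. if i = e then 0 else f i) \<in> borel_measurable ?P" for i
    by (cases "i = e") (auto intro!: measurable_component_singleton)
  have meas: "?\<iota> \<in> measurable ?P borel"
  proof (rule borel_measurable_euclidean_space[THEN iffD2], rule ballI)
    fix k :: "real^'n" assume "k \<in> Basis"
    then obtain i where "k = axis i 1" by (auto simp: Basis_vec_def)
    then show "(\<lambda>x. ?\<iota> x \<bullet> k) \<in> borel_measurable ?P"
      using comp[of i] by (simp add: inner_axis)
  qed
  have "?\<iota> -` ?S \<inter> space ?P = (\<Pi>\<^sub>E i\<in>UNIV - {e}. {a i..b i})"
  proof (rule set_eqI)
    fix f
    have "(\<forall>i. i \<noteq> e \<longrightarrow> a i \<le> ?\<iota> f $ i \<and> ?\<iota> f $ i \<le> b i) \<longleftrightarrow> (\<forall>i\<in>UNIV - {e}. f i \<in> {a i..b i})"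
      by auto
    then show "f \<in> ?\<iota> -` ?S \<inter> space ?P \<longleftrightarrow> f \<in> (\<Pi>\<^sub>E i\<in>UNIV - {e}. {a i..b i})"
      by (simp add: space_PiM PiE_iff)
  qed
  then have "emeasure (bdry_measure e) ?S = emeasure ?P (\<Pi>\<^sub>E i\<in>UNIV - {e}. {a i..b i})"
    unfolding bdry_measure_def using emeasure_distr[OF meas S] by simp
  also have "\<dots> = (\<Prod>i\<in>UNIV - {e}. emeasure lborel {a i..b i})"
    by (rule emeasure_PiM) auto
  also have "\<dots> = (\<Prod>i\<in>UNIV - {e}. ennreal (b i - a i))"
    using assms by (intro prod.cong) auto
  also have "\<dots> = ennreal (\<Prod>i\<in>UNIV - {e}. b i - a i)"
    using assms by (intro prod_ennreal) auto
  finally show "emeasure (bdry_measure e) ?S = ennreal (\<Prod>i\<in>UNIV - {e}. b i - a i)" .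
qed

text \<open>Cubes rather than balls are used on the boundary, because a heat kernel centred at a corner
  of a cube still sees a subcube of comparable size.\<close>
definition bdry_cube :: "'n::finite \<Rightarrow> real^'n \<Rightarrow> real \<Rightarrow> (real^'n) set" where
  "bdry_cube e z r = {y. y $ e = 0 \<and> (\<forall>i. i \<noteq> e \<longrightarrow> \<bar>y $ i - z $ i\<bar> \<le> r)}"

lemma bdry_cube_subset_halfD: "y \<in> bdry_cube e z r \<Longrightarrow> y \<in> halfD e"
  by (simp add: bdry_cube_def halfD_def)

lemma bdry_cube_mono: "r \<le> r' \<Longrightarrow> bdry_cube e z r \<subseteq> bdry_cube e z r'"
  by (force simp: bdry_cube_def)

lemma emeasure_bdry_cube:
  fixes e :: "'n::finite"
  assumes "0 \<le> r"
  shows "bdry_cube e z r \<in> sets (bdry_measure e)"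
    and "emeasure (bdry_measure e) (bdry_cube e z r) = ennreal ((2 * r) ^ (CARD('n) - 1))"
proof -
  have eq: "bdry_cube e z r = {y. y $ e = 0 \<and> (\<forall>i. i \<noteq> e \<longrightarrow> z $ i - r \<le> y $ i \<and> y $ i \<le> z $ i + r)}"
    by (auto simp: bdry_cube_def abs_le_iff algebra_simps)
  show "bdry_cube e z r \<in> sets (bdry_measure e)"
    unfolding eq by (rule emeasure_bdry_measure_box) (use assms in auto)
  show "emeasure (bdry_measure e) (bdry_cube e z r) = ennreal ((2 * r) ^ (CARD('n) - 1))"
    unfolding eq by (subst emeasure_bdry_measure_box) (use assms in \<open>auto simp: card_Diff_singleton\<close>)
qed

lemma nn_integral_ge_const_mult_emeasure:
  assumes "S \<in> sets M" "\<And>x. x \<in> S \<Longrightarrow> c \<le> f x"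
  shows "c * emeasure M S \<le> (\<integral>\<^sup>+x. f x \<partial>M)"
proof -
  have "c * emeasure M S = (\<integral>\<^sup>+x. c * indicator S x \<partial>M)"
    using assms(1) by (rule nn_integral_cmult_indicator[symmetric])
  also have "\<dots> \<le> (\<integral>\<^sup>+x. f x \<partial>M)"
    using assms(2) by (intro nn_integral_mono) (auto simp: indicator_def)
  finally show ?thesis .
qed

lemma norm_sq_le_card:
  fixes x :: "real^'n::finite"
  assumes "\<And>i. (x $ i)\<^sup>2 \<le> B"
  shows "(norm x)\<^sup>2 \<le> real CARD('n) * B"
proof -
  have "(norm x)\<^sup>2 = (\<Sum>i\<in>UNIV. (x $ i)\<^sup>2)"
    by (simp add: norm_vec_def L2_set_def sum_nonneg)
  also have "\<dots> \<le> (\<Sum>i\<in>(UNIV::'n set). B)" by (intro sum_mono assms)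
  finally show ?thesis by simp
qed

section \<open>Pointwise kernel bounds and boundary integrals at short times\<close>

lemma heatGamma_nonneg: "0 \<le> heatGamma x t"
  by (simp add: heatGamma_def)

lemma neumannG_nonneg: "0 \<le> neumannG e x y t"
  by (simp add: neumannG_def heatGamma_nonneg)

lemma neumannG_ge_heatGamma: "heatGamma (x - y) t \<le> neumannG e x y t"
  by (simp add: neumannG_def heatGamma_nonneg)

text \<open>The prefactor decreases in time and may be taken at the later time \<open>t\<close>,
  while the exponent is controlled at \<open>h\<close>; this gives bounds that are uniform over a
  time interval.\<close>

lemma heatGamma_ge:
  fixes v :: "real^'n::finite"
  assumes "0 < h" "h \<le> t" "(norm v)\<^sup>2 / (4 * h) \<le> R"
  shows "(4 * pi * t) powr (- real CARD('n) / 2) * exp (- R) \<le> heatGamma v h"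
  unfolding heatGamma_def using assms
  by (intro mult_mono powr_mono2') auto

text \<open>The kernel at time \<open>h\<close> and distance \<open>sqrt (N * h)\<close>, with its
  factor \<open>h powr (- N / 2)\<close> removed.\<close>

definition cube_const :: "'n::finite itself \<Rightarrow> real" where
  "cube_const _ = (4 * pi) powr (- real CARD('n) / 2) * exp (- real CARD('n) / 4)"

lemma cube_const_pos: "0 < cube_const TYPE('n::finite)"
  by (simp add: cube_const_def)

text \<open>A boundary subcube of side \<open>sqrt h\<close> has area
  \<open>h powr ((N - 1) / 2)\<close>, against a kernel of size \<open>h powr (- N / 2)\<close>. The
  boundary is one dimension short, so \<open>h powr (- 1 / 2)\<close> survives.\<close>

lemma bdry_cube_heat_lower:
  fixes x z :: "real^'n::finite"
  assumes x: "x \<in> bdry_cube e z r" and h: "0 < h" "h \<le> r\<^sup>2" and r: "0 < r"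
    and f: "\<And>y. y \<in> bdry_cube e z r \<Longrightarrow> B \<le> f y" and B: "0 \<le> B"
  shows "ennreal (cube_const TYPE('n) * h powr (- 1 / 2) * B) \<le>
    (\<integral>\<^sup>+y. ennreal (neumannG e x y h * f y) \<partial>bdry_measure e)"
proof -
  \<comment> \<open>\<open>x\<close> is a vertex of the subcube, which extends towards
    \<open>z\<close> in every coordinate along the boundary and stays inside the cube since
    \<open>sqrt h \<le> r\<close>.\<close>
  define a where "a i = (if x $ i \<ge> z $ i then x $ i - sqrt h else x $ i)" for i
  define b where "b i = a i + sqrt h" for i
  define S where "S = {y. y $ e = 0 \<and> (\<forall>i. i \<noteq> e \<longrightarrow> a i \<le> y $ i \<and> y $ i \<le> b i)}"
  define N where "N = CARD('n)"
  have N: "N \<ge> 1" by (simp add: N_def Suc_leI)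
  have sh: "0 < sqrt h" "sqrt h \<le> r"
    using h r by (auto simp: real_le_lsqrt)
  have Q: "y \<in> bdry_cube e z r" if "y \<in> S" for y
    using that x sh unfolding S_def a_def b_def bdry_cube_def by (auto split: if_splits) (smt (verit))+
  have near: "(norm (x - y))\<^sup>2 \<le> N * h" if "y \<in> S" for y
    unfolding N_def
  proof (rule norm_sq_le_card)
    fix i
    have "\<bar>(x - y) $ i\<bar> \<le> sqrt h"
    proof (cases "i = e")
      case True
      then show ?thesis using that x sh by (simp add: S_def bdry_cube_def)
    next
      case False
      then have "a i \<le> y $ i" "y $ i \<le> a i + sqrt h" using that by (auto simp: S_def b_def)
      then show ?thesis by (auto simp: a_def split: if_splits)
    qed
    then show "((x - y) $ i)\<^sup>2 \<le> h"
      using h(1) abs_le_square_iff[of "(x - y) $ i" "sqrt h"] sh(1) by simp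
  qed
  have G: "(4 * pi * h) powr (- real N / 2) * exp (- real N / 4) \<le> neumannG e x y h" if "y \<in> S" for y
  proof -
    have "(norm (x - y))\<^sup>2 / (4 * h) \<le> real N / 4"
      using near[OF that] h(1) by (simp add: field_simps)
    from heatGamma_ge[OF h(1) order_refl this] show ?thesis
      using neumannG_ge_heatGamma[of x y h e] by (simp add: N_def)
  qed
  let ?c = "(4 * pi * h) powr (- real N / 2) * exp (- real N / 4) * B"
  have S: "S \<in> sets (bdry_measure e)" "emeasure (bdry_measure e) S = ennreal (sqrt h ^ (N - 1))"
    unfolding S_def using sh
    by (subst emeasure_bdry_measure_box | auto simp: b_def N_def card_Diff_singleton intro!: emeasure_bdry_measure_box)+
  have hp: "h powr (- real N / 2) * sqrt h ^ (N - 1) = h powr (- 1 / 2)"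
  proof -
    have "sqrt h ^ (N - 1) = h powr ((real N - 1) / 2)"
      using h(1) N by (simp add: powr_half_sqrt[symmetric] powr_realpow[symmetric] powr_powr of_nat_diff)
    then have "h powr (- real N / 2) * sqrt h ^ (N - 1) = h powr (- real N / 2 + (real N - 1) / 2)"
      by (simp only: powr_add)
    also have "- real N / 2 + (real N - 1) / 2 = - 1 / 2" by (simp add: field_simps)
    finally show ?thesis .
  qed
  have "cube_const TYPE('n) * h powr (- 1 / 2) * B = ?c * sqrt h ^ (N - 1)"
    unfolding hp[symmetric] using h(1) by (simp add: cube_const_def N_def powr_mult mult_ac)
  then have "ennreal (cube_const TYPE('n) * h powr (- 1 / 2) * B) = ennreal (?c * sqrt h ^ (N - 1))"
    by (rule arg_cong)
  also have "\<dots> = ennreal ?c * emeasure (bdry_measure e) S"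
    using B sh unfolding S(2) by (subst ennreal_mult) simp_all
  also have "\<dots> \<le> (\<integral>\<^sup>+y. ennreal (neumannG e x y h * f y) \<partial>bdry_measure e)"
    using B by (intro nn_integral_ge_const_mult_emeasure S(1) ennreal_leI mult_mono G f Q)
      (auto simp: neumannG_nonneg)
  finally show ?thesis .
qed

section \<open>The boundary term on parabolic cylinders\<close>

lemma solution_nonneg: "is_solution e p T u \<Longrightarrow> x \<in> halfD e \<Longrightarrow> 0 < t \<Longrightarrow> t < T \<Longrightarrow> 0 \<le> u x t"
  by (simp add: is_solution_def)

lemma solution_duhamel:
  assumes "is_solution e p T u" "0 < \<tau>" "\<tau> < t" "t < T" "x \<in> halfD e"
  shows "ennreal (u x t) =
     (\<integral>\<^sup>+ y. ennreal (indicator (halfD e) y * neumannG e x y (t - \<tau>) * u y \<tau>) \<partial>lborel)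
     + (\<integral>\<^sup>+ s. indicator {\<tau><..<t} s *
          (\<integral>\<^sup>+ y. ennreal (neumannG e x y (t - s) * u y s powr p) \<partial>bdry_measure e) \<partial>lborel)"
  using assms unfolding is_solution_def by blast

text \<open>Only the boundary part of the Duhamel formula is kept. There
  \<open>(t - \<tau>) powr (- 1 / 2)\<close> is at least \<open>(t - s) powr (- 1 / 2)\<close>,
  which the length \<open>t - s\<close> of the interval turns into a square root.\<close>

lemma solution_cylinder_step:
  fixes u :: "real^'n::finite \<Rightarrow> real \<Rightarrow> real"
  assumes sol: "is_solution e p T u" and p: "0 \<le> p"
    and t: "0 < s" "s < t" "t < T" "t - s \<le> r\<^sup>2" and r: "0 < r" and A: "0 \<le> A"
    and le: "\<And>y \<tau>. y \<in> bdry_cube e z r \<Longrightarrow> s \<le> \<tau> \<Longrightarrow> \<tau> < t \<Longrightarrow> A \<le> u y \<tau>"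
    and x: "x \<in> bdry_cube e z r"
  shows "cube_const TYPE('n) * A powr p * sqrt (t - s) \<le> u x t"
proof -
  let ?c = "cube_const TYPE('n) * (t - s) powr (- 1 / 2) * A powr p"
  let ?I = "\<lambda>\<tau>. \<integral>\<^sup>+ y. ennreal (neumannG e x y (t - \<tau>) * u y \<tau> powr p) \<partial>bdry_measure e"
  have "(t - s) powr (- 1 / 2) * (t - s) = sqrt (t - s)"
    using powr_add[of "t - s" "- 1 / 2" 1] t by (simp add: powr_half_sqrt)
  then have "cube_const TYPE('n) * A powr p * sqrt (t - s) = ?c * (t - s)"
    by (simp add: mult_ac)
  then have "ennreal (cube_const TYPE('n) * A powr p * sqrt (t - s)) = ennreal (?c * (t - s))"
    by (rule arg_cong)
  also have "\<dots> = ennreal ?c * emeasure lborel {s<..<t}"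
    using t cube_const_pos[where 'n = 'n] by (subst ennreal_mult) auto
  also have "\<dots> \<le> (\<integral>\<^sup>+ \<tau>. indicator {s<..<t} \<tau> * ?I \<tau> \<partial>lborel)"
  proof (rule nn_integral_ge_const_mult_emeasure)
    fix \<tau> assume \<tau>: "\<tau> \<in> {s<..<t}"
    have "ennreal ?c \<le> ennreal (cube_const TYPE('n) * (t - \<tau>) powr (- 1 / 2) * A powr p)"
      using \<tau> t cube_const_pos[where 'n = 'n]
      by (intro ennreal_leI mult_right_mono mult_left_mono powr_mono2') auto
    also have "\<dots> \<le> ?I \<tau>"
    proof (rule bdry_cube_heat_lower[OF x _ _ r])
      show "A powr p \<le> u y \<tau> powr p" if "y \<in> bdry_cube e z r" for y
        using le[OF that, of \<tau>] \<tau> A p by (intro powr_mono2) auto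
    qed (use \<tau> t in auto)
    finally show "ennreal ?c \<le> indicator {s<..<t} \<tau> * ?I \<tau>" using \<tau> by simp
  qed simp
  also have "\<dots> \<le> ennreal (u x t)"
    using solution_duhamel[OF sol t(1-3) bdry_cube_subset_halfD[OF x]] by simp
  finally show ?thesis
    using solution_nonneg[OF sol bdry_cube_subset_halfD[OF x], of t] t by (simp add: ennreal_le_iff)
qed

text \<open>On a boundary cylinder of parabolic size a lower bound \<open>A\<close> for \<open>u\<close> doubles after a waiting time
  proportional to \<open>A\<^sup>2\<^sup>-\<^sup>2\<^sup>p\<close>. These times form a geometric series, so a large \<open>A\<close> would force blow-up
  inside the cylinder.\<close>
lemma solution_cylinder_upper:
  fixes u :: "real^'n::finite \<Rightarrow> real \<Rightarrow> real"
  assumes sol: "is_solution e p T u" and p: "1 < p"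
    and t: "0 < s" "s < t" "t < T" "t - s \<le> r\<^sup>2" and r: "0 < r" and A: "0 < A"
    and le: "\<And>y \<tau>. y \<in> bdry_cube e z r \<Longrightarrow> s \<le> \<tau> \<Longrightarrow> \<tau> \<le> t \<Longrightarrow> A \<le> u y \<tau>"
  shows "A powr (2 * (p - 1)) * (t - s) \<le> (2 / cube_const TYPE('n))\<^sup>2 / (1 - 4 powr (1 - p))"
proof (rule ccontr)
  assume neg: "\<not> ?thesis"
  define \<kappa> where "\<kappa> = cube_const TYPE('n)"
  \<comment> \<open>Solving \<open>\<kappa> * A powr p * sqrt l = 2 * A\<close> gives the first
    doubling time \<open>l\<close>. With \<open>2 ^ j * A\<close> in place of \<open>A\<close> it
    becomes \<open>l * q ^ j\<close>, because \<open>2 powr (2 - 2 * p) = q\<close>.\<close>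
  define q where "q = (4::real) powr (1 - p)"
  define l where "l = (2 / \<kappa>)\<^sup>2 * A powr (2 - 2 * p)"
  have \<kappa>: "0 < \<kappa>" by (simp add: \<kappa>_def cube_const_pos)
  have q: "0 < q" "q < 1" using p powr_less_mono[of "1 - p" 0 4] by (auto simp: q_def)
  have l: "0 < l" using \<kappa> A by (simp add: l_def)
  have "(2 / \<kappa>)\<^sup>2 / (1 - q) < A powr (2 * (p - 1)) * (t - s)"
    using neg by (simp add: \<kappa>_def q_def)
  then have "A powr (2 - 2 * p) * ((2 / \<kappa>)\<^sup>2 / (1 - q)) < A powr (2 - 2 * p) * (A powr (2 * (p - 1)) * (t - s))"
    using A by (intro mult_strict_left_mono) auto
  also have "\<dots> = t - s"
  proof -
    have "A powr (2 - 2 * p) * A powr (2 * (p - 1)) = 1"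
      using A by (simp add: powr_add[symmetric])
    then show ?thesis by (simp only: mult.assoc[symmetric] mult_1_left)
  qed
  \<comment> \<open>The negated claim says precisely that the total of all doubling times is less
    than \<open>t - s\<close>.\<close>
  finally have lt: "l / (1 - q) < t - s" by (simp add: l_def mult_ac)
  define \<sigma> where "\<sigma> j = s + l * (\<Sum>i<j. q ^ i)" for j :: nat
  have \<sigma>_t: "\<sigma> j < t" for j
  proof -
    have "(\<Sum>i<j. q ^ i) = (1 - q ^ j) / (1 - q)"
      using q by (simp add: sum_gp_strict)
    also have "\<dots> \<le> 1 / (1 - q)" using q by (intro divide_right_mono) auto
    finally have "l * (\<Sum>i<j. q ^ i) \<le> l * (1 / (1 - q))" using l by (intro mult_left_mono) auto
    then show ?thesis using lt by (simp add: \<sigma>_def)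
  qed
  have \<sigma>_s: "s \<le> \<sigma> j" for j using l q by (auto simp: \<sigma>_def intro!: mult_nonneg_nonneg sum_nonneg)
  have claim: "2 ^ j * A \<le> u y \<tau>" if "y \<in> bdry_cube e z r" "\<sigma> j \<le> \<tau>" "\<tau> \<le> t" for j y \<tau>
    using that
  proof (induction j arbitrary: y \<tau>)
    case 0
    then show ?case using le by (simp add: \<sigma>_def)
  next
    case (Suc j)
    have step: "\<sigma> (Suc j) = \<sigma> j + l * q ^ j" by (simp add: \<sigma>_def algebra_simps)
    have lq: "0 < l * q ^ j" using l q by simp
    have "2 ^ Suc j * A = \<kappa> * (2 ^ j * A) powr p * sqrt (l * q ^ j)"
    proof -
      have "sqrt (l * q ^ j) = (2 / \<kappa>) * A powr (1 - p) * (2 ^ j) powr (1 - p)"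
      proof (rule real_sqrt_unique)
        have "(A powr (1 - p))\<^sup>2 = A powr (2 - 2 * p)"
          by (simp add: power2_eq_square powr_add[symmetric])
        moreover have "((2 ^ j) powr (1 - p))\<^sup>2 = q ^ j"
          by (simp add: q_def power2_eq_square powr_mult[symmetric] power_mult_distrib[symmetric]
              powr_realpow[symmetric] powr_powr mult.commute)
        ultimately show "(2 / \<kappa> * A powr (1 - p) * (2 ^ j) powr (1 - p))\<^sup>2 = l * q ^ j"
          by (simp only: power_mult_distrib l_def)
      qed (use \<kappa> in simp)
      moreover have "(2 ^ j * A) powr p * (A powr (1 - p) * (2 ^ j) powr (1 - p)) = 2 ^ j * A"
      proof -
        have "A powr (1 - p) * (2 ^ j) powr (1 - p) = (2 ^ j * A) powr (1 - p)"
          by (simp add: powr_mult)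
        then show ?thesis using A by (simp add: powr_add[symmetric])
      qed
      ultimately show ?thesis using \<kappa> by (simp add: mult_ac)
    qed
    also have "\<dots> \<le> \<kappa> * (2 ^ j * A) powr p * sqrt (\<tau> - \<sigma> j)"
      using Suc.prems(2) \<kappa> step by (intro mult_left_mono) auto
    finally have "2 ^ Suc j * A \<le> \<kappa> * (2 ^ j * A) powr p * sqrt (\<tau> - \<sigma> j)" .
    also have "\<dots> \<le> u y \<tau>"
      unfolding \<kappa>_def
    proof (rule solution_cylinder_step[OF sol _ _ _ _ _ r _ _ Suc.prems(1)])
      show "0 < \<sigma> j" "\<tau> - \<sigma> j \<le> r\<^sup>2" using \<sigma>_s[of j] t Suc.prems(3) by auto
      show "\<sigma> j < \<tau>" using Suc.prems(2) lq step by simp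
    qed (use p t A Suc in auto)
    finally show ?case .
  qed
  \<comment> \<open>One point of the cube at time \<open>t\<close> already contradicts
    \<open>claim\<close> for large \<open>j\<close>.\<close>
  define x where "x = (\<chi> i. if i = e then 0 else z $ i)"
  have x: "x \<in> bdry_cube e z r" using r by (simp add: x_def bdry_cube_def)
  obtain j :: nat where "u x t / A < 2 ^ j"
    using real_arch_pow[of 2 "u x t / A"] by auto
  then have "u x t < 2 ^ j * A" using A by (simp add: field_simps)
  then show False using claim[OF x less_imp_le[OF \<sigma>_t[of j]]] by simp
qed

section \<open>From the initial trace to pointwise lower bounds\<close>

lemma ennreal_integral_le_nn_integral:
  assumes "\<And>x. 0 \<le> f x"
  shows "ennreal (\<integral>x. f x \<partial>M) \<le> (\<integral>\<^sup>+x. ennreal (f x) \<partial>M)"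
\<comment> \<open>Outside the integrable case the Bochner integral has the default value 0, so the
  bound is trivial there.\<close>
proof (cases "integrable M f")
  case True
  then show ?thesis using assms by (simp add: nn_integral_eq_integral)
qed (simp add: not_integrable_integral_eq)

text \<open>The starting time \<open>\<tau>\<close> of the Duhamel formula tends to 0: its linear
  part, tested with functions increasing to the indicator of \<open>U\<close>, turns into mass of
  \<open>\<mu>\<close>. The kernel there has time \<open>t - \<tau>\<close>, so the bound
  \<open>g\<close> must hold on a whole interval below \<open>t\<close>. The boundary integral is
  cut at a fixed \<open>s\<close> so as not to move with \<open>\<tau>\<close>.\<close>

lemma initial_trace_lower_bound:
  fixes u :: "real^'n::finite \<Rightarrow> real \<Rightarrow> real"
  assumes sol: "is_solution e p T u" and tr: "initial_trace e u \<mu>"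
    and U: "open U" "bounded U" and x: "x \<in> halfD e" and t: "0 < t" "t < T"
    and \<eta>: "0 < \<eta>" and s: "0 < s" and g: "0 \<le> g"
    and G: "\<And>y h. y \<in> U \<Longrightarrow> y \<in> halfD e \<Longrightarrow> t - \<eta> \<le> h \<Longrightarrow> h \<le> t \<Longrightarrow> g \<le> neumannG e x y h"
  shows "ennreal (g * measure \<mu> U) +
      (\<integral>\<^sup>+ \<tau>. indicator {s<..<t} \<tau> *
          (\<integral>\<^sup>+ y. ennreal (neumannG e x y (t - \<tau>) * u y \<tau> powr p) \<partial>bdry_measure e) \<partial>lborel)
      \<le> ennreal (u x t)"
    (is "_ + ?J s \<le> _")
proof -
  have \<mu>: "radon_measure \<mu>" "sets \<mu> = sets borel"
    using tr by (auto simp: initial_trace_def radon_measure_def)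
  define F where "F k \<tau> = (\<integral>y. indicator (halfD e) y * u y \<tau> * approx_ind U k y \<partial>lborel)" for k \<tau>
  have F_lim: "(F k \<longlongrightarrow> (\<integral>y. approx_ind U k y \<partial>\<mu>)) (at_right 0)" for k
    using tr approx_ind_C0[OF U(2), of k] by (auto simp: initial_trace_def F_def[abs_def])
  \<comment> \<open>Below \<open>m\<close> the time \<open>\<tau>\<close> precedes \<open>t\<close>,
    \<open>t - \<tau>\<close> stays in the range where \<open>g\<close> is valid, and the interval
    from \<open>s\<close> to \<open>t\<close> lies in that from \<open>\<tau>\<close> to
    \<open>t\<close>.\<close>
  define m where "m = min t (min \<eta> s)"
  have m: "0 < m" "m \<le> t" "m \<le> \<eta>" "m \<le> s" using t \<eta> s by (auto simp: m_def)
  have step: "ennreal (g * F k \<tau>) + ?J s \<le> ennreal (u x t)" if \<tau>: "0 < \<tau>" "\<tau> < m" for k \<tau>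
  proof -
    have nn: "0 \<le> indicator (halfD e) y * u y \<tau> * approx_ind U k y" for y
      using solution_nonneg[OF sol, of y \<tau>] \<tau> m t by (auto simp: indicator_def approx_ind_bounds)
    have "ennreal (g * F k \<tau>) = ennreal (\<integral>y. g * (indicator (halfD e) y * u y \<tau> * approx_ind U k y) \<partial>lborel)"
      unfolding F_def by simp
    also have "\<dots> \<le> (\<integral>\<^sup>+y. ennreal (g * (indicator (halfD e) y * u y \<tau> * approx_ind U k y)) \<partial>lborel)"
      using nn g by (intro ennreal_integral_le_nn_integral) auto
    also have "\<dots> \<le> (\<integral>\<^sup>+y. ennreal (indicator (halfD e) y * neumannG e x y (t - \<tau>) * u y \<tau>) \<partial>lborel)"
    proof (intro nn_integral_mono ennreal_leI)
      fix y
      show "g * (indicator (halfD e) y * u y \<tau> * approx_ind U k y)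
          \<le> indicator (halfD e) y * neumannG e x y (t - \<tau>) * u y \<tau>"
      proof (cases "y \<in> halfD e \<and> y \<in> U")
        case True
        then have u: "0 \<le> u y \<tau>" using solution_nonneg[OF sol] \<tau> m t by auto
        have "g * (u y \<tau> * approx_ind U k y) \<le> g * (u y \<tau> * 1)"
          using g u by (intro mult_left_mono) (auto simp: approx_ind_bounds)
        also have "\<dots> \<le> neumannG e x y (t - \<tau>) * u y \<tau>"
          using True \<tau> m u by (auto intro!: mult_right_mono G)
        finally show ?thesis using True by simp
      next
        case False
        then show ?thesis
          using solution_nonneg[OF sol, of y \<tau>] \<tau> m t
          by (auto simp: approx_ind_outside neumannG_nonneg indicator_def)
      qed
    qed
    finally have "ennreal (g * F k \<tau>) + ?J s \<le>
        (\<integral>\<^sup>+y. ennreal (indicator (halfD e) y * neumannG e x y (t - \<tau>) * u y \<tau>) \<partial>lborel) + ?J \<tau>"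
      using \<tau> m by (intro add_mono nn_integral_mono mult_right_mono) (auto simp: indicator_def)
    also have "\<dots> = ennreal (u x t)"
      using solution_duhamel[OF sol _ _ t(2) x, of \<tau>] \<tau> m by simp
    finally show ?thesis .
  qed
  have "?J s \<le> ennreal (u x t)"
    using step[of "m / 2" 0] m by (auto intro: order_trans[rotated])
  \<comment> \<open>The boundary part is finite, so it can be subtracted and the limit taken over
    the reals.\<close>
  then obtain j where j: "?J s = ennreal j" "0 \<le> j"
    using less_top_ennreal[of "?J s"] order_le_less_trans[OF _ ennreal_less_top] by blast
  have ux: "0 \<le> u x t" using solution_nonneg[OF sol x t] .
  have lim: "g * (\<integral>y. approx_ind U k y \<partial>\<mu>) \<le> u x t - j" for k
  proof (rule tendsto_upperbound[OF tendsto_mult_left[OF F_lim]])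
    have "g * F k \<tau> \<le> u x t - j" if "\<tau> \<in> {0<..<m}" for \<tau>
    proof -
      have "0 \<le> F k \<tau>"
        unfolding F_def using solution_nonneg[OF sol, of _ \<tau>] that m t
        by (intro Bochner_Integration.integral_nonneg) (auto simp: indicator_def approx_ind_bounds)
      then show ?thesis
        using step[of \<tau> k] that g j ux by (simp add: ennreal_plus[symmetric] ennreal_le_iff del: ennreal_plus)
    qed
    then show "eventually (\<lambda>\<tau>. g * F k \<tau> \<le> u x t - j) (at_right 0)"
      unfolding eventually_at_right_field using m(1) by auto
  qed simp
  have uj: "0 \<le> u x t - j"
    using \<open>?J s \<le> ennreal (u x t)\<close> j ux by (simp add: ennreal_le_iff)
  have "ennreal (g * measure \<mu> U) = ennreal g * emeasure \<mu> U"
    using radon_bounded_finite[OF \<mu>(1) U(2)] g by (simp add: emeasure_eq_ennreal_measure ennreal_mult)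
  also have "\<dots> = (SUP k. ennreal g * (\<integral>\<^sup>+y. ennreal (approx_ind U k y) \<partial>\<mu>))"
    by (simp add: nn_integral_approx_ind_SUP[OF U(1) \<mu>(2), symmetric] SUP_mult_left_ennreal)
  also have "\<dots> \<le> ennreal (u x t - j)"
  proof (rule SUP_least)
    fix k
    have "ennreal g * (\<integral>\<^sup>+y. ennreal (approx_ind U k y) \<partial>\<mu>) = ennreal (g * (\<integral>y. approx_ind U k y \<partial>\<mu>))"
      using radon_C0_integrable[OF \<mu>(1) approx_ind_C0[OF U(2)]] g
      by (simp add: nn_integral_eq_integral approx_ind_bounds ennreal_mult)
    also have "\<dots> \<le> ennreal (u x t - j)" by (intro ennreal_leI lim)
    finally show "ennreal g * (\<integral>\<^sup>+y. ennreal (approx_ind U k y) \<partial>\<mu>) \<le> ennreal (u x t - j)" .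
  qed
  finally have "ennreal (g * measure \<mu> U) + ?J s \<le> ennreal (u x t - j) + ennreal j"
    unfolding j(1) by (rule add_right_mono)
  also have "\<dots> = ennreal (u x t)" using uj j(2) by (subst ennreal_plus[symmetric]) auto
  finally show ?thesis .
qed

text \<open>The exponent collects what does not involve the height of the centre:
  \<open>4 * N\<close> from distances along the boundary and \<open>q / (q - 1)\<close> from Young's
  inequality, divided by \<open>4 / q\<close> because the time may be as small as
  \<open>\<rho>\<^sup>2 / q\<close>.\<close>

definition kernel_const :: "'n::finite itself \<Rightarrow> real \<Rightarrow> real" where
  "kernel_const _ q = (4 * pi) powr (- real CARD('n) / 2) * exp (- q * (4 * real CARD('n) + q / (q - 1)) / 4)"

lemma kernel_const_pos: "0 < kernel_const TYPE('n::finite) q"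
  by (simp add: kernel_const_def)

text \<open>Each factor \<open>q\<close> in front of \<open>(z $ e)\<^sup>2\<close> has its own
  source: one comes from comparing the height of \<open>y\<close> with that of \<open>z\<close>, one
  from the short end of the time range. Mass is measured at scale \<open>\<sigma>\<close> and
  observed at scale \<open>\<rho>\<close>; the critical case lets \<open>\<rho>\<close> grow while
  the weight keeps \<open>\<sigma>\<close>.\<close>

lemma neumannG_lower:
  fixes x z :: "real^'n::finite"
  assumes q: "1 < q" and \<sigma>: "0 < \<sigma>" "\<sigma> \<le> \<rho>" and z: "z \<in> halfD e"
    and x: "x \<in> bdry_cube e z \<rho>" and y: "y \<in> ball z \<sigma>" and h: "\<rho>\<^sup>2 / q \<le> h" "h \<le> \<rho>\<^sup>2"
  shows "kernel_const TYPE('n) q * \<rho> powr (- real CARD('n)) * exp (- q\<^sup>2 * (z $ e)\<^sup>2 / (4 * \<sigma>\<^sup>2)) \<le> neumannG e x y h"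
proof -
  define N where "N = real CARD('n)"
  have \<rho>: "0 < \<rho>" using \<sigma> by simp
  have h0: "0 < h" using h(1) \<rho> q by (smt (verit) divide_pos_pos zero_less_power)
  have yz: "\<bar>y $ i - z $ i\<bar> < \<sigma>" for i
    using y component_le_norm_cart[of "y - z" i] by (simp add: dist_norm norm_minus_commute)
  have ye: "(y $ e)\<^sup>2 \<le> q * (z $ e)\<^sup>2 + q / (q - 1) * \<sigma>\<^sup>2"
  proof -
    have "0 \<le> z $ e" using z by (simp add: halfD_def)
    then have "\<bar>y $ e\<bar> \<le> z $ e + \<sigma>" using yz[of e] by linarith
    then have "(y $ e)\<^sup>2 \<le> (z $ e + \<sigma>)\<^sup>2"
      by (metis abs_ge_zero power2_abs power_mono)
    \<comment> \<open>Young's inequality, with its defect written as a square.\<close>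
    moreover have "q * (z $ e)\<^sup>2 + q / (q - 1) * \<sigma>\<^sup>2 - (z $ e + \<sigma>)\<^sup>2 = ((q - 1) * z $ e - \<sigma>)\<^sup>2 / (q - 1)"
      using q by (simp add: field_simps power2_eq_square)
    moreover have "0 \<le> ((q - 1) * z $ e - \<sigma>)\<^sup>2 / (q - 1)" using q by simp
    ultimately show ?thesis by linarith
  qed
  have "(norm (x - y))\<^sup>2 \<le> 4 * N * \<rho>\<^sup>2 + (y $ e)\<^sup>2"
  proof -
    have "(norm (x - y))\<^sup>2 = (\<Sum>i\<in>UNIV. ((x - y) $ i)\<^sup>2)"
      by (simp add: norm_vec_def L2_set_def sum_nonneg)
    also have "\<dots> \<le> (\<Sum>i\<in>UNIV. 4 * \<rho>\<^sup>2 + (if i = e then (y $ e)\<^sup>2 else 0))"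
    proof (rule sum_mono)
      fix i
      show "((x - y) $ i)\<^sup>2 \<le> 4 * \<rho>\<^sup>2 + (if i = e then (y $ e)\<^sup>2 else 0)"
      proof (cases "i = e")
        case True
        then show ?thesis using x by (simp add: bdry_cube_def)
      next
        case False
        then have "\<bar>x $ i - z $ i\<bar> \<le> \<rho>" using x by (simp add: bdry_cube_def)
        then have "\<bar>(x - y) $ i\<bar> \<le> 2 * \<rho>"
          using yz[of i] \<sigma>(2) unfolding vector_minus_component by linarith
        then have "((x - y) $ i)\<^sup>2 \<le> (2 * \<rho>)\<^sup>2" by (metis abs_ge_zero power2_abs power_mono)
        then show ?thesis using False by (simp add: power_mult_distrib)
      qed
    qed
    also have "\<dots> = 4 * N * \<rho>\<^sup>2 + (y $ e)\<^sup>2" by (simp add: sum.distrib N_def)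
    finally show ?thesis .
  qed
  then have "(norm (x - y))\<^sup>2 / (4 * h) \<le> (4 * N * \<rho>\<^sup>2 + (q * (z $ e)\<^sup>2 + q / (q - 1) * \<sigma>\<^sup>2)) / (4 * h)"
    using ye h0 by (intro divide_right_mono) auto
  also have "\<dots> \<le> (4 * N * \<rho>\<^sup>2 + (q * (z $ e)\<^sup>2 + q / (q - 1) * \<sigma>\<^sup>2)) / (4 * (\<rho>\<^sup>2 / q))"
    using h(1) h0 \<rho> q by (intro divide_left_mono) (auto simp: N_def intro!: add_nonneg_nonneg mult_nonneg_nonneg)
  also have "\<dots> = q * N + (q\<^sup>2 * (z $ e)\<^sup>2 / 4 + q\<^sup>2 / (q - 1) * \<sigma>\<^sup>2 / 4) / \<rho>\<^sup>2"
    using \<rho> q by (simp add: field_simps power2_eq_square)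
  also have "\<dots> \<le> q * N + (q\<^sup>2 * (z $ e)\<^sup>2 / 4 + q\<^sup>2 / (q - 1) * \<sigma>\<^sup>2 / 4) / \<sigma>\<^sup>2"
    using \<sigma> q by (intro add_left_mono divide_left_mono power_mono) (auto intro!: add_nonneg_nonneg)
  also have "\<dots> = q * (4 * N + q / (q - 1)) / 4 + q\<^sup>2 * (z $ e)\<^sup>2 / (4 * \<sigma>\<^sup>2)"
    using \<sigma> q by (simp add: field_simps power2_eq_square)
  finally have "(4 * pi * \<rho>\<^sup>2) powr (- N / 2) * exp (- (q * (4 * N + q / (q - 1)) / 4 + q\<^sup>2 * (z $ e)\<^sup>2 / (4 * \<sigma>\<^sup>2)))
      \<le> heatGamma (x - y) h"
    unfolding N_def by (rule heatGamma_ge[OF h0 h(2)])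
  moreover have "(4 * pi * \<rho>\<^sup>2) powr (- N / 2) = (4 * pi) powr (- N / 2) * \<rho> powr (- N)"
    using \<rho> by (simp add: powr_mult powr_powr powr_realpow[symmetric] del: powr_numeral)
  moreover have "exp (- (q * (4 * N + q / (q - 1)) / 4 + q\<^sup>2 * (z $ e)\<^sup>2 / (4 * \<sigma>\<^sup>2))) =
      exp (- q * (4 * N + q / (q - 1)) / 4) * exp (- q\<^sup>2 * (z $ e)\<^sup>2 / (4 * \<sigma>\<^sup>2))"
    by (simp add: exp_add[symmetric])
  ultimately have "kernel_const TYPE('n) q * \<rho> powr (- N) * exp (- q\<^sup>2 * (z $ e)\<^sup>2 / (4 * \<sigma>\<^sup>2)) \<le> heatGamma (x - y) h"
    by (simp only: kernel_const_def N_def mult_ac)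
  then show ?thesis
    using neumannG_ge_heatGamma[of x y h e] by (simp add: N_def)
qed

lemma powr_le_cancel_exponent:
  fixes a b r :: real
  assumes "0 < a" "0 < r" "a powr r \<le> b"
  shows "a \<le> b powr (1 / r)"
proof -
  have "a = (a powr r) powr (1 / r)" using assms by (simp add: powr_powr)
  also have "\<dots> \<le> b powr (1 / r)" using assms by (intro powr_mono2) auto
  finally show ?thesis .
qed

text \<open>Mass \<open>m\<close> in the ball forces \<open>u\<close> to be at least a multiple of
  \<open>\<sigma> powr (- N) * E * m\<close> on a boundary cylinder of size \<open>\<sigma>\<close>,
  where \<open>E\<close> is the weight, and the doubling argument caps such a bound at a multiple of
  \<open>\<sigma> powr (- 1 / (p - 1))\<close>.\<close>

lemma trace_ball_bound:
  fixes u :: "real^'n::finite \<Rightarrow> real \<Rightarrow> real"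
  assumes sol: "is_solution e p T u" and tr: "initial_trace e u \<mu>" and p: "1 < p" and \<delta>: "0 < \<delta>"
  obtains C where "0 < C"
    "\<And>\<sigma> x. 0 < \<sigma> \<Longrightarrow> \<sigma>\<^sup>2 \<le> T \<Longrightarrow> x \<in> halfD e \<Longrightarrow>
      exp (- (1 + \<delta>) * (x $ e)\<^sup>2 / (4 * \<sigma>\<^sup>2)) * measure \<mu> (ball x \<sigma>) \<le> C * \<sigma> powr (real CARD('n) - 1 / (p - 1))"
proof -
  define q where "q = sqrt (1 + \<delta>)"
  define K where "K = (2 / cube_const TYPE('n))\<^sup>2 / (1 - 4 powr (1 - p))"
  define b where "b = 1 - 1 / q"
  define C where "C = (3 * K / b) powr (1 / (2 * (p - 1))) / kernel_const TYPE('n) q"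
  have q: "1 < q" "q\<^sup>2 = 1 + \<delta>" using \<delta> by (auto simp: q_def)
  have b: "0 < b" "b < 1" using q by (auto simp: b_def)
  have "4 powr (1 - p) < (1::real)" using p powr_less_mono[of "1 - p" 0 4] by simp
  then have K: "0 < K" using cube_const_pos[where 'n='n] by (simp add: K_def)
  have C: "0 < C" using K b kernel_const_pos[of q, where 'n='n] by (simp add: C_def)
  have "exp (- (1 + \<delta>) * (x $ e)\<^sup>2 / (4 * \<sigma>\<^sup>2)) * measure \<mu> (ball x \<sigma>) \<le> C * \<sigma> powr (real CARD('n) - 1 / (p - 1))"
    if \<sigma>: "0 < \<sigma>" "\<sigma>\<^sup>2 \<le> T" and x: "x \<in> halfD e" for \<sigma> x
  proof (cases "measure \<mu> (ball x \<sigma>) = 0")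
    case True
    then show ?thesis using C by simp
  next
    case False
    define m where "m = measure \<mu> (ball x \<sigma>)"
    define E where "E = exp (- q\<^sup>2 * (x $ e)\<^sup>2 / (4 * \<sigma>\<^sup>2))"
    define g where "g = kernel_const TYPE('n) q * \<sigma> powr (- real CARD('n)) * E"
    have m: "0 < m" using False measure_nonneg[of \<mu> "ball x \<sigma>"] unfolding m_def by linarith
    have g: "0 < g" using \<sigma> kernel_const_pos[of q, where 'n='n] by (simp add: g_def E_def)
    \<comment> \<open>The interval from
      \<open>\<sigma>\<^sup>2 / q = (1 - b) * \<sigma>\<^sup>2\<close> to
      \<open>\<sigma>\<^sup>2\<close> is cut into thirds: the first is the margin for
      \<open>\<eta>\<close>, the middle one carries the cylinder, the last keeps
      \<open>t < T\<close> even for \<open>\<sigma>\<^sup>2 = T\<close>.\<close>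
    define s where "s = (1 - 2 * b / 3) * \<sigma>\<^sup>2"
    define t where "t = (1 - b / 3) * \<sigma>\<^sup>2"
    have \<sigma>2: "0 < \<sigma>\<^sup>2" using \<sigma> by simp
    have st: "0 < s" "s < t" "t < T" "t - s \<le> \<sigma>\<^sup>2" "t - s = b / 3 * \<sigma>\<^sup>2"
    proof -
      show "t - s = b / 3 * \<sigma>\<^sup>2" by (simp add: s_def t_def algebra_simps)
      moreover have b3: "0 < b / 3 * \<sigma>\<^sup>2" using b \<sigma>2 by simp
      moreover have "b / 3 * \<sigma>\<^sup>2 \<le> 1 * \<sigma>\<^sup>2" using b by (intro mult_right_mono) auto
      ultimately show "s < t" "t - s \<le> \<sigma>\<^sup>2" by simp_all
      show "0 < s" using b \<sigma>2 by (simp add: s_def)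
      show "t < T" using b3 \<sigma>(2) by (simp add: t_def algebra_simps)
    qed
    have "(g * m) powr (2 * (p - 1)) * (t - s) \<le> K"
      unfolding K_def
    proof (rule solution_cylinder_upper[OF sol p st(1-4) \<sigma>(1), of _ x])
      show "0 < g * m" using g m by simp
      fix y \<tau> assume y: "y \<in> bdry_cube e x \<sigma>" and \<tau>: "s \<le> \<tau>" "\<tau> \<le> t"
      have "ennreal (g * m) \<le> ennreal (u y \<tau>)"
        unfolding m_def
      \<comment> \<open>Only the mass term is kept; the nonnegative boundary term is discarded, so
        its starting time 1 is arbitrary.\<close>
      proof (rule order_trans[OF _ initial_trace_lower_bound[where \<eta> = "b / 3 * \<sigma>\<^sup>2" and s = 1,
              OF sol tr open_ball bounded_ball bdry_cube_subset_halfD[OF y]]])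
        fix w h assume w: "w \<in> ball x \<sigma>" "\<tau> - b / 3 * \<sigma>\<^sup>2 \<le> h" "h \<le> \<tau>"
        have "\<sigma>\<^sup>2 / q = (1 - b) * \<sigma>\<^sup>2" by (simp add: b_def)
        also have "\<dots> = s - b / 3 * \<sigma>\<^sup>2" by (simp add: s_def algebra_simps)
        also have "\<dots> \<le> h" using w \<tau> by simp
        finally have h1: "\<sigma>\<^sup>2 / q \<le> h" .
        have "0 \<le> b / 3 * \<sigma>\<^sup>2" using b by simp
        then have h2: "h \<le> \<sigma>\<^sup>2" using w(3) \<tau> by (simp add: t_def algebra_simps)
        show "g \<le> neumannG e y w h"
          unfolding g_def E_def by (rule neumannG_lower[OF q(1) \<sigma>(1) order_refl x y w(1) h1 h2])
      qed (use \<tau> st g b \<sigma>2 in auto)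
      then show "g * m \<le> u y \<tau>"
        using solution_nonneg[OF sol bdry_cube_subset_halfD[OF y], of \<tau>] \<tau> st by (simp add: ennreal_le_iff)
    qed
    then have "(g * m) powr (2 * (p - 1)) \<le> K / (b / 3 * \<sigma>\<^sup>2)"
      using b \<sigma>2 unfolding st(5) by (simp add: pos_le_divide_eq)
    also have "\<dots> = 3 * K / b * (1 / \<sigma>\<^sup>2)" by simp
    finally have "(g * m) powr (2 * (p - 1)) \<le> 3 * K / b * (1 / \<sigma>\<^sup>2)" .
    then have "g * m \<le> (3 * K / b * (1 / \<sigma>\<^sup>2)) powr (1 / (2 * (p - 1)))"
      using g m p by (intro powr_le_cancel_exponent) auto
    also have "\<dots> = (3 * K / b) powr (1 / (2 * (p - 1))) * \<sigma> powr (- 1 / (p - 1))"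
    proof -
      have "1 / \<sigma>\<^sup>2 = \<sigma> powr (- 2)"
        using \<sigma>(1) by (simp add: powr_minus_divide)
      then have "(1 / \<sigma>\<^sup>2) powr (1 / (2 * (p - 1))) = \<sigma> powr (- 2 * (1 / (2 * (p - 1))))"
        by (simp only: powr_powr)
      also have "- 2 * (1 / (2 * (p - 1))) = - 1 / (p - 1)" using p by (simp add: field_simps)
      finally show ?thesis by (simp only: powr_mult)
    qed
    finally have "E * m * (kernel_const TYPE('n) q * \<sigma> powr (- real CARD('n))) \<le>
        (3 * K / b) powr (1 / (2 * (p - 1))) * \<sigma> powr (- 1 / (p - 1))"
      by (simp add: g_def mult_ac)
    then have "E * m \<le> (3 * K / b) powr (1 / (2 * (p - 1))) * \<sigma> powr (- 1 / (p - 1)) /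
        (kernel_const TYPE('n) q * \<sigma> powr (- real CARD('n)))"
      using \<sigma> kernel_const_pos[of q, where 'n='n] by (subst pos_le_divide_eq) auto
    also have "\<dots> = C * (\<sigma> powr (- 1 / (p - 1)) / \<sigma> powr (- real CARD('n)))"
      by (simp add: C_def)
    also have "\<sigma> powr (- 1 / (p - 1)) / \<sigma> powr (- real CARD('n)) = \<sigma> powr (real CARD('n) - 1 / (p - 1))"
      by (simp add: powr_diff[symmetric])
    finally show ?thesis by (simp add: E_def m_def q(2))
  qed
  then show ?thesis using that C by blast
qed

section \<open>The critical exponent\<close>

text \<open>Discrete version of the blow-up of \<open>a' = c * a powr p\<close>: each step lowers
  \<open>a powr (1 - p)\<close> by at least a fixed amount, so its initial value limits the number
  of steps. The amount depends on \<open>B\<close> because one step multiplies \<open>a\<close> by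
  up to \<open>1 + c * B powr (p - 1)\<close>, and the derivative in the mean value theorem is
  estimated at the far end of the step.\<close>

lemma superlinear_recursion_bound:
  fixes a :: "nat \<Rightarrow> real"
  assumes p: "1 < p" and c: "0 < c" and a0: "0 < a 0"
    and rec: "\<And>k. a (Suc k) = a k + c * a k powr p" and B: "a K \<le> B"
  shows "real K * ((p - 1) * c * (1 + c * B powr (p - 1)) powr (- p)) \<le> a 0 powr (1 - p)"
proof -
  have pos: "0 < a k" for k
    by (induction k) (use a0 c in \<open>auto simp: rec intro!: add_pos_nonneg\<close>)
  have "incseq a" using c by (intro incseq_SucI) (simp add: rec)
  then have le_B: "a k \<le> B" if "k \<le> K" for k
    using that B by (meson incseqD order_trans)
  define d where "d = (p - 1) * c * (1 + c * B powr (p - 1)) powr (- p)"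
  have step: "d \<le> a k powr (1 - p) - a (Suc k) powr (1 - p)" if "k < K" for k
  proof -
    define x where "x = a k"
    define y where "y = a (Suc k)"
    have xy: "0 < x" "x < y" "y = x + c * x powr p" "x \<le> B"
      using pos[of k] c le_B[of k] that by (auto simp: x_def y_def rec)
    have y_eq: "y = x * (1 + c * x powr (p - 1))"
      using xy(1) powr_add[of x 1 "p - 1"] by (simp add: xy(3) algebra_simps)
    have der: "((\<lambda>v. v powr (1 - p)) has_real_derivative (1 - p) * v powr (- p)) (at v)"
      if "x \<le> v" "v \<le> y" for v
      using has_real_derivative_powr[of v "1 - p"] that xy(1) by simp
    obtain \<xi> where \<xi>: "x < \<xi>" "\<xi> < y" "y powr (1 - p) - x powr (1 - p) = (y - x) * ((1 - p) * \<xi> powr (- p))"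
      using MVT2[OF xy(2) der] by blast
    have "d \<le> (p - 1) * c * (1 + c * x powr (p - 1)) powr (- p)"
      unfolding d_def using p c xy
      by (intro mult_left_mono powr_mono2') (auto intro!: add_pos_nonneg powr_mono2)
    also have "\<dots> = (p - 1) * (c * x powr p) * (x powr (- p) * (1 + c * x powr (p - 1)) powr (- p))"
      using xy(1) powr_add[of x p "- p"] by simp
    also have "x powr (- p) * (1 + c * x powr (p - 1)) powr (- p) = y powr (- p)"
      unfolding y_eq by (simp add: powr_mult)
    also have "(p - 1) * (c * x powr p) * y powr (- p) \<le> (p - 1) * (c * x powr p) * \<xi> powr (- p)"
      using p c \<xi> xy by (intro mult_left_mono powr_mono2') auto
    also have "\<dots> = x powr (1 - p) - y powr (1 - p)"
      using \<xi>(3) xy(3) by (simp add: algebra_simps)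
    finally show ?thesis by (simp add: x_def y_def)
  qed
  have "real k * d \<le> a 0 powr (1 - p) - a k powr (1 - p)" if "k \<le> K" for k
    using that
  proof (induction k)
    case (Suc k)
    then show ?case using step[of k] by (simp add: algebra_simps)
  qed simp
  from this[of K] show ?thesis
    unfolding d_def using powr_ge_zero[of "a K" "1 - p"] by linarith
qed

text \<open>\<open>exp (- 2 * N)\<close> is the Gaussian for squared distance
  \<open>4 * N * t\<close> at the shortest kernel time \<open>t / 2\<close>.\<close>

definition spread_const :: "'n::finite itself \<Rightarrow> real" where
  "spread_const _ = (4 * pi) powr (- real CARD('n) / 2) * exp (- 2 * real CARD('n))"

lemma spread_const_pos: "0 < spread_const TYPE('n::finite)"
  by (simp add: spread_const_def)

text \<open>Long-time counterpart of the short-time estimate: a source on a cube of size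
  \<open>sqrt s\<close> is felt throughout the larger cube of size \<open>sqrt t\<close>, as its
  total mass spread with density comparable to \<open>t powr (- N / 2)\<close>.\<close>

lemma bdry_cube_heat_spread:
  fixes x z :: "real^'n::finite"
  assumes x: "x \<in> bdry_cube e z (sqrt t)" and s: "0 < s" "s \<le> t / 2"
    and f: "\<And>y. y \<in> bdry_cube e z (sqrt s) \<Longrightarrow> B \<le> f y" and B: "0 \<le> B"
  shows "ennreal (spread_const TYPE('n) * t powr (- real CARD('n) / 2) * s powr ((real CARD('n) - 1) / 2) * B)
    \<le> (\<integral>\<^sup>+y. ennreal (neumannG e x y (t - s) * f y) \<partial>bdry_measure e)"
proof -
  define N where "N = CARD('n)"
  have N: "N \<ge> 1" by (simp add: N_def Suc_leI)
  have t: "0 < t" "0 < t - s" "t / 2 \<le> t - s" using s by auto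
  have ss: "0 < sqrt s" "sqrt s \<le> sqrt t" using s t by auto
  have G: "(4 * pi * t) powr (- real N / 2) * exp (- (2 * real N)) \<le> neumannG e x y (t - s)"
    if y: "y \<in> bdry_cube e z (sqrt s)" for y
  proof -
    have "(norm (x - y))\<^sup>2 \<le> real CARD('n) * (4 * t)"
    proof (rule norm_sq_le_card)
      fix i
      have "\<bar>(x - y) $ i\<bar> \<le> 2 * sqrt t"
      proof (cases "i = e")
        case True
        then show ?thesis using x y t by (simp add: bdry_cube_def)
      next
        case False
        then have "\<bar>x $ i - z $ i\<bar> \<le> sqrt t" "\<bar>y $ i - z $ i\<bar> \<le> sqrt s"
          using x y by (auto simp: bdry_cube_def)
        then show ?thesis using ss(2) unfolding vector_minus_component by linarith
      qed
      then have "((x - y) $ i)\<^sup>2 \<le> (2 * sqrt t)\<^sup>2" by (metis abs_ge_zero power2_abs power_mono)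
      then show "((x - y) $ i)\<^sup>2 \<le> 4 * t" using t by (simp add: power_mult_distrib)
    qed
    then have "(norm (x - y))\<^sup>2 / (4 * (t - s)) \<le> real N * (4 * t) / (4 * (t - s))"
      using t by (intro divide_right_mono) (auto simp: N_def)
    also have "\<dots> \<le> real N * (4 * t) / (4 * (t / 2))"
      using t by (intro divide_left_mono) auto
    also have "\<dots> = 2 * real N" using t by simp
    finally have "(4 * pi * t) powr (- real N / 2) * exp (- (2 * real N)) \<le> heatGamma (x - y) (t - s)"
      unfolding N_def by (intro heatGamma_ge) (use t s in auto)
    then show ?thesis using neumannG_ge_heatGamma[of x y "t - s" e] by simp
  qed
  let ?c = "(4 * pi * t) powr (- real N / 2) * exp (- (2 * real N)) * B"
  have "s powr ((real N - 1) / 2) = sqrt s ^ (N - 1)"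
    using s(1) N by (simp add: powr_half_sqrt[symmetric] powr_realpow[symmetric] powr_powr of_nat_diff)
  also have "\<dots> \<le> (2 * sqrt s) ^ (N - 1)" using ss by (intro power_mono) auto
  finally have "?c * s powr ((real N - 1) / 2) \<le> ?c * (2 * sqrt s) ^ (N - 1)"
    using B by (intro mult_left_mono) auto
  then have "spread_const TYPE('n) * t powr (- real N / 2) * s powr ((real N - 1) / 2) * B \<le> ?c * (2 * sqrt s) ^ (N - 1)"
    using t(1) by (simp add: spread_const_def N_def powr_mult mult_ac)
  then have "ennreal (spread_const TYPE('n) * t powr (- real N / 2) * s powr ((real N - 1) / 2) * B)
      \<le> ennreal (?c * (2 * sqrt s) ^ (N - 1))"
    by (rule ennreal_leI)
  also have "\<dots> = ennreal ?c * emeasure (bdry_measure e) (bdry_cube e z (sqrt s))"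
    using B ss by (subst emeasure_bdry_cube) (auto simp: N_def ennreal_mult)
  also have "\<dots> \<le> (\<integral>\<^sup>+y. ennreal (neumannG e x y (t - s) * f y) \<partial>bdry_measure e)"
    using B ss by (intro nn_integral_ge_const_mult_emeasure emeasure_bdry_cube ennreal_leI mult_mono G f)
      (auto simp: neumannG_nonneg)
  finally show ?thesis by (simp add: N_def)
qed

text \<open>For the critical exponent each time scale \<open>4\<^sup>j \<sigma>\<^sup>2\<close> between \<open>\<sigma>\<^sup>2\<close> and \<open>t\<close> contributes equally to
  the Duhamel integral; this is the origin of the logarithm.\<close>
lemma critical_lower_bound:
  fixes u :: "real^'n::finite \<Rightarrow> real \<Rightarrow> real"
  assumes sol: "is_solution e p T u" and tr: "initial_trace e u \<mu>" and p: "p = 1 + 1 / real CARD('n)"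
    and q: "1 < q" and \<sigma>: "0 < \<sigma>" and z: "z \<in> halfD e"
    and a0: "a 0 = kernel_const TYPE('n) q * (exp (- q\<^sup>2 * (z $ e)\<^sup>2 / (4 * \<sigma>\<^sup>2)) * measure \<mu> (ball z \<sigma>))"
    and rec: "\<And>k. a (Suc k) = a k + spread_const TYPE('n) / 2 * a k powr p"
    and t: "4 ^ k * \<sigma>\<^sup>2 \<le> t" "t < T" and x: "x \<in> bdry_cube e z (sqrt t)"
  shows "a k * t powr (- real CARD('n) / 2) \<le> u x t"
  using t x
proof (induction k arbitrary: t x rule: less_induct)
  case (less k)
  define N where "N = real CARD('n)"
  have N: "1 \<le> N" by (simp add: N_def Suc_leI)
  define \<kappa> where "\<kappa> = spread_const TYPE('n)"
  have \<kappa>: "0 < \<kappa>" by (simp add: \<kappa>_def spread_const_pos)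
  have \<sigma>2: "0 < \<sigma>\<^sup>2" using \<sigma> by simp
  have a_nonneg: "0 \<le> a j" for j
    by (induction j) (use \<kappa> kernel_const_pos[of q, where 'n='n] in \<open>auto simp: a0 rec \<kappa>_def[symmetric] intro!: mult_nonneg_nonneg\<close>)
  \<comment> \<open>All earlier scales contribute separately, hence the strong induction and the
    recursion in summed form.\<close>
  have a_sum: "a k = a 0 + (\<Sum>j<k. \<kappa> / 2 * a j powr p)" for k
    by (induction k) (auto simp: rec \<kappa>_def)
  have "1 * \<sigma>\<^sup>2 \<le> 4 ^ k * \<sigma>\<^sup>2" using \<sigma>2 by (intro mult_right_mono) auto
  then have \<sigma>t: "\<sigma>\<^sup>2 \<le> t" using less.prems(1) by simp
  then have t0: "0 < t" using \<sigma>2 by linarith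
  have \<sigma>st: "\<sigma> \<le> sqrt t" using \<sigma>t by (intro real_le_rsqrt)
  have xD: "x \<in> halfD e" by (rule bdry_cube_subset_halfD[OF less.prems(3)])
  let ?I = "\<lambda>s. \<integral>\<^sup>+ y. ennreal (neumannG e x y (t - s) * u y s powr p) \<partial>bdry_measure e"
  define E where "E = exp (- q\<^sup>2 * (z $ e)\<^sup>2 / (4 * \<sigma>\<^sup>2))"
  define g where "g = kernel_const TYPE('n) q * sqrt t powr (- N) * E"
  have g: "0 \<le> g" using kernel_const_pos[of q, where 'n='n] by (simp add: g_def E_def)
  \<comment> \<open>Time windows of length \<open>4 ^ j * \<sigma>\<^sup>2\<close>. The ratio 4
    keeps them disjoint and, for \<open>j < k\<close>, in the first half of the interval up to
    \<open>t\<close>.\<close>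
  define T1 where "T1 j = {4 ^ j * \<sigma>\<^sup>2<..<2 * (4 ^ j * \<sigma>\<^sup>2)}" for j :: nat
  \<comment> \<open>A lower bound for the boundary integral on the window \<open>T1 j\<close>; times
    the length of the window it is the \<open>j\<close>-th increment. Replacing \<open>s\<close> by
    the end \<open>2 * (4 ^ j * \<sigma>\<^sup>2)\<close> of the window is the origin of the factor
    1/2 in the recursion.\<close>
  define d where "d j = \<kappa> * t powr (- N / 2) * a j powr p / (2 * (4 ^ j * \<sigma>\<^sup>2))" for j
  have d: "0 \<le> d j" for j using \<kappa> \<sigma>2 by (simp add: d_def)
  have T1_t: "s < t" "s \<le> t / 2" if "s \<in> T1 j" "j < k" for s j
  proof -
    have "4 * 4 ^ j \<le> (4 ^ k :: real)"
      using that(2) power_increasing[of "Suc j" k "4::real"] by simp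
    then have "4 * 4 ^ j * \<sigma>\<^sup>2 \<le> 4 ^ k * \<sigma>\<^sup>2" using \<sigma>2 by (intro mult_right_mono) auto
    moreover have "s < 2 * (4 ^ j * \<sigma>\<^sup>2)" using that(1) by (simp add: T1_def)
    ultimately show "s \<le> t / 2" using less.prems(1) by simp
    then show "s < t" using t0 by simp
  qed
  have T1_disj: "i = j" if "s \<in> T1 i" "s \<in> T1 j" for s i j
  proof -
    have False if "i < j" "s \<in> T1 i" "s \<in> T1 j" for i j
    proof -
      have "4 * 4 ^ i \<le> (4 ^ j :: real)"
        using that(1) power_increasing[of "Suc i" j "4::real"] by simp
      then have "4 * 4 ^ i * \<sigma>\<^sup>2 \<le> 4 ^ j * \<sigma>\<^sup>2" using \<sigma>2 by (intro mult_right_mono) auto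
      then show False using that(2,3) \<sigma>2 by (simp add: T1_def)
    qed
    then show ?thesis using that by (metis linorder_neqE_nat)
  qed
  have pulse: "ennreal (d j) \<le> ?I s" if j: "j < k" and s: "s \<in> T1 j" for j s
  proof -
    have s0: "4 ^ j * \<sigma>\<^sup>2 < s" "s < 2 * (4 ^ j * \<sigma>\<^sup>2)" using s by (auto simp: T1_def)
    have "0 < 4 ^ j * \<sigma>\<^sup>2" using \<sigma>2 by simp
    then have s1: "0 < s" using s0(1) by linarith
    have IH: "a j * s powr (- N / 2) \<le> u y s" if "y \<in> bdry_cube e z (sqrt s)" for y
      unfolding N_def by (rule less.IH[OF j]) (use s0 T1_t[OF s j] less.prems(2) that in auto)
    have "d j \<le> \<kappa> * t powr (- N / 2) * a j powr p / s"
      unfolding d_def using s0 s1 \<kappa> by (intro divide_left_mono) auto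
    \<comment> \<open>Here criticality enters: \<open>N * p / 2 = 1 + (N - 1) / 2\<close>, so area
      and lower bound combine to exactly \<open>1 / s\<close>, whose integral over a window does not
      depend on the scale.\<close>
    also have "\<dots> = \<kappa> * t powr (- N / 2) * s powr ((N - 1) / 2) * (a j * s powr (- N / 2)) powr p"
    proof -
      have "(a j * s powr (- N / 2)) powr p = a j powr p * s powr (- N / 2 * p)"
        by (simp add: powr_mult powr_powr)
      moreover have "- N / 2 * p = - 1 - (N - 1) / 2"
        using N by (simp add: p N_def[symmetric] field_simps)
      moreover have "s powr ((N - 1) / 2) * s powr (- 1 - (N - 1) / 2) = 1 / s"
        using s1 by (simp add: powr_add[symmetric] powr_minus_divide)
      ultimately show ?thesis by (simp add: mult_ac)
    qed
    finally have "ennreal (d j) \<le> ennreal (\<kappa> * t powr (- N / 2) * s powr ((N - 1) / 2) * (a j * s powr (- N / 2)) powr p)"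
      by (rule ennreal_leI)
    also have "\<dots> \<le> ?I s"
      unfolding \<kappa>_def N_def
    proof (rule bdry_cube_heat_spread[OF less.prems(3) s1 T1_t(2)[OF s j]])
      show "(a j * s powr (- real CARD('n) / 2)) powr p \<le> u y s powr p"
        if "y \<in> bdry_cube e z (sqrt s)" for y
        using IH[OF that] a_nonneg[of j] p by (intro powr_mono2) (auto simp: N_def)
    qed simp
    finally show ?thesis .
  qed
  have "ennreal (\<Sum>j<k. \<kappa> / 2 * a j powr p * t powr (- N / 2)) = (\<Sum>j<k. ennreal (d j) * emeasure lborel (T1 j))"
  proof -
    have "\<kappa> / 2 * a j powr p * t powr (- N / 2) = d j * (4 ^ j * \<sigma>\<^sup>2)" for j
      using \<sigma> by (simp add: d_def)
    moreover have "emeasure lborel (T1 j) = ennreal (4 ^ j * \<sigma>\<^sup>2)" for j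
      using \<sigma>2 by (simp add: T1_def)
    ultimately show ?thesis
      using d \<sigma>2 by (simp add: ennreal_mult[symmetric] del: ennreal_mult'' ennreal_mult')
  qed
  also have "\<dots> = (\<integral>\<^sup>+s. (\<Sum>j<k. ennreal (d j) * indicator (T1 j) s) \<partial>lborel)"
    by (subst nn_integral_sum) (auto simp: T1_def nn_integral_cmult_indicator)
  also have "\<dots> \<le> (\<integral>\<^sup>+s. indicator {\<sigma>\<^sup>2 / 2<..<t} s * ?I s \<partial>lborel)"
  proof (rule nn_integral_mono)
    fix s
    show "(\<Sum>j<k. ennreal (d j) * indicator (T1 j) s) \<le> indicator {\<sigma>\<^sup>2 / 2<..<t} s * ?I s"
    proof (cases "\<exists>j<k. s \<in> T1 j")
      case True
      then obtain j where j: "j < k" "s \<in> T1 j" by blast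
      have "(\<Sum>i<k. ennreal (d i) * indicator (T1 i) s) = (\<Sum>i<k. if i = j then ennreal (d j) else 0)"
        using j T1_disj by (intro sum.cong refl) (auto simp: indicator_def)
      also have "\<dots> = ennreal (d j)" using j by (simp add: sum.delta)
      also have "\<dots> \<le> ?I s" by (rule pulse[OF j])
      also have "s \<in> {\<sigma>\<^sup>2 / 2<..<t}"
      proof -
        have "1 * \<sigma>\<^sup>2 \<le> 4 ^ j * \<sigma>\<^sup>2" using \<sigma>2 by (intro mult_right_mono) auto
        then have "\<sigma>\<^sup>2 / 2 < s" using j(2) \<sigma>2 unfolding T1_def greaterThanLessThan_iff by linarith
        then show ?thesis using T1_t[OF j(2,1)] by simp
      qed
      then have "?I s = indicator {\<sigma>\<^sup>2 / 2<..<t} s * ?I s" by simp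
      finally show ?thesis .
    next
      case False
      then have "(\<Sum>j<k. ennreal (d j) * indicator (T1 j) s) = 0" by auto
      then show ?thesis by simp
    qed
  qed
  finally have "ennreal (g * measure \<mu> (ball z \<sigma>)) + ennreal (\<Sum>j<k. \<kappa> / 2 * a j powr p * t powr (- N / 2)) \<le>
      ennreal (g * measure \<mu> (ball z \<sigma>)) + (\<integral>\<^sup>+s. indicator {\<sigma>\<^sup>2 / 2<..<t} s * ?I s \<partial>lborel)"
    by (rule add_left_mono)
  also have "\<dots> \<le> ennreal (u x t)"
  \<comment> \<open>Kernel times between \<open>t / q\<close> and \<open>t\<close> are those covered
    by \<open>neumannG_lower\<close> with \<open>\<rho> = sqrt t\<close>.\<close>
  proof (rule initial_trace_lower_bound[OF sol tr open_ball bounded_ball xD t0 less.prems(2), where \<eta> = "t - t / q"])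
    show "0 < t - t / q" using q t0 by (simp add: field_simps)
    fix y h assume y: "y \<in> ball z \<sigma>" and h: "t - (t - t / q) \<le> h" "h \<le> t"
    show "g \<le> neumannG e x y h"
      unfolding g_def E_def N_def
      by (rule neumannG_lower[OF q \<sigma> \<sigma>st z less.prems(3) y]) (use h t0 in auto)
  qed (use \<sigma>2 g in auto)
  finally have "g * measure \<mu> (ball z \<sigma>) + (\<Sum>j<k. \<kappa> / 2 * a j powr p * t powr (- N / 2)) \<le> u x t"
    using g \<kappa> solution_nonneg[OF sol xD t0 less.prems(2)]
    by (subst (asm) ennreal_plus[symmetric]) (auto intro!: sum_nonneg simp: ennreal_le_iff)
  also have "g * measure \<mu> (ball z \<sigma>) = a 0 * t powr (- N / 2)"
    using t0 by (simp add: g_def E_def a0 powr_half_sqrt[symmetric] powr_powr)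
  also have "a 0 * t powr (- N / 2) + (\<Sum>j<k. \<kappa> / 2 * a j powr p * t powr (- N / 2)) = a k * t powr (- N / 2)"
    by (subst (2) a_sum) (simp add: sum_distrib_right distrib_right)
  finally show ?case by (simp add: N_def)
qed

text \<open>The number \<open>K\<close> of scales between \<open>\<sigma>\<^sup>2\<close> and
  \<open>T\<close> is comparable to the logarithm. The doubling argument on a cylinder at times of
  order \<open>T\<close> keeps \<open>a K\<close> below a bound \<open>B\<close> independent of
  \<open>\<sigma>\<close> and \<open>x\<close>, so the recursion limits \<open>K\<close> by a
  multiple of \<open>a 0 powr (1 - p)\<close>. Since \<open>(1 - p) * (- N) = 1\<close>, this bounds
  \<open>a 0\<close> by the power \<open>- N\<close> of the logarithm.\<close>

lemma trace_ball_bound_critical: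
  fixes u :: "real^'n::finite \<Rightarrow> real \<Rightarrow> real"
  assumes sol: "is_solution e p T u" and tr: "initial_trace e u \<mu>" and p: "p = 1 + 1 / real CARD('n)"
    and \<delta>: "0 < \<delta>" and T: "0 < T"
  obtains C where "0 < C"
    "\<And>\<sigma> x. 0 < \<sigma> \<Longrightarrow> \<sigma> < sqrt T \<Longrightarrow> x \<in> halfD e \<Longrightarrow>
      exp (- (1 + \<delta>) * (x $ e)\<^sup>2 / (4 * \<sigma>\<^sup>2)) * measure \<mu> (ball x \<sigma>) \<le> C * ln (exp 1 + sqrt T / \<sigma>) powr (- real CARD('n))"
proof -
  define N where "N = real CARD('n)"
  have N: "1 \<le> N" by (simp add: N_def Suc_leI)
  have p1: "1 < p" "1 / (p - 1) = N" using N by (auto simp: p N_def)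
  define q where "q = sqrt (1 + \<delta>)"
  have q: "1 < q" "q\<^sup>2 = 1 + \<delta>" using \<delta> by (auto simp: q_def)
  define kc where "kc = kernel_const TYPE('n) q"
  have kc: "0 < kc" by (simp add: kc_def kernel_const_pos)
  define c where "c = spread_const TYPE('n) / 2"
  have c: "0 < c" by (simp add: c_def spread_const_pos)
  define A where "A = (2 / cube_const TYPE('n))\<^sup>2 / (1 - 4 powr (1 - p))"
  \<comment> \<open>The cap on \<open>a K\<close>: the cylinder bound for a time span
    \<open>T / 4\<close>, with the factor \<open>(T / 2) powr (- N / 2)\<close> undone.\<close>
  define B where "B = (A / (T / 4)) powr (1 / (2 * (p - 1))) * (T / 2) powr (N / 2)"
  define \<gamma> where "\<gamma> = (p - 1) * c * (1 + c * B powr (p - 1)) powr (- p)"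
  have \<gamma>: "0 < \<gamma>"
  proof -
    have "0 < 1 + c * B powr (p - 1)" using c by (intro add_pos_nonneg) auto
    then show ?thesis using p1 c by (simp add: \<gamma>_def)
  qed
  obtain C1 where C1: "0 < C1" "\<And>\<sigma> x. 0 < \<sigma> \<Longrightarrow> \<sigma>\<^sup>2 \<le> T \<Longrightarrow> x \<in> halfD e \<Longrightarrow>
      exp (- (1 + \<delta>) * (x $ e)\<^sup>2 / (4 * \<sigma>\<^sup>2)) * measure \<mu> (ball x \<sigma>) \<le> C1 * \<sigma> powr (real CARD('n) - 1 / (p - 1))"
    using trace_ball_bound[OF sol tr p1(1) \<delta>] by blast
  \<comment> \<open>One summand per regime: for \<open>sqrt T / \<sigma> < 4\<close> the logarithm
    is at most 3 and the general bound suffices; otherwise the recursion applies.\<close>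
  define C where "C = C1 * 3 powr N + (\<gamma> / 4) powr (- N) / kc"
  have C: "0 < C" using C1(1) \<gamma> kc by (auto simp: C_def intro!: add_pos_pos)
  have "exp (- (1 + \<delta>) * (x $ e)\<^sup>2 / (4 * \<sigma>\<^sup>2)) * measure \<mu> (ball x \<sigma>) \<le> C * ln (exp 1 + sqrt T / \<sigma>) powr (- N)"
    if \<sigma>: "0 < \<sigma>" "\<sigma> < sqrt T" and x: "x \<in> halfD e" for \<sigma> x
  proof -
    define M where "M = exp (- (1 + \<delta>) * (x $ e)\<^sup>2 / (4 * \<sigma>\<^sup>2)) * measure \<mu> (ball x \<sigma>)"
    define L where "L = ln (exp 1 + sqrt T / \<sigma>)"
    have M: "0 \<le> M" by (simp add: M_def)
    have \<sigma>2: "0 < \<sigma>\<^sup>2" using \<sigma> by simp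
    have "0 < sqrt T / \<sigma>" using \<sigma> T by simp
    then have "ln (exp 1) < L" unfolding L_def by (intro ln_less_cancel_iff[THEN iffD2]) (auto intro: add_pos_pos)
    then have L: "1 < L" by simp
    have "\<sigma>\<^sup>2 \<le> T" using power_mono[of \<sigma> "sqrt T" 2] \<sigma> T by simp
    \<comment> \<open>At the critical exponent the general bound carries the power 0 of
      \<open>\<sigma>\<close>.\<close>
    from C1(2)[OF \<sigma>(1) this x] have M_C1: "M \<le> C1" using \<sigma>(1) by (simp add: M_def p1(2) N_def[symmetric])
    have "M \<le> C * L powr (- N)"
    proof (cases "sqrt T / \<sigma> < 4")
      case True
      have "exp 1 + sqrt T / \<sigma> \<le> exp (3::real)"
      proof -
        have e2: "(2::real) \<le> exp 1" using exp_ge_add_one_self[of "1::real"] by simp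
        have "exp (3::real) = exp 1 * (exp 1 * exp 1)" by (simp add: exp_add[symmetric])
        also have "\<dots> \<ge> exp 1 * (2 * 2)" using e2 by (intro mult_left_mono mult_mono) auto
        finally show ?thesis using True e2 by linarith
      qed
      then have "L \<le> ln (exp 3)" unfolding L_def using \<open>0 < sqrt T / \<sigma>\<close>
        by (intro ln_le_cancel_iff[THEN iffD2]) (auto intro: add_pos_pos)
      then have "L \<le> 3" by simp
      then have "3 powr (- N) \<le> L powr (- N)" using L N by (intro powr_mono2') auto
      then have "3 powr N * 3 powr (- N) \<le> 3 powr N * L powr (- N)" by (intro mult_left_mono) auto
      then have "1 \<le> 3 powr N * L powr (- N)" by (simp add: powr_add[symmetric])
      then have "C1 * 1 \<le> C1 * (3 powr N * L powr (- N))" using C1(1) by (intro mult_left_mono) auto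
      then have "M \<le> C1 * 3 powr N * L powr (- N)" using M_C1 by simp
      also have "\<dots> \<le> C * L powr (- N)"
        unfolding C_def using kc by (intro mult_right_mono) auto
      finally show ?thesis .
    next
      case False
      show ?thesis
      \<comment> \<open>The recursion needs a positive start, since \<open>a 0\<close> is raised to
        a negative power.\<close>
      proof (cases "M = 0")
        case True
        then show ?thesis using C by simp
      next
        case M0: False
        define R where "R = T / (4 * \<sigma>\<^sup>2)"
        have "4\<^sup>2 \<le> (sqrt T / \<sigma>)\<^sup>2" using False by (intro power_mono) auto
        then have R4: "4 \<le> R" using T \<sigma>2 by (simp add: R_def power_divide field_simps)
        \<comment> \<open>The last scale with \<open>4 ^ K * \<sigma>\<^sup>2 \<le> T / 4\<close>,
          so that the lower bound with \<open>a K\<close> holds on the whole cylinder from time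
          \<open>T / 4\<close> to \<open>T / 2\<close>.\<close>
        define K where "K = nat \<lfloor>log 4 R\<rfloor>"
        have logR: "1 \<le> log 4 R" using R4 by (subst le_log_iff) auto
        have K1: "1 \<le> K" using logR unfolding K_def by linarith
        have KR: "real K \<le> log 4 R" "log 4 R < real K + 1" using logR unfolding K_def by linarith+
        have "4 ^ K = 4 powr real K" by (simp add: powr_realpow)
        also have "\<dots> \<le> R" using KR(1) R4 by (subst (asm) le_log_iff) auto
        finally have K_le: "4 ^ K * \<sigma>\<^sup>2 \<le> T / 4" using \<sigma>2 by (simp add: R_def field_simps)
        have "R < 4 powr (real K + 1)" using KR(2) R4 by (subst (asm) log_less_iff) auto
        also have "\<dots> = 4 ^ (K + 1)" using powr_realpow[of 4 "K + 1"] by (simp add: add.commute)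
        finally have R_lt: "R < 4 ^ (K + 1)" .
        \<comment> \<open>\<open>sqrt T / \<sigma> < 2 ^ (K + 2)\<close> bounds the logarithm by
          \<open>K + 3\<close>, and \<open>1 \<le> K\<close> absorbs the 3.\<close>
        have L_le: "L \<le> 4 * real K"
        proof -
          have "(sqrt T / \<sigma>)\<^sup>2 < (2 ^ (K + 2))\<^sup>2"
          proof -
            have "(sqrt T / \<sigma>)\<^sup>2 = 4 * R" using T \<sigma>2 by (simp add: R_def power_divide)
            also have "\<dots> < 4 * 4 ^ (K + 1)" using R_lt by simp
            also have "\<dots> = (2 ^ (K + 2))\<^sup>2"
              by (simp add: power_mult_distrib[symmetric] power2_eq_square)
            finally show ?thesis .
          qed
          then have "sqrt T / \<sigma> < 2 ^ (K + 2)" by (rule power_less_imp_less_base) simp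
          moreover have "exp 1 \<le> (2 ^ (K + 2) :: real)"
          proof -
            have "exp 1 \<le> (4::real)" using exp_le by linarith
            also have "(4::real) = 2 ^ 2" by simp
            also have "\<dots> \<le> 2 ^ (K + 2)" by (intro power_increasing) auto
            finally show ?thesis .
          qed
          ultimately have "exp 1 + sqrt T / \<sigma> \<le> 2 ^ (K + 3)" by (simp add: power_add)
          also have "\<dots> \<le> exp 1 ^ (K + 3)"
            using exp_ge_add_one_self[of "1::real"] by (intro power_mono) auto
          also have "\<dots> = exp (real (K + 3))" using exp_of_nat_mult[of "K + 3" "1::real"] by simp
          finally have "L \<le> ln (exp (real (K + 3)))"
            unfolding L_def using \<open>0 < sqrt T / \<sigma>\<close>
            by (intro ln_le_cancel_iff[THEN iffD2]) (auto intro: add_pos_pos)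
          also have "\<dots> = real K + 3" by simp
          finally show ?thesis using K1 by linarith
        qed
        define a where "a = rec_nat (kc * M) (\<lambda>_ v. v + c * v powr p)"
        have a: "a 0 = kc * M" "\<And>k. a (Suc k) = a k + c * a k powr p" by (simp_all add: a_def)
        have a0: "0 < a 0" using M M0 kc by (simp add: a)
        have apos: "0 < a k" for k
          by (induction k) (use a0 c in \<open>auto simp: a(2) intro!: add_pos_nonneg\<close>)
        have low: "a K * t powr (- N / 2) \<le> u y t" if "T / 4 \<le> t" "t < T" "y \<in> bdry_cube e x (sqrt t)" for t y
          unfolding N_def
          by (rule critical_lower_bound[OF sol tr p q(1) \<sigma>(1) x _ _ _ that(2,3)])
            (use that K_le in \<open>auto simp: a kc_def M_def q(2) c_def\<close>)
        have "a K \<le> B"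
        proof -
          define D where "D = a K * (T / 2) powr (- N / 2)"
          have D: "0 < D" using apos T by (simp add: D_def)
          have "D powr (2 * (p - 1)) * (T / 2 - T / 4) \<le> A"
            unfolding A_def
          proof (rule solution_cylinder_upper[OF sol p1(1), of _ _ "sqrt (T / 4)" _ x])
            fix y \<tau> assume y: "y \<in> bdry_cube e x (sqrt (T / 4))" and \<tau>: "T / 4 \<le> \<tau>" "\<tau> \<le> T / 2"
            have "D \<le> a K * \<tau> powr (- N / 2)"
              unfolding D_def using \<tau> T N apos[of K] by (intro mult_left_mono powr_mono2') auto
            also have "\<dots> \<le> u y \<tau>"
              using y bdry_cube_mono[of "sqrt (T / 4)" "sqrt \<tau>" e x] \<tau> T by (intro low) auto
            finally show "D \<le> u y \<tau>" .
          qed (use T D in auto)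
          then have "D powr (2 * (p - 1)) \<le> A / (T / 4)"
            using T by (simp add: pos_le_divide_eq field_simps)
          then have "D \<le> (A / (T / 4)) powr (1 / (2 * (p - 1)))"
            using D p1(1) by (intro powr_le_cancel_exponent) auto
          then have "D * (T / 2) powr (N / 2) \<le> B"
            unfolding B_def by (intro mult_right_mono) auto
          moreover have "D * (T / 2) powr (N / 2) = a K"
            using T powr_add[of "T / 2" "- N / 2" "N / 2"] by (simp add: D_def)
          ultimately show ?thesis by simp
        qed
        then have "real K * \<gamma> \<le> a 0 powr (1 - p)"
          unfolding \<gamma>_def by (rule superlinear_recursion_bound[OF p1(1) c a0 a(2)])
        moreover have "\<gamma> / 4 * L \<le> real K * \<gamma>"
          using L_le \<gamma> mult_left_mono[of L "4 * real K" "\<gamma> / 4"] by (simp add: mult_ac)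
        ultimately have "\<gamma> / 4 * L \<le> a 0 powr (1 - p)" by linarith
        then have "(a 0 powr (1 - p)) powr (- N) \<le> (\<gamma> / 4 * L) powr (- N)"
          using \<gamma> L N by (intro powr_mono2') auto
        moreover have "(1 - p) * (- N) = 1" using N by (simp add: p N_def)
        ultimately have "a 0 \<le> (\<gamma> / 4 * L) powr (- N)"
          using a0 by (simp add: powr_powr)
        then have "M \<le> (\<gamma> / 4 * L) powr (- N) / kc"
          using kc by (simp add: a pos_le_divide_eq mult.commute)
        also have "\<dots> = (\<gamma> / 4) powr (- N) / kc * L powr (- N)"
          by (subst powr_mult) simp
        also have "\<dots> \<le> C * L powr (- N)"
          unfolding C_def using C1(1) by (intro mult_right_mono) auto
        finally show ?thesis .
      qed
    qed
    then show ?thesis by (simp add: M_def L_def)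
  qed
  then show ?thesis using that C by (simp add: N_def)
qed

section \<open>Existence and uniqueness of the initial trace\<close>

lemma reflect_nth: "reflect e x $ i = (if i = e then - (x $ e) else x $ i)"
  by (simp add: reflect_def)

lemma norm_reflect: "norm (reflect e x) = norm x"
  by (simp add: norm_vec_def L2_set_def reflect_nth if_distrib[of "\<lambda>z. z\<^sup>2"] cong: if_cong sum.cong)
     (metis (no_types, lifting) power2_minus)

lemma reflect_diff: "reflect e x - reflect e y = reflect e (x - y)"
  by (simp add: vec_eq_iff reflect_nth)

lemma reflect_measurable [measurable]: "reflect (e::'n::finite) \<in> borel_measurable borel"
proof (rule borel_measurable_continuous_onI)
  have "continuous_on UNIV (\<lambda>y::real^'n. if i = e then - (y $ e) else y $ i)" for i
    by (cases "i = e") (auto intro!: continuous_on_minus continuous_on_component continuous_on_id)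
  then show "continuous_on UNIV (reflect e)"
    unfolding reflect_def[abs_def] by (rule continuous_on_vec_lambda)
qed

text \<open>A diagonal map with entries 1 and a single -1 has Jacobian factor 1.\<close>

lemma distr_lborel_reflect: "distr lborel borel (reflect e) = (lborel :: (real^'n::finite) measure)"
proof -
  define c :: "real^'n \<Rightarrow> real" where "c j = (if j = axis e 1 then - 1 else 1)" for j
  have inner: "(\<Sum>j\<in>Basis. (c j * (x \<bullet> j)) *\<^sub>R j) \<bullet> b = c b * (x \<bullet> b)" if "b \<in> Basis" for x b :: "real^'n"
    using that by (simp add: inner_sum_left inner_Basis if_distrib sum.delta cong: if_cong)
  have "(\<Sum>j\<in>Basis. (c j * (x \<bullet> j)) *\<^sub>R j) = reflect e x" for x
  proof (rule vec_eq_iff[THEN iffD2], rule allI)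
    fix i
    have "(\<Sum>j\<in>Basis. (c j * (x \<bullet> j)) *\<^sub>R j) $ i = c (axis i 1) * (x \<bullet> axis i 1)"
      using inner[of "axis i 1" x] by (simp add: inner_axis)
    then show "(\<Sum>j\<in>Basis. (c j * (x \<bullet> j)) *\<^sub>R j) $ i = reflect e x $ i"
      by (auto simp: c_def reflect_nth inner_axis axis_eq_axis)
  qed
  then have "lborel = density (distr lborel borel (reflect e)) (\<lambda>_. (\<Prod>j\<in>Basis. \<bar>c j\<bar>))"
    using lborel_affine_euclidean[of c 0] by (simp add: c_def)
  also have "(\<Prod>j\<in>Basis. \<bar>c j\<bar>) = 1" by (intro prod.neutral) (auto simp: c_def)
  finally show ?thesis by (simp add: density_1)
qed

lemma ball_borel [measurable]: "ball x r \<in> sets borel"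
  by simp

lemma heatGamma_measurable [measurable (raw)]:
  assumes [measurable]: "f \<in> borel_measurable M"
  shows "(\<lambda>x. heatGamma (f x :: real^'n::finite) t) \<in> borel_measurable M"
  unfolding heatGamma_def by measurable

text \<open>The kernel is the product over the coordinates of centred normal densities of variance
  \<open>2 * h\<close>.\<close>

lemma nn_integral_heatGamma:
  assumes h: "0 < h"
  shows "(\<integral>\<^sup>+x. ennreal (heatGamma (x::real^'n::finite) h) \<partial>lborel) = 1"
proof -
  let ?f = "\<lambda>b. normal_density 0 (sqrt (2 * h))"
  have dens: "normal_density 0 (sqrt (2 * h)) y = (4 * pi * h) powr (- 1 / 2) * exp (- y\<^sup>2 / (4 * h))" for y
    using h by (simp add: normal_density_def powr_minus_divide powr_half_sqrt mult_ac)
  have eq: "heatGamma x h = (\<Prod>b\<in>Basis. ?f b (x \<bullet> b))" for x :: "real^'n"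
  proof -
    have "(\<Prod>b\<in>(Basis::(real^'n) set). ?f b (x \<bullet> b)) =
        ((4 * pi * h) powr (- 1 / 2)) ^ CARD('n) * exp (\<Sum>b\<in>Basis. - (x \<bullet> b)\<^sup>2 / (4 * h))"
      unfolding dens by (simp add: prod.distrib exp_sum)
    also have "(\<Sum>b\<in>Basis. - (x \<bullet> b)\<^sup>2 / (4 * h)) = - (norm x)\<^sup>2 / (4 * h)"
    proof -
      have "(norm x)\<^sup>2 = (\<Sum>b\<in>Basis. (x \<bullet> b)\<^sup>2)"
        unfolding power2_norm_eq_inner by (subst euclidean_inner) (simp add: power2_eq_square)
      then show ?thesis by (simp add: sum_divide_distrib sum_negf)
    qed
    also have "((4 * pi * h) powr (- 1 / 2)) ^ CARD('n) = (4 * pi * h) powr (- real CARD('n) / 2)"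
      using h by (simp add: powr_realpow[symmetric] powr_powr)
    finally show ?thesis by (simp add: heatGamma_def)
  qed
  have "(\<integral>\<^sup>+x. ennreal (heatGamma (x::real^'n) h) \<partial>lborel) =
      (\<integral>\<^sup>+x. (\<Prod>b\<in>Basis. ennreal (?f b (x \<bullet> b))) \<partial>(lborel :: (real^'n) measure))"
    by (simp add: eq prod_ennreal)
  also have "\<dots> = (\<Prod>b\<in>(Basis :: (real^'n) set). \<integral>\<^sup>+y. ennreal (?f b y) \<partial>lborel)"
    by (rule nn_integral_lborel_prod) auto
  also have "(\<integral>\<^sup>+y. ennreal (normal_density 0 (sqrt (2 * h)) y) \<partial>lborel) = 1"
    using h by (simp add: nn_integral_eq_integral)
  finally show ?thesis by simp
qed

text \<open>Outside the ball half of the Gaussian exponent is spent on smallness, the other half on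
  integrability.\<close>
lemma heatGamma_ball_mass:
  assumes h: "0 < h" and r: "0 < r"
  shows "1 \<le> (\<integral>\<^sup>+x. ennreal (indicator (ball 0 r) x * heatGamma (x::real^'n::finite) h) \<partial>lborel) +
    ennreal (2 powr (real CARD('n) / 2) * exp (- r\<^sup>2 / (8 * h)))"
proof -
  let ?c = "2 powr (real CARD('n) / 2) * exp (- r\<^sup>2 / (8 * h))"
  have tail: "heatGamma x h \<le> ?c * heatGamma x (2 * h)" if "r \<le> norm x" for x :: "real^'n"
  proof -
    have "exp (- (norm x)\<^sup>2 / (4 * h)) = exp (- (norm x)\<^sup>2 / (8 * h)) * exp (- (norm x)\<^sup>2 / (4 * (2 * h)))"
      using h by (simp add: exp_add[symmetric])
    also have "\<dots> \<le> exp (- r\<^sup>2 / (8 * h)) * exp (- (norm x)\<^sup>2 / (4 * (2 * h)))"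
      using h r that by (intro mult_right_mono) (auto intro!: divide_right_mono power_mono)
    finally have "heatGamma x h \<le> (4 * pi * h) powr (- real CARD('n) / 2) *
        (exp (- r\<^sup>2 / (8 * h)) * exp (- (norm x)\<^sup>2 / (4 * (2 * h))))"
      unfolding heatGamma_def by (intro mult_left_mono) auto
    \<comment> \<open>\<open>2 powr (N / 2)\<close> is the ratio of the prefactors at the times
      \<open>h\<close> and \<open>2 * h\<close>.\<close>
    also have "(4 * pi * h) powr (- real CARD('n) / 2) =
        2 powr (real CARD('n) / 2) * (4 * pi * (2 * h)) powr (- real CARD('n) / 2)"
    proof -
      have "4 * pi * (2 * h) = 2 * (4 * pi * h)" by simp
      then have "(4 * pi * (2 * h)) powr (- real CARD('n) / 2) =
          2 powr (- real CARD('n) / 2) * (4 * pi * h) powr (- real CARD('n) / 2)"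
        by (simp only: powr_mult)
      moreover have "2 powr (real CARD('n) / 2) * 2 powr (- real CARD('n) / 2) = (1::real)"
        by (simp add: powr_add[symmetric])
      ultimately show ?thesis by simp
    qed
    finally show ?thesis unfolding heatGamma_def by (simp add: mult_ac)
  qed
  have "1 = (\<integral>\<^sup>+x. ennreal (heatGamma (x::real^'n) h) \<partial>lborel)"
    using nn_integral_heatGamma[OF h] by simp
  also have "\<dots> \<le> (\<integral>\<^sup>+x. ennreal (indicator (ball 0 r) x * heatGamma (x::real^'n) h) +
      ennreal ?c * ennreal (heatGamma x (2 * h)) \<partial>lborel)"
  proof (rule nn_integral_mono)
    fix x :: "real^'n"
    show "ennreal (heatGamma x h) \<le> ennreal (indicator (ball 0 r) x * heatGamma x h) +
        ennreal ?c * ennreal (heatGamma x (2 * h))"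
    proof (cases "x \<in> ball 0 r")
      case False
      then show ?thesis
        using tail[of x] by (simp add: ennreal_mult[symmetric] heatGamma_nonneg del: ennreal_mult'' ennreal_mult')
    qed simp
  qed
  also have "\<dots> = (\<integral>\<^sup>+x. ennreal (indicator (ball 0 r) x * heatGamma (x::real^'n) h) \<partial>lborel) +
      ennreal ?c * (\<integral>\<^sup>+x. ennreal (heatGamma (x::real^'n) (2 * h)) \<partial>lborel)"
    by (subst nn_integral_add) (auto simp: nn_integral_cmult)
  finally show ?thesis using nn_integral_heatGamma[of "2 * h", where 'n='n] h by simp
qed

lemma halfD_closed: "closed (halfD e)"
  unfolding halfD_def by (intro closed_Collect_le continuous_intros)

lemma halfD_borel [measurable]: "halfD e \<in> sets borel"
  using halfD_closed by (rule borel_closed)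

text \<open>Reflecting the part of the ball outside the half space back into it only brings it closer to
  \<open>y\<close>, so the Neumann kernel has at least the mass of the heat kernel on the full ball.\<close>
lemma neumannG_ball_mass:
  fixes y :: "real^'n::finite"
  assumes y: "y \<in> halfD e"
  shows "(\<integral>\<^sup>+x. ennreal (indicator (ball 0 r) x * heatGamma (x::real^'n) h) \<partial>lborel) \<le>
    (\<integral>\<^sup>+x. ennreal (indicator (halfD e \<inter> ball y r) x * neumannG e x y h) \<partial>lborel)"
proof -
  let ?S = "halfD e \<inter> ball y r"
  have close: "dist y (reflect e x) \<le> dist y x" if "x \<notin> halfD e" for x
  proof -
    have "((y - reflect e x) $ i)\<^sup>2 \<le> ((y - x) $ i)\<^sup>2" for i
    proof (cases "i = e")
      case True
      have "0 \<le> - 4 * (x $ e * y $ e)"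
        using that y by (auto simp: halfD_def intro: mult_nonpos_nonneg)
      then show ?thesis using True by (simp add: reflect_nth power2_eq_square algebra_simps)
    qed (simp add: reflect_nth)
    then show ?thesis
      unfolding dist_norm norm_vec_def L2_set_def by (intro real_sqrt_le_mono sum_mono) simp
  qed
  have "(\<integral>\<^sup>+x. ennreal (indicator (ball 0 r) x * heatGamma (x::real^'n) h) \<partial>lborel) =
      (\<integral>\<^sup>+x. ennreal (indicator (ball 0 r) x * heatGamma x h) \<partial>distr lborel borel ((+) (- y)))"
    by (simp add: lborel_distr_plus)
  also have "\<dots> = (\<integral>\<^sup>+x. ennreal (indicator (ball y r) x * heatGamma (x - y) h) \<partial>lborel)"
    by (subst nn_integral_distr) (auto intro!: nn_integral_cong simp: indicator_def dist_norm norm_minus_commute)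
  also have "\<dots> \<le> (\<integral>\<^sup>+x. ennreal (indicator ?S x * heatGamma (x - y) h) +
      ennreal (indicator ?S (reflect e x) * heatGamma (reflect e x - reflect e y) h) \<partial>lborel)"
  proof (rule nn_integral_mono)
    fix x
    have refl: "heatGamma (reflect e x - reflect e y) h = heatGamma (x - y) h"
      by (simp add: reflect_diff heatGamma_def norm_reflect)
    have "reflect e x \<in> ?S" if "x \<in> ball y r" "x \<notin> halfD e"
      using that close[of x] by (auto simp: halfD_def reflect_nth)
    then show "ennreal (indicator (ball y r) x * heatGamma (x - y) h) \<le> ennreal (indicator ?S x * heatGamma (x - y) h) +
      ennreal (indicator ?S (reflect e x) * heatGamma (reflect e x - reflect e y) h)"
      unfolding refl by (cases "x \<in> halfD e") (auto simp: indicator_def)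
  qed
  also have "\<dots> = (\<integral>\<^sup>+x. ennreal (indicator ?S x * heatGamma (x - y) h) \<partial>lborel) +
      (\<integral>\<^sup>+x. ennreal (indicator ?S (reflect e x) * heatGamma (reflect e x - reflect e y) h) \<partial>lborel)"
    by (rule nn_integral_add) measurable
  \<comment> \<open>Substituting the reflection turns the second integral into the image term of
    \<open>neumannG\<close>.\<close>
  also have "(\<integral>\<^sup>+x. ennreal (indicator ?S (reflect e x) * heatGamma (reflect e x - reflect e y) h) \<partial>lborel) =
      (\<integral>\<^sup>+x. ennreal (indicator ?S x * heatGamma (x - reflect e y) h) \<partial>distr lborel borel (reflect e))"
    by (subst nn_integral_distr) (simp_all add: measurable_lborel2)
  also have "\<dots> = (\<integral>\<^sup>+x. ennreal (indicator ?S x * heatGamma (x - reflect e y) h) \<partial>lborel)"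
    by (simp add: distr_lborel_reflect)
  also have "(\<integral>\<^sup>+x. ennreal (indicator ?S x * heatGamma (x - y) h) \<partial>lborel) + \<dots> =
      (\<integral>\<^sup>+x. ennreal (indicator ?S x * heatGamma (x - y) h) + ennreal (indicator ?S x * heatGamma (x - reflect e y) h) \<partial>lborel)"
    by (rule nn_integral_add[symmetric]) measurable
  also have "\<dots> = (\<integral>\<^sup>+x. ennreal (indicator ?S x * neumannG e x y h) \<partial>lborel)"
    by (intro nn_integral_cong) (auto simp: neumannG_def heatGamma_nonneg indicator_def)
  finally show ?thesis .
qed

section \<open>Almost monotonicity in time and the limit at 0\<close>

lemma C0_uniformly_continuous:
  fixes \<phi> :: "real^'n::finite \<Rightarrow> real"
  assumes "\<phi> \<in> C0" "0 < \<epsilon>"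
  obtains r where "0 < r" "\<And>x y. dist x y < r \<Longrightarrow> \<bar>\<phi> x - \<phi> y\<bar> < \<epsilon>"
proof -
  obtain K where K: "compact K" "continuous_on UNIV \<phi>" "\<And>x. x \<notin> K \<Longrightarrow> \<phi> x = 0"
    using assms(1) by (auto simp: C0_def)
  obtain R where R: "0 < R" "K \<subseteq> ball 0 R"
    using bounded_subset_ballD[OF compact_imp_bounded[OF K(1)]] by blast
  have "uniformly_continuous_on (cball 0 (R + 1)) \<phi>"
    by (intro compact_uniformly_continuous continuous_on_subset[OF K(2)]) auto
  then obtain d where d: "0 < d" "\<And>x y. x \<in> cball 0 (R + 1) \<Longrightarrow> y \<in> cball 0 (R + 1) \<Longrightarrow> dist y x < d \<Longrightarrow> dist (\<phi> y) (\<phi> x) < \<epsilon>"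
    unfolding uniformly_continuous_on_def using assms(2) by metis
  have "\<bar>\<phi> x - \<phi> y\<bar> < \<epsilon>" if xy: "dist x y < min d 1" for x y
  proof (cases "x \<in> cball 0 (R + 1) \<and> y \<in> cball 0 (R + 1)")
    case True
    then show ?thesis using d(2)[of y x] xy by (simp add: dist_real_def)
  next
    case False
    have "norm x \<le> norm y + dist x y" "norm y \<le> norm x + dist x y"
      using norm_triangle_sub[of x y] norm_triangle_sub[of y x] by (auto simp: dist_norm norm_minus_commute)
    then have "x \<notin> ball 0 R" "y \<notin> ball 0 R" using False xy by auto
    then show ?thesis using R K(3) assms(2) by (metis abs_zero diff_zero subsetD)
  qed
  then show ?thesis using that[of "min d 1"] d(1) by simp
qed

text \<open>Uniform continuity handles the kernel near \<open>y\<close>, and its tail outside a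
  small ball is negligible for short times. The error carries \<open>indicator K\<close> because it
  will be integrated against \<open>u\<close>, whose mass is controlled on bounded sets.\<close>

lemma neumann_semigroup_lower:
  fixes \<phi> :: "real^'n::finite \<Rightarrow> real"
  assumes \<phi>: "\<phi> \<in> C0" "\<And>x. 0 \<le> \<phi> x" and K: "\<And>x. x \<notin> K \<Longrightarrow> \<phi> x = 0" and \<epsilon>: "0 < \<epsilon>"
  obtains h0 where "0 < h0" "\<And>h y. 0 < h \<Longrightarrow> h < h0 \<Longrightarrow> y \<in> halfD e \<Longrightarrow>
    ennreal (\<phi> y) \<le> (\<integral>\<^sup>+x. ennreal (indicator (halfD e) x * neumannG e x y h * \<phi> x) \<partial>lborel) + ennreal (\<epsilon> * indicator K y)"
proof -
  obtain B where B: "0 \<le> B" "\<And>x. \<bar>\<phi> x\<bar> \<le> B" using C0_bounded \<phi>(1) by blast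
  obtain r where r: "0 < r" "\<And>x y. dist x y < r \<Longrightarrow> \<bar>\<phi> x - \<phi> y\<bar> < \<epsilon> / 2"
    using C0_uniformly_continuous[OF \<phi>(1), of "\<epsilon> / 2"] \<epsilon> by auto
  define tl where "tl h = 2 powr (real CARD('n) / 2) * exp (- r\<^sup>2 / (8 * h))" for h
  have "(tl \<longlongrightarrow> 2 powr (real CARD('n) / 2) * 0) (at_right 0)"
    unfolding tl_def
  proof (intro tendsto_mult tendsto_const)
    have "filterlim (\<lambda>h::real. inverse h) at_top (at_right 0)" by (rule filterlim_inverse_at_top_right)
    then have "filterlim (\<lambda>h::real. (r\<^sup>2 / 8) * inverse h) at_top (at_right 0)"
      using r(1) by (intro filterlim_tendsto_pos_mult_at_top[OF tendsto_const]) auto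
    then have "filterlim (\<lambda>h::real. - ((r\<^sup>2 / 8) * inverse h)) at_bot (at_right 0)"
      by (simp add: filterlim_uminus_at_top)
    then have "((\<lambda>h. exp (- ((r\<^sup>2 / 8) * inverse h))) \<longlongrightarrow> 0) (at_right 0)"
      by (rule filterlim_compose[OF exp_at_bot])
    then show "((\<lambda>h. exp (- r\<^sup>2 / (8 * h))) \<longlongrightarrow> 0) (at_right 0)"
      by (simp add: field_simps)
  qed
  then have "eventually (\<lambda>h. tl h < \<epsilon> / (2 * (B + 1))) (at_right 0)"
    using \<epsilon> B by (intro order_tendstoD(2)) auto
  then obtain h0 where h0: "0 < h0" "\<And>h. 0 < h \<Longrightarrow> h < h0 \<Longrightarrow> tl h < \<epsilon> / (2 * (B + 1))"
    by (auto simp: eventually_at_right_field)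
  have "ennreal (\<phi> y) \<le> (\<integral>\<^sup>+x. ennreal (indicator (halfD e) x * neumannG e x y h * \<phi> x) \<partial>lborel) + ennreal (\<epsilon> * indicator K y)"
    if h: "0 < h" "h < h0" and y: "y \<in> halfD e" for h y
  \<comment> \<open>Off \<open>K\<close>, where \<open>\<phi>\<close> vanishes, and where it is
    below \<open>\<epsilon> / 2\<close>, the estimate is immediate.\<close>
  proof (cases "y \<in> K \<and> \<epsilon> / 2 \<le> \<phi> y")
    case False
    then have "\<phi> y \<le> \<epsilon> * indicator K y" using K[of y] \<epsilon> by (cases "y \<in> K") auto
    then have "ennreal (\<phi> y) \<le> ennreal (\<epsilon> * indicator K y)" by (rule ennreal_leI)
    then show ?thesis by (rule add_increasing[OF zero_le])
  next
    case True
    \<comment> \<open>A lower bound for \<open>\<phi>\<close> on the ball of radius \<open>r\<close>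
      around \<open>y\<close>; the other \<open>\<epsilon> / 2\<close> of the error pays for the
      Gaussian tail.\<close>
    define m where "m = \<phi> y - \<epsilon> / 2"
    have m: "0 \<le> m" "m \<le> B" using True B(2)[of y] \<epsilon> by (auto simp: m_def)
    let ?S = "halfD e \<inter> ball y r"
    let ?P = "\<integral>\<^sup>+x. ennreal (indicator (ball 0 r) x * heatGamma (x::real^'n) h) \<partial>lborel"
    have "ennreal m * 1 \<le> ennreal m * (?P + ennreal (tl h))"
      unfolding tl_def by (intro mult_left_mono heatGamma_ball_mass h(1) r(1)) auto
    also have "\<dots> = ennreal m * ?P + ennreal (m * tl h)"
      using m by (simp add: distrib_left ennreal_mult tl_def)
    also have "\<dots> \<le> (\<integral>\<^sup>+x. ennreal (indicator (halfD e) x * neumannG e x y h * \<phi> x) \<partial>lborel) + ennreal (\<epsilon> / 2)"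
    proof (rule add_mono)
      have "ennreal m * ?P \<le> ennreal m * (\<integral>\<^sup>+x. ennreal (indicator ?S x * neumannG e x y h) \<partial>lborel)"
        by (intro mult_left_mono neumannG_ball_mass[OF y]) auto
      also have "\<dots> = (\<integral>\<^sup>+x. ennreal m * ennreal (indicator ?S x * neumannG e x y h) \<partial>lborel)"
        unfolding neumannG_def by (rule nn_integral_cmult[symmetric]) measurable
      also have "\<dots> \<le> (\<integral>\<^sup>+x. ennreal (indicator (halfD e) x * neumannG e x y h * \<phi> x) \<partial>lborel)"
      proof (rule nn_integral_mono)
        fix x
        have "m * (indicator ?S x * neumannG e x y h) \<le> indicator (halfD e) x * neumannG e x y h * \<phi> x"
        proof (cases "x \<in> ?S")
          case True
          then have "\<bar>\<phi> y - \<phi> x\<bar> < \<epsilon> / 2" by (intro r(2)) simp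
          then have "m \<le> \<phi> x" unfolding m_def by linarith
          then have "m * neumannG e x y h \<le> \<phi> x * neumannG e x y h"
            by (intro mult_right_mono neumannG_nonneg)
          then show ?thesis using True by (simp add: mult.commute)
        next
          case False
          have "0 \<le> indicator (halfD e) x * neumannG e x y h * \<phi> x"
            by (simp add: neumannG_nonneg \<phi>(2))
          then show ?thesis using False by simp
        qed
        then show "ennreal m * ennreal (indicator ?S x * neumannG e x y h) \<le> ennreal (indicator (halfD e) x * neumannG e x y h * \<phi> x)"
          using m(1) by (subst ennreal_mult[symmetric]) (auto simp: neumannG_nonneg intro: ennreal_leI)
      qed
      finally show "ennreal m * ?P \<le> (\<integral>\<^sup>+x. ennreal (indicator (halfD e) x * neumannG e x y h * \<phi> x) \<partial>lborel)" .
      have "m * tl h \<le> B * (\<epsilon> / (2 * (B + 1)))"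
        using m h0(2)[OF h] by (intro mult_mono) (auto simp: tl_def intro: order_trans)
      also have "\<dots> \<le> \<epsilon> / 2" using B(1) \<epsilon> by (simp add: field_simps)
      finally show "ennreal (m * tl h) \<le> ennreal (\<epsilon> / 2)" by (rule ennreal_leI)
    qed
    finally have "ennreal m \<le>
        (\<integral>\<^sup>+x. ennreal (indicator (halfD e) x * neumannG e x y h * \<phi> x) \<partial>lborel) + ennreal (\<epsilon> / 2)"
      by simp
    then have "ennreal m + ennreal (\<epsilon> / 2) \<le>
        ((\<integral>\<^sup>+x. ennreal (indicator (halfD e) x * neumannG e x y h * \<phi> x) \<partial>lborel) + ennreal (\<epsilon> / 2)) + ennreal (\<epsilon> / 2)"
      by (rule add_right_mono)
    also have "ennreal m + ennreal (\<epsilon> / 2) = ennreal (\<phi> y)"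
      using m \<epsilon> by (subst ennreal_plus[symmetric]) (auto simp: m_def)
    also have "(\<integral>\<^sup>+x. ennreal (indicator (halfD e) x * neumannG e x y h * \<phi> x) \<partial>lborel) + ennreal (\<epsilon> / 2) + ennreal (\<epsilon> / 2) =
        (\<integral>\<^sup>+x. ennreal (indicator (halfD e) x * neumannG e x y h * \<phi> x) \<partial>lborel) + ennreal (\<epsilon> * indicator K y)"
      using True \<epsilon> by (simp add: add.assoc ennreal_plus[symmetric] del: ennreal_plus)
    finally show ?thesis .
  qed
  then show ?thesis using that h0(1) by blast
qed

text \<open>\<open>Inf S\<close> is the upper limit of \<open>f\<close> at 0. Almost monotonicity
  puts \<open>f t + \<epsilon>\<close> into \<open>S\<close> for all small \<open>t\<close>, so
  \<open>f t\<close> cannot fall below that upper limit by more than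
  \<open>\<epsilon>\<close>.\<close>

lemma almost_mono_tendsto_at_right:
  fixes f :: "real \<Rightarrow> real"
  assumes am: "\<And>\<epsilon>. 0 < \<epsilon> \<Longrightarrow> \<exists>h>0. \<forall>s t. 0 < s \<longrightarrow> s < t \<longrightarrow> t < h \<longrightarrow> f s \<le> f t + \<epsilon>"
    and lb: "\<exists>h>0. \<forall>t. 0 < t \<longrightarrow> t < h \<longrightarrow> 0 \<le> f t"
  shows "\<exists>l. (f \<longlongrightarrow> l) (at_right 0)"
proof -
  define S where "S = {c. eventually (\<lambda>t. f t \<le> c) (at_right 0)}"
  have S_I: "f t + \<epsilon> \<in> S" if "0 < t" "\<And>s. 0 < s \<Longrightarrow> s < t \<Longrightarrow> f s \<le> f t + \<epsilon>" for t \<epsilon>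
    using that unfolding S_def eventually_at_right_field by auto
  obtain h1 where h1: "0 < h1" "\<And>s t. 0 < s \<Longrightarrow> s < t \<Longrightarrow> t < h1 \<Longrightarrow> f s \<le> f t + 1"
    using am[of 1] by auto
  have "f (h1 / 2) + 1 \<in> S" using h1 by (intro S_I) auto
  then have S_ne: "S \<noteq> {}" by blast
  have "0 \<le> c" if cS: "c \<in> S" for c
  proof -
    obtain h where "0 < h" "\<And>t. 0 < t \<Longrightarrow> t < h \<Longrightarrow> 0 \<le> f t" using lb by blast
    moreover obtain h' where "0 < h'" "\<And>t. 0 < t \<Longrightarrow> t < h' \<Longrightarrow> f t \<le> c"
      using cS unfolding S_def eventually_at_right_field by auto
    ultimately have "0 \<le> f (min h h' / 2)" "f (min h h' / 2) \<le> c" by auto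
    then show ?thesis by linarith
  qed
  then have S_bdd: "bdd_below S" by (auto simp: bdd_below_def)
  have "(f \<longlongrightarrow> Inf S) (at_right 0)"
  proof (rule order_tendstoI)
    fix a assume a: "a < Inf S"
    obtain h where h: "0 < h" "\<And>s t. 0 < s \<Longrightarrow> s < t \<Longrightarrow> t < h \<Longrightarrow> f s \<le> f t + (Inf S - a) / 2"
      using am[of "(Inf S - a) / 2"] a by auto
    have "a < f t" if "0 < t" "t < h" for t
    proof -
      have "Inf S \<le> f t + (Inf S - a) / 2"
        using that h by (intro cInf_lower S_bdd S_I) auto
      then show ?thesis using a by (simp add: field_simps)
    qed
    then show "eventually (\<lambda>t. a < f t) (at_right 0)"
      using h(1) unfolding eventually_at_right_field by auto
  next
    fix a assume "Inf S < a"
    then obtain c where c: "c \<in> S" "c < a" using cInf_lessD[OF S_ne] by blast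
    then show "eventually (\<lambda>t. f t < a) (at_right 0)"
      unfolding S_def by (auto elim: eventually_mono)
  qed
  then show ?thesis by blast
qed

context
  fixes e :: "'n::finite" and p T :: real and u :: "real^'n \<Rightarrow> real \<Rightarrow> real"
  assumes sol: "is_solution e p T u" and T: "0 < T"
begin

lemma solution_slice_continuous: "0 < t \<Longrightarrow> t < T \<Longrightarrow> continuous_on (halfD e) (\<lambda>x. u x t)"
proof -
  assume t: "0 < t" "t < T"
  have "continuous_on (halfD e \<times> {0<..<T}) (\<lambda>z. u (fst z) (snd z))"
    using sol by (simp add: is_solution_def split_def)
  then have "continuous_on (halfD e) ((\<lambda>z. u (fst z) (snd z)) \<circ> (\<lambda>x. (x, t)))"
    using t by (intro continuous_on_compose) (auto intro!: continuous_intros elim: continuous_on_subset)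
  then show ?thesis by (simp add: o_def)
qed

lemma solution_slice_measurable:
  "0 < t \<Longrightarrow> t < T \<Longrightarrow> (\<lambda>x. indicator (halfD e) x * u x t) \<in> borel_measurable borel"
  using borel_measurable_continuous_on_indicator[OF halfD_borel solution_slice_continuous, of t] by simp

lemma solution_slice_integrable:
  assumes t: "0 < t" "t < T" and \<phi>: "\<phi> \<in> C0"
  shows "integrable lborel (\<lambda>y. indicator (halfD e) y * u y t * \<phi> y)"
proof -
  obtain K where K: "compact K" "continuous_on UNIV \<phi>" "\<And>x. x \<notin> K \<Longrightarrow> \<phi> x = 0"
    using \<phi> by (auto simp: C0_def)
  have "integrable lborel (\<lambda>x. indicator (halfD e \<inter> K) x *\<^sub>R (u x t * \<phi> x))"
    by (intro borel_integrable_compact closed_Int_compact halfD_closed K continuous_on_mult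
        continuous_on_subset[OF solution_slice_continuous[OF t]] continuous_on_subset[OF K(2)]) auto
  also have "(\<lambda>x. indicator (halfD e \<inter> K) x *\<^sub>R (u x t * \<phi> x)) = (\<lambda>y. indicator (halfD e) y * u y t * \<phi> y)"
    using K(3) by (auto simp: indicator_def fun_eq_iff)
  finally show ?thesis .
qed

text \<open>Finiteness of \<open>u\<close> at the origin and the time \<open>T / 2\<close> suffices:
  the kernel is bounded below on \<open>K\<close> uniformly for early times, so the linear part of
  the Duhamel formula controls the mass there.\<close>

lemma solution_local_mass:
  assumes K: "bounded K"
  obtains B t0 where "0 \<le> B" "0 < t0" "t0 < T" "\<And>\<tau>. 0 < \<tau> \<Longrightarrow> \<tau> < t0 \<Longrightarrow>
    (\<integral>\<^sup>+y. ennreal (indicator (halfD e \<inter> K) y * u y \<tau>) \<partial>lborel) \<le> ennreal B"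
proof -
  obtain R where R: "\<And>x. x \<in> K \<Longrightarrow> norm x \<le> R" using K by (auto simp: bounded_iff)
  define t where "t = T / 2"
  have t: "0 < t" "t < T" using T by (auto simp: t_def)
  \<comment> \<open>Kernel times \<open>t - \<tau>\<close> lie between \<open>t / 2\<close> and
    \<open>t\<close>: the prefactor is taken at \<open>t\<close>, the exponent at
    \<open>t / 2\<close>.\<close>
  define c where "c = (4 * pi * t) powr (- real CARD('n) / 2) * exp (- (R\<^sup>2 / (2 * t)))"
  have c: "0 < c" using t by (simp add: c_def)
  have 0: "0 \<in> halfD e" by (simp add: halfD_def)
  have "(\<integral>\<^sup>+y. ennreal (indicator (halfD e \<inter> K) y * u y \<tau>) \<partial>lborel) \<le> ennreal (u 0 t / c)"
    if \<tau>: "0 < \<tau>" "\<tau> < t / 2" for \<tau>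
  proof -
    have nn: "0 \<le> u y \<tau>" if "y \<in> halfD e" for y
      using solution_nonneg[OF sol that, of \<tau>] \<tau> t by simp
    have "(\<integral>\<^sup>+y. ennreal (indicator (halfD e \<inter> K) y * u y \<tau>) \<partial>lborel) \<le>
        (\<integral>\<^sup>+y. ennreal (1 / c) * ennreal (indicator (halfD e) y * neumannG e 0 y (t - \<tau>) * u y \<tau>) \<partial>lborel)"
    proof (rule nn_integral_mono)
      fix y
      have "indicator (halfD e \<inter> K) y * u y \<tau> \<le> 1 / c * (indicator (halfD e) y * neumannG e 0 y (t - \<tau>) * u y \<tau>)"
      proof (cases "y \<in> halfD e \<inter> K")
        case True
        have "(norm (0 - y))\<^sup>2 / (4 * (t - \<tau>)) \<le> R\<^sup>2 / (4 * (t / 2))"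
          using R[of y] True \<tau> by (intro frac_le power_mono) auto
        then have "c \<le> heatGamma (0 - y) (t - \<tau>)"
          unfolding c_def using \<tau> t by (intro heatGamma_ge) auto
        then have "c \<le> neumannG e 0 y (t - \<tau>)"
          using neumannG_ge_heatGamma[of 0 y "t - \<tau>" e] by simp
        then have "c * u y \<tau> \<le> neumannG e 0 y (t - \<tau>) * u y \<tau>" using nn True by (intro mult_right_mono) auto
        then show ?thesis using True c by (simp add: pos_le_divide_eq mult.commute)
      next
        case False
        then show ?thesis using c nn[of y] by (auto simp: indicator_def neumannG_nonneg)
      qed
      then show "ennreal (indicator (halfD e \<inter> K) y * u y \<tau>) \<le>
          ennreal (1 / c) * ennreal (indicator (halfD e) y * neumannG e 0 y (t - \<tau>) * u y \<tau>)"
        using c nn[of y] by (subst ennreal_mult[symmetric]) (auto simp: neumannG_nonneg indicator_def intro: ennreal_leI)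
    qed
    also have "\<dots> = ennreal (1 / c) * (\<integral>\<^sup>+y. ennreal (indicator (halfD e) y * neumannG e 0 y (t - \<tau>) * u y \<tau>) \<partial>lborel)"
    proof (rule nn_integral_cmult)
      have [measurable]: "(\<lambda>y. indicator (halfD e) y * u y \<tau>) \<in> borel_measurable borel"
        using \<tau> t by (intro solution_slice_measurable) auto
      have "(\<lambda>y. ennreal (neumannG e 0 y (t - \<tau>) * (indicator (halfD e) y * u y \<tau>))) \<in> borel_measurable lborel"
        unfolding neumannG_def by measurable
      then show "(\<lambda>y. ennreal (indicator (halfD e) y * neumannG e 0 y (t - \<tau>) * u y \<tau>)) \<in> borel_measurable lborel"
        by (simp add: mult_ac)
    qed
    also have "\<dots> \<le> ennreal (1 / c) * ennreal (u 0 t)"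
      using solution_duhamel[OF sol \<tau>(1) _ t(2) 0] \<tau> t by (intro mult_left_mono) auto
    also have "\<dots> = ennreal (u 0 t / c)"
      using c solution_nonneg[OF sol 0 t] by (subst ennreal_mult[symmetric]) auto
    finally show ?thesis .
  qed
  then show ?thesis
    using that[of "u 0 t / c" "t / 2"] c t solution_nonneg[OF sol 0 t] by auto
qed

definition slice_integral :: "(real^'n \<Rightarrow> real) \<Rightarrow> real \<Rightarrow> real" where
  "slice_integral \<phi> t = (\<integral>y. indicator (halfD e) y * u y t * \<phi> y \<partial>lborel)"

lemma slice_integral_nn:
  assumes t: "0 < t" "t < T" and \<phi>: "\<phi> \<in> C0" "\<And>x. 0 \<le> \<phi> x"
  shows "ennreal (slice_integral \<phi> t) = (\<integral>\<^sup>+y. ennreal (indicator (halfD e) y * u y t * \<phi> y) \<partial>lborel)"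
    and "0 \<le> slice_integral \<phi> t"
proof -
  have nn: "0 \<le> indicator (halfD e) y * u y t * \<phi> y" for y
    using solution_nonneg[OF sol, of y t] t \<phi>(2)[of y] by (auto simp: indicator_def)
  then show "0 \<le> slice_integral \<phi> t"
    unfolding slice_integral_def by (intro Bochner_Integration.integral_nonneg)
  show "ennreal (slice_integral \<phi> t) = (\<integral>\<^sup>+y. ennreal (indicator (halfD e) y * u y t * \<phi> y) \<partial>lborel)"
    unfolding slice_integral_def using nn by (intro nn_integral_eq_integral[symmetric] solution_slice_integrable t \<phi>) auto
qed

text \<open>The Duhamel formula is integrated against \<open>\<phi>\<close>. After exchanging the
  integrals the kernel acts on \<open>\<phi>\<close> instead of \<open>u\<close>, which loses little
  in a short time: a small multiple of the mass on \<open>K\<close>, and that mass is bounded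
  uniformly near time 0.\<close>

lemma slice_integral_almost_mono:
  assumes \<phi>: "\<phi> \<in> C0" "\<And>x. 0 \<le> \<phi> x" and \<epsilon>: "0 < \<epsilon>"
  shows "\<exists>h>0. \<forall>s t. 0 < s \<longrightarrow> s < t \<longrightarrow> t < h \<longrightarrow> slice_integral \<phi> s \<le> slice_integral \<phi> t + \<epsilon>"
proof -
  obtain K where K: "compact K" "\<And>x. x \<notin> K \<Longrightarrow> \<phi> x = 0"
    using \<phi>(1) by (auto simp: C0_def)
  obtain B t0 where B: "0 \<le> B" "0 < t0" "t0 < T" "\<And>\<tau>. 0 < \<tau> \<Longrightarrow> \<tau> < t0 \<Longrightarrow>
      (\<integral>\<^sup>+y. ennreal (indicator (halfD e \<inter> K) y * u y \<tau>) \<partial>lborel) \<le> ennreal B"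
    using solution_local_mass[OF compact_imp_bounded[OF K(1)]] by blast
  \<comment> \<open>Scaled so that \<open>\<eta>\<close> times the mass bound \<open>B\<close> is at
    most \<open>\<epsilon>\<close>, also for \<open>B = 0\<close>.\<close>
  define \<eta> where "\<eta> = \<epsilon> / (B + 1)"
  have \<eta>: "0 < \<eta>" "\<eta> * B \<le> \<epsilon>" using B(1) \<epsilon> by (auto simp: \<eta>_def field_simps)
  obtain h0 where h0: "0 < h0" "\<And>h y. 0 < h \<Longrightarrow> h < h0 \<Longrightarrow> y \<in> halfD e \<Longrightarrow>
    ennreal (\<phi> y) \<le> (\<integral>\<^sup>+x. ennreal (indicator (halfD e) x * neumannG e x y h * \<phi> x) \<partial>lborel) + ennreal (\<eta> * indicator K y)"
    using neumann_semigroup_lower[OF \<phi> K(2) \<eta>(1)] by blast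
  have "slice_integral \<phi> s \<le> slice_integral \<phi> t + \<epsilon>" if st: "0 < s" "s < t" "t < min h0 t0" for s t
  proof -
    have T': "s < T" "0 < t" "t < T" "s < t0" using st B by auto
    define v where "v y = indicator (halfD e) y * u y s" for y
    have v: "0 \<le> v y" for y using solution_nonneg[OF sol, of y s] st T' by (auto simp: v_def indicator_def)
    have [measurable]: "v \<in> borel_measurable borel" "\<phi> \<in> borel_measurable borel" "K \<in> sets borel"
      using solution_slice_measurable[OF st(1) T'(1)] C0_borel_measurable[OF \<phi>(1)] K(1)
      by (auto simp: v_def[abs_def] borel_compact)
    let ?G = "\<lambda>x y. indicator (halfD e) x * neumannG e x y (t - s) * \<phi> x"
    have [measurable]: "(\<lambda>x. ennreal (?G x y)) \<in> borel_measurable borel" for y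
      unfolding neumannG_def by measurable
    have [measurable]: "(\<lambda>y. \<integral>\<^sup>+x. ennreal (?G x y) \<partial>lborel) \<in> borel_measurable borel"
    proof (rule lborel.borel_measurable_nn_integral)
      have "(\<lambda>z. ennreal (?G (snd z) (fst z))) \<in> borel_measurable (borel \<Otimes>\<^sub>M lborel)"
        unfolding neumannG_def by measurable
      then show "(\<lambda>(y, x). ennreal (?G x y)) \<in> borel_measurable (borel \<Otimes>\<^sub>M lborel)"
        by (simp only: split_def)
    qed
    have "ennreal (slice_integral \<phi> s) = (\<integral>\<^sup>+y. ennreal (v y) * ennreal (\<phi> y) \<partial>lborel)"
      using slice_integral_nn[OF st(1) T'(1) \<phi>] v \<phi>(2) by (simp add: v_def[symmetric] ennreal_mult)
    also have "\<dots> \<le> (\<integral>\<^sup>+y. ennreal (v y) * (\<integral>\<^sup>+x. ennreal (?G x y) \<partial>lborel) + ennreal \<eta> * ennreal (indicator K y * v y) \<partial>lborel)"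
    proof (rule nn_integral_mono)
      fix y
      show "ennreal (v y) * ennreal (\<phi> y) \<le>
          ennreal (v y) * (\<integral>\<^sup>+x. ennreal (?G x y) \<partial>lborel) + ennreal \<eta> * ennreal (indicator K y * v y)"
      proof (cases "y \<in> halfD e")
        case True
        have "ennreal (v y) * ennreal (\<phi> y) \<le> ennreal (v y) * ((\<integral>\<^sup>+x. ennreal (?G x y) \<partial>lborel) + ennreal (\<eta> * indicator K y))"
          using st True by (intro mult_left_mono h0(2)) auto
        also have "\<dots> = ennreal (v y) * (\<integral>\<^sup>+x. ennreal (?G x y) \<partial>lborel) + ennreal \<eta> * ennreal (indicator K y * v y)"
          using \<eta>(1) v[of y] by (simp add: distrib_left ennreal_mult mult_ac)
        finally show ?thesis .
      qed (simp add: v_def)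
    qed
    also have "\<dots> = (\<integral>\<^sup>+y. ennreal (v y) * (\<integral>\<^sup>+x. ennreal (?G x y) \<partial>lborel) \<partial>lborel) +
        (\<integral>\<^sup>+y. ennreal \<eta> * ennreal (indicator K y * v y) \<partial>lborel)"
      by (rule nn_integral_add) measurable
    also have "(\<integral>\<^sup>+y. ennreal \<eta> * ennreal (indicator K y * v y) \<partial>lborel) \<le> ennreal \<epsilon>"
    proof -
      have "(\<integral>\<^sup>+y. ennreal \<eta> * ennreal (indicator K y * v y) \<partial>lborel) =
          ennreal \<eta> * (\<integral>\<^sup>+y. ennreal (indicator (halfD e \<inter> K) y * u y s) \<partial>lborel)"
      proof -
        have "(\<lambda>y. ennreal (indicator K y * v y)) \<in> borel_measurable lborel" by measurable
        moreover have "indicator K y * v y = indicator (halfD e \<inter> K) y * u y s" for y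
          by (auto simp: v_def indicator_def)
        ultimately show ?thesis by (simp add: nn_integral_cmult)
      qed
      also have "\<dots> \<le> ennreal \<eta> * ennreal B"
        by (intro mult_left_mono B(4) st T') auto
      also have "\<dots> = ennreal (\<eta> * B)" using \<eta>(1) B(1) by (simp add: ennreal_mult)
      also have "\<dots> \<le> ennreal \<epsilon>" by (rule ennreal_leI) fact
      finally show ?thesis .
    qed
    also have "(\<integral>\<^sup>+y. ennreal (v y) * (\<integral>\<^sup>+x. ennreal (?G x y) \<partial>lborel) \<partial>lborel) =
        (\<integral>\<^sup>+y. (\<integral>\<^sup>+x. ennreal (v y) * ennreal (?G x y) \<partial>lborel) \<partial>lborel)"
      by (intro nn_integral_cong nn_integral_cmult[symmetric]) simp
    also have "\<dots> = (\<integral>\<^sup>+x. (\<integral>\<^sup>+y. ennreal (v y) * ennreal (?G x y) \<partial>lborel) \<partial>lborel)"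
    proof (rule lborel_pair.Fubini')
      have "(\<lambda>z. ennreal (v (snd z)) * ennreal (?G (fst z) (snd z))) \<in> borel_measurable (lborel \<Otimes>\<^sub>M lborel)"
        unfolding neumannG_def by measurable
      then show "(\<lambda>(x, y). ennreal (v y) * ennreal (?G x y)) \<in> borel_measurable (lborel \<Otimes>\<^sub>M lborel)"
        by (simp only: split_def)
    qed
    \<comment> \<open>The boundary part of the Duhamel formula is nonnegative and is
      dropped.\<close>
    also have "\<dots> \<le> (\<integral>\<^sup>+x. ennreal (indicator (halfD e) x * u x t * \<phi> x) \<partial>lborel)"
    proof (rule nn_integral_mono)
      fix x
      show "(\<integral>\<^sup>+y. ennreal (v y) * ennreal (?G x y) \<partial>lborel) \<le> ennreal (indicator (halfD e) x * u x t * \<phi> x)"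
      proof (cases "x \<in> halfD e")
        case True
        have "(\<integral>\<^sup>+y. ennreal (v y) * ennreal (?G x y) \<partial>lborel) =
            (\<integral>\<^sup>+y. ennreal (\<phi> x) * ennreal (indicator (halfD e) y * neumannG e x y (t - s) * u y s) \<partial>lborel)"
        proof (intro nn_integral_cong)
          fix y
          have "ennreal (v y) * ennreal (?G x y) = ennreal (v y * ?G x y)"
            using v[of y] \<phi>(2)[of x] neumannG_nonneg[of e x y "t - s"] by (subst ennreal_mult) auto
          also have "v y * ?G x y = \<phi> x * (indicator (halfD e) y * neumannG e x y (t - s) * u y s)"
            using True by (simp add: v_def)
          also have "ennreal \<dots> = ennreal (\<phi> x) * ennreal (indicator (halfD e) y * neumannG e x y (t - s) * u y s)"
            using \<phi>(2)[of x] solution_nonneg[OF sol, of y s] st T' neumannG_nonneg[of e x y "t - s"]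
            by (intro ennreal_mult) (auto simp: indicator_def)
          finally show "ennreal (v y) * ennreal (?G x y) = ennreal (\<phi> x) * ennreal (indicator (halfD e) y * neumannG e x y (t - s) * u y s)" .
        qed
        also have "\<dots> = ennreal (\<phi> x) * (\<integral>\<^sup>+y. ennreal (indicator (halfD e) y * neumannG e x y (t - s) * u y s) \<partial>lborel)"
        proof (rule nn_integral_cmult)
          have "(\<lambda>y. ennreal (neumannG e x y (t - s) * v y)) \<in> borel_measurable lborel"
            unfolding neumannG_def by measurable
          then show "(\<lambda>y. ennreal (indicator (halfD e) y * neumannG e x y (t - s) * u y s)) \<in> borel_measurable lborel"
            by (simp add: v_def mult_ac)
        qed
        also have "\<dots> \<le> ennreal (\<phi> x) * ennreal (u x t)"
          using solution_duhamel[OF sol st(1,2) T'(3) True] by (intro mult_left_mono) auto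
        also have "\<dots> = ennreal (indicator (halfD e) x * u x t * \<phi> x)"
          using True \<phi>(2)[of x] solution_nonneg[OF sol True T'(2,3)] by (simp add: ennreal_mult mult.commute)
        finally show ?thesis .
      qed simp
    qed
    also have "\<dots> = ennreal (slice_integral \<phi> t)"
      by (rule slice_integral_nn(1)[OF T'(2,3) \<phi>, symmetric])
    finally have "ennreal (slice_integral \<phi> s) \<le> ennreal (slice_integral \<phi> t) + ennreal \<epsilon>"
      by (simp add: add_right_mono add_left_mono)
    also have "\<dots> = ennreal (slice_integral \<phi> t + \<epsilon>)"
      using slice_integral_nn(2)[OF T'(2,3) \<phi>] \<epsilon> by (intro ennreal_plus[symmetric]) auto
    finally show ?thesis
      using slice_integral_nn(2)[OF T'(2,3) \<phi>] \<epsilon> by (subst (asm) ennreal_le_iff) auto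
  qed
  then show ?thesis using h0(1) B(2) by (intro exI[of _ "min h0 t0"]) auto
qed

lemma slice_integral_add:
  "0 < t \<Longrightarrow> t < T \<Longrightarrow> f \<in> C0 \<Longrightarrow> g \<in> C0 \<Longrightarrow>
    slice_integral (\<lambda>x. f x + g x) t = slice_integral f t + slice_integral g t"
  unfolding slice_integral_def by (simp add: distrib_left solution_slice_integrable)

lemma slice_integral_scale:
  "slice_integral (\<lambda>x. c * f x) t = c * slice_integral f t"
  unfolding slice_integral_def by (simp add: mult.left_commute)

lemma slice_integral_tendsto:
  assumes \<phi>: "\<phi> \<in> C0"
  shows "\<exists>l. (slice_integral \<phi> \<longlongrightarrow> l) (at_right 0)"
proof -
  have pos: "\<exists>l. (slice_integral \<psi> \<longlongrightarrow> l) (at_right 0)" if "\<psi> \<in> C0" "\<And>x. 0 \<le> \<psi> x" for \<psi>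
    using slice_integral_almost_mono[OF that] slice_integral_nn(2)[OF _ _ that] T
    by (intro almost_mono_tendsto_at_right) auto
  define f where "f x = max (\<phi> x) 0" for x
  define g where "g x = max (- \<phi> x) 0" for x
  have C: "f \<in> C0" "g \<in> C0"
    unfolding f_def g_def
    by (rule C0_comp_continuous[OF \<phi>, of "\<lambda>y. max y 0"] C0_comp_continuous[OF \<phi>, of "\<lambda>y. max (- y) 0"],
        auto intro!: continuous_on_max continuous_on_minus continuous_on_id continuous_on_const)+
  obtain l l' where l: "(slice_integral f \<longlongrightarrow> l) (at_right 0)" "(slice_integral g \<longlongrightarrow> l') (at_right 0)"
    using pos[OF C(1)] pos[OF C(2)] by (auto simp: f_def g_def)
  have \<phi>_eq: "\<phi> = (\<lambda>x. f x + (- 1) * g x)" by (auto simp: f_def g_def)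
  have "eventually (\<lambda>t. slice_integral f t + (- 1) * slice_integral g t = slice_integral \<phi> t) (at_right 0)"
    unfolding eventually_at_right_field
  proof (intro exI[of _ T] conjI allI impI T)
    fix t assume "0 < t" "t < T"
    then have "slice_integral (\<lambda>x. f x + (- 1) * g x) t = slice_integral f t + (- 1) * slice_integral g t"
      using slice_integral_add[OF _ _ C(1) C0_scale[OF C(2)], of t "- 1"]
      by (simp only: slice_integral_scale)
    then show "slice_integral f t + (- 1) * slice_integral g t = slice_integral \<phi> t"
      unfolding \<phi>_eq[symmetric] by (rule sym)
  qed
  moreover have "((\<lambda>t. slice_integral f t + (- 1) * slice_integral g t) \<longlongrightarrow> l + (- 1) * l') (at_right 0)"
    by (intro tendsto_intros l)
  ultimately show ?thesis by (blast intro: Lim_transform_eventually)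
qed

text \<open>The limit of the slice integrals is a positive functional, and its Riesz measure is the
  trace. The complement of the half space is not charged because test functions vanishing on the
  half space have slice integrals 0.\<close>

lemma initial_trace_exists: "\<exists>\<mu>. initial_trace e u \<mu>"
proof -
  define L where "L \<phi> = Lim (at_right 0) (slice_integral \<phi>)" for \<phi>
  have lim: "(slice_integral \<phi> \<longlongrightarrow> L \<phi>) (at_right 0)" if "\<phi> \<in> C0" for \<phi>
    using slice_integral_tendsto[OF that] tendsto_Lim[of "at_right (0::real)" "slice_integral \<phi>"]
    by (auto simp: L_def)
  have L_I: "L \<phi> = l" if "\<phi> \<in> C0" "(f \<longlongrightarrow> l) (at_right 0)" "\<And>t. 0 < t \<Longrightarrow> t < T \<Longrightarrow> slice_integral \<phi> t = f t" for \<phi> f l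
  proof (rule tendsto_unique[OF _ lim[OF that(1)]])
    have "eventually (\<lambda>t. f t = slice_integral \<phi> t) (at_right 0)"
      unfolding eventually_at_right_field using T that(3) by (intro exI[of _ T]) auto
    then show "(slice_integral \<phi> \<longlongrightarrow> l) (at_right 0)"
      by (rule Lim_transform_eventually[OF that(2)])
  qed simp
  interpret L: positive_C0_functional L
  proof
    show "L (\<lambda>x. f x + g x) = L f + L g" if "f \<in> C0" "g \<in> C0" for f g
      by (rule L_I[OF C0_add[OF that] tendsto_add[OF lim[OF that(1)] lim[OF that(2)]]])
        (rule slice_integral_add[OF _ _ that])
    show "L (\<lambda>x. c * f x) = c * L f" if "f \<in> C0" for f c
      by (rule L_I[OF C0_scale[OF that] tendsto_mult_left[OF lim[OF that]]]) (rule slice_integral_scale)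
    show "0 \<le> L f" if "f \<in> C0" "\<And>x. 0 \<le> f x" for f
    proof (rule tendsto_lowerbound[OF lim[OF that(1)]])
      show "eventually (\<lambda>t. 0 \<le> slice_integral f t) (at_right 0)"
        unfolding eventually_at_right_field using T slice_integral_nn(2)[OF _ _ that] by (intro exI[of _ T]) auto
    qed simp
  qed
  let ?\<mu> = L.riesz_measure
  have \<mu>: "radon_measure ?\<mu>" "sets ?\<mu> = sets borel"
    by (rule L.radon_riesz_measure) (rule L.sets_riesz_measure)
  \<comment> \<open>The complement is exhausted by bounded open sets, so that the approximating
    functions have compact support.\<close>
  have null: "emeasure ?\<mu> (ball 0 (real n) - halfD e) = 0" for n
  proof -
    let ?U = "ball 0 (real n) - halfD e"
    have U: "open ?U" "bounded ?U"
      by (auto intro!: open_Diff halfD_closed bounded_subset[OF bounded_ball])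
    have "(\<integral>\<^sup>+x. ennreal (approx_ind ?U k x) \<partial>?\<mu>) = 0" for k
    proof -
      have "L (approx_ind ?U k) = 0"
      proof (rule L_I[OF approx_ind_C0[OF U(2)] tendsto_const])
        fix t
        have "(\<lambda>y. indicator (halfD e) y * u y t * approx_ind ?U k y) = (\<lambda>_. 0)"
          by (auto simp: fun_eq_iff indicator_def approx_ind_outside)
        then show "slice_integral (approx_ind ?U k) t = 0" by (simp add: slice_integral_def)
      qed
      then have "(\<integral>x. approx_ind ?U k x \<partial>?\<mu>) = 0"
        using L.riesz_representation[OF approx_ind_C0[OF U(2)], of k] by simp
      then show ?thesis
        using radon_C0_integrable[OF \<mu>(1) approx_ind_C0[OF U(2)], of k]
        by (simp add: nn_integral_eq_integral approx_ind_bounds)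
    qed
    then show ?thesis using nn_integral_approx_ind_SUP[OF U(1) \<mu>(2)] by simp
  qed
  have "emeasure ?\<mu> (\<Union>n. ball 0 (real n) - halfD e) = 0"
    using null \<mu>(2) by (intro emeasure_UN_eq_0) auto
  also have "(\<Union>n. ball 0 (real n) - halfD e) = UNIV - halfD e"
    using reals_Archimedean2 by auto
  finally have "initial_trace e u ?\<mu>"
    unfolding initial_trace_def using \<mu> lim L.riesz_representation
    by (auto simp: slice_integral_def[abs_def])
  then show ?thesis by blast
qed

end

lemma initial_trace_unique:
  assumes "initial_trace e u \<mu>" "initial_trace e u \<mu>'"
  shows "\<mu> = \<mu>'"
proof (rule radon_measure_eqI)
  show "(\<integral>x. f x \<partial>\<mu>) = (\<integral>x. f x \<partial>\<mu>')" if "f \<in> C0" for f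
  proof (rule tendsto_unique)
    let ?F = "\<lambda>t. \<integral>y. indicator (halfD e) y * u y t * f y \<partial>lborel"
    show "(?F \<longlongrightarrow> (\<integral>x. f x \<partial>\<mu>)) (at_right 0)" "(?F \<longlongrightarrow> (\<integral>x. f x \<partial>\<mu>')) (at_right 0)"
      using assms that by (auto simp: initial_trace_def)
  qed simp
qed (use assms in \<open>auto simp: initial_trace_def\<close>)

theorem theorem1p1:
  fixes e :: "'n::finite" and p T :: real and u :: "real^'n \<Rightarrow> real \<Rightarrow> real"
  defines "N \<equiv> real CARD('n)"
  assumes "p > 1" and "0 < T" and "is_solution e p T u"
  shows "(\<exists>!\<mu>. initial_trace e u \<mu>) \<and>
    (\<forall>\<mu>. initial_trace e u \<mu> \<longrightarrow>
      (\<forall>\<delta>>0. \<exists>\<gamma>\<^sub>1>0.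
        (p < 1 + 1 / N \<longrightarrow>
           (\<forall>x\<in>halfD e. exp (- (1 + \<delta>) * (x $ e)\<^sup>2 / (4 * T)) * measure \<mu> (ball x (sqrt T))
              \<le> \<gamma>\<^sub>1 * T powr (N / 2 - 1 / (2 * (p - 1))))) \<and>
        (p = 1 + 1 / N \<longrightarrow>
           (\<forall>\<sigma>. 0 < \<sigma> \<and> \<sigma> < sqrt T \<longrightarrow>
             (\<forall>x\<in>halfD e. exp (- (1 + \<delta>) * (x $ e)\<^sup>2 / (4 * \<sigma>\<^sup>2)) * measure \<mu> (ball x \<sigma>)
                \<le> \<gamma>\<^sub>1 * ln (exp 1 + sqrt T / \<sigma>) powr (- N)))) \<and>
        (p > 1 + 1 / N \<longrightarrow>
           (\<forall>\<sigma>. 0 < \<sigma> \<and> \<sigma> < sqrt T \<longrightarrow>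
             (\<forall>x\<in>halfD e. exp (- (1 + \<delta>) * (x $ e)\<^sup>2 / (4 * \<sigma>\<^sup>2)) * measure \<mu> (ball x \<sigma>)
                \<le> \<gamma>\<^sub>1 * \<sigma> powr (N - 1 / (p - 1)))))))"
proof -
  have trace: "\<exists>!\<mu>. initial_trace e u \<mu>"
    using initial_trace_exists[OF assms(4,3)] initial_trace_unique by blast
  have bounds: "\<exists>\<gamma>>0.
        (p < 1 + 1 / N \<longrightarrow>
           (\<forall>x\<in>halfD e. exp (- (1 + \<delta>) * (x $ e)\<^sup>2 / (4 * T)) * measure \<mu> (ball x (sqrt T))
              \<le> \<gamma> * T powr (N / 2 - 1 / (2 * (p - 1))))) \<and>
        (p = 1 + 1 / N \<longrightarrow>
           (\<forall>\<sigma>. 0 < \<sigma> \<and> \<sigma> < sqrt T \<longrightarrow>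
             (\<forall>x\<in>halfD e. exp (- (1 + \<delta>) * (x $ e)\<^sup>2 / (4 * \<sigma>\<^sup>2)) * measure \<mu> (ball x \<sigma>)
                \<le> \<gamma> * ln (exp 1 + sqrt T / \<sigma>) powr (- N)))) \<and>
        (p > 1 + 1 / N \<longrightarrow>
           (\<forall>\<sigma>. 0 < \<sigma> \<and> \<sigma> < sqrt T \<longrightarrow>
             (\<forall>x\<in>halfD e. exp (- (1 + \<delta>) * (x $ e)\<^sup>2 / (4 * \<sigma>\<^sup>2)) * measure \<mu> (ball x \<sigma>)
                \<le> \<gamma> * \<sigma> powr (N - 1 / (p - 1)))))"
    if tr: "initial_trace e u \<mu>" and \<delta>: "0 < \<delta>" for \<mu> \<delta>
  proof (cases "p = 1 + 1 / N")
    case True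
    obtain C where "0 < C" "\<And>\<sigma> x. 0 < \<sigma> \<Longrightarrow> \<sigma> < sqrt T \<Longrightarrow> x \<in> halfD e \<Longrightarrow>
      exp (- (1 + \<delta>) * (x $ e)\<^sup>2 / (4 * \<sigma>\<^sup>2)) * measure \<mu> (ball x \<sigma>) \<le> C * ln (exp 1 + sqrt T / \<sigma>) powr (- N)"
      using trace_ball_bound_critical[OF assms(4) tr _ \<delta> assms(3)] True unfolding N_def by blast
    then show ?thesis
      using True by (intro exI[of _ C]) auto
  next
    case False
    obtain C where C: "0 < C" "\<And>\<sigma> x. 0 < \<sigma> \<Longrightarrow> \<sigma>\<^sup>2 \<le> T \<Longrightarrow> x \<in> halfD e \<Longrightarrow>
      exp (- (1 + \<delta>) * (x $ e)\<^sup>2 / (4 * \<sigma>\<^sup>2)) * measure \<mu> (ball x \<sigma>) \<le> C * \<sigma> powr (N - 1 / (p - 1))"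
      using trace_ball_bound[OF assms(4) tr assms(2) \<delta>] unfolding N_def by blast
    \<comment> \<open>The subcritical estimate is the general one at the end point
      \<open>\<sigma> = sqrt T\<close>.\<close>
    have "sqrt T powr (N - 1 / (p - 1)) = T powr (N / 2 - 1 / (2 * (p - 1)))"
      using assms(2,3) by (simp add: powr_half_sqrt[symmetric] powr_powr right_diff_distrib)
    then have "exp (- (1 + \<delta>) * (x $ e)\<^sup>2 / (4 * T)) * measure \<mu> (ball x (sqrt T))
        \<le> C * T powr (N / 2 - 1 / (2 * (p - 1)))" if "x \<in> halfD e" for x
      using C(2)[of "sqrt T" x] that assms(3) by simp
    moreover have "\<sigma>\<^sup>2 \<le> T" if "0 < \<sigma>" "\<sigma> < sqrt T" for \<sigma>
      using power_mono[of \<sigma> "sqrt T" 2] that assms(3) by simp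
    ultimately show ?thesis
      using False C by (intro exI[of _ C]) auto
  qed
  show ?thesis
    using trace bounds by blast
qed

end
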